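(* Let $V'$ be an immediate extension of a valuation ring $V$, $K\subset K'$ their fraction field extension, $v=(v_j)_{j<\lambda}$ a pseudo-convergent sequence in $V$ which is not fundamental and has a pseudo limit $x$ in $V'$, but having no pseudo limit in $K$, and suppose $K'=K(x)$. Assume $x$ is transcendental over $K$ and either $\dim V=1$, or $V$ is Henselian. Then the following statements are equivalent: \begin{enumerate} \item for every polynomial $f\in V[X]$ with $f(x)\not =0$ there exists a $y\in V$ such that $\mathrm{val}(f(y))= \mathrm{val}(f(x))$, \item for every polynomial $f\in V[X]$ with $f(x)\not =0$ there exists a $y\in V$ such that $\mathrm{val}(f(y))\geq \mathrm{val}(f(x))$, \item $v$ is transcendental, \item $V'$ is a filtered union of its localizations of polynomial $V$-subalgebras in one variable. \end{enumerate}
   Context: $\mathrm{val}$ is the valuation with value group $\Gamma$. $v$ is pseudo convergent if $\mathrm{val}(v_i-v_{i''})<\mathrm{val}(v_{i'}-v_{i''})$ for $i<i'<i''<\lambda$; $x$ is a pseudo limit if $\mathrm{val}(x-v_i)=\mathrm{val}(v_i-v_{i'})$ for $i<i'<\lambda$; $v$ is fundamental if for every $\gamma\in\Gamma$, $\mathrm{val}(v_i-v_{i'})>\gamma$ for large $i<i'<\lambda$; $v$ is transcendental if each $f\in V[T]$ satisfies $\mathrm{val}(f(v_i))=\mathrm{val}(f(v_{i'}))$ for large enough $i<i'<\lambda$. *)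

theory Defs
  imports "HOL-Computational_Algebra.Polynomial"
begin

text \<open>Valuations take values in an ordered abelian group 'g extended by infinity;
  None represents the value infinity (the value of 0).\<close>

fun vle :: "'g::linorder option \<Rightarrow> 'g option \<Rightarrow> bool" where
  "vle _ None = True"
| "vle None (Some _) = False"
| "vle (Some a) (Some b) = (a \<le> b)"

definition vless :: "'g::linorder option \<Rightarrow> 'g option \<Rightarrow> bool" where
  "vless a b \<longleftrightarrow> vle a b \<and> \<not> vle b a"

fun vplus :: "'g::plus option \<Rightarrow> 'g option \<Rightarrow> 'g option" where
  "vplus (Some a) (Some b) = Some (a + b)"
| "vplus _ _ = None"

definition subfield :: "'a::field set \<Rightarrow> bool" where
  "subfield F \<longleftrightarrow> 0 \<in> F \<and> 1 \<in> F \<and>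
     (\<forall>a\<in>F. \<forall>b\<in>F. a + b \<in> F \<and> a * b \<in> F \<and> - a \<in> F) \<and>
     (\<forall>a\<in>F. a \<noteq> 0 \<longrightarrow> inverse a \<in> F)"

definition field_adjoin :: "'a::field set \<Rightarrow> 'a \<Rightarrow> 'a set" where
  "field_adjoin K x = \<Inter> {F. subfield F \<and> K \<subseteq> F \<and> x \<in> F}"

definition valuation_on :: "'a::field set \<Rightarrow> ('a \<Rightarrow> 'g::linordered_ab_group_add option) \<Rightarrow> bool" where
  "valuation_on F val \<longleftrightarrow>
     (\<forall>a\<in>F. val a = None \<longleftrightarrow> a = 0) \<and>
     (\<forall>a\<in>F. \<forall>b\<in>F. val (a * b) = vplus (val a) (val b)) \<and>
     (\<forall>a\<in>F. \<forall>b\<in>F. vle (val a) (val (a + b)) \<or> vle (val b) (val (a + b)))"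

definition poly_over :: "'a::comm_ring_1 set \<Rightarrow> 'a poly \<Rightarrow> bool" where
  "poly_over R p \<longleftrightarrow> (\<forall>n. coeff p n \<in> R)"

definition transcendental_over :: "'a::field set \<Rightarrow> 'a \<Rightarrow> bool" where
  "transcendental_over R z \<longleftrightarrow> (\<forall>p. poly_over R p \<and> p \<noteq> 0 \<longrightarrow> poly p z \<noteq> 0)"

text \<open>Sequences indexed by an ordinal \<lambda>, represented by a well-ordered index type 'i.\<close>
definition pseudo_convergent :: "('a \<Rightarrow> 'g::linorder option) \<Rightarrow> ('i::wellorder \<Rightarrow> 'a::ab_group_add) \<Rightarrow> bool" where
  "pseudo_convergent val v \<longleftrightarrow>
     (\<forall>i i' i''. i < i' \<and> i' < i'' \<longrightarrow> vless (val (v i - v i'')) (val (v i' - v i'')))"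

definition pseudo_limit :: "('a \<Rightarrow> 'g::linorder option) \<Rightarrow> ('i::wellorder \<Rightarrow> 'a::ab_group_add) \<Rightarrow> 'a \<Rightarrow> bool" where
  "pseudo_limit val v x \<longleftrightarrow> (\<forall>i i'. i < i' \<longrightarrow> val (x - v i) = val (v i - v i'))"

definition fundamental :: "'g::linorder set \<Rightarrow> ('a \<Rightarrow> 'g option) \<Rightarrow> ('i::wellorder \<Rightarrow> 'a::ab_group_add) \<Rightarrow> bool" where
  "fundamental \<Gamma> val v \<longleftrightarrow>
     (\<forall>\<gamma>\<in>\<Gamma>. \<exists>i0. \<forall>i i'. i0 \<le> i \<and> i < i' \<longrightarrow> vless (Some \<gamma>) (val (v i - v i')))"

definition transcendental_seq :: "'a set \<Rightarrow> ('a \<Rightarrow> 'g::linorder option) \<Rightarrow> ('i::wellorder \<Rightarrow> 'a::field) \<Rightarrow> bool" where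
  "transcendental_seq V val v \<longleftrightarrow>
     (\<forall>f. poly_over V f \<longrightarrow>
        (\<exists>i0. \<forall>i i'. i0 \<le> i \<and> i < i' \<longrightarrow> val (poly f (v i)) = val (poly f (v i'))))"

definition ideal_of :: "'a::comm_ring_1 set \<Rightarrow> 'a set \<Rightarrow> bool" where
  "ideal_of V I \<longleftrightarrow> I \<subseteq> V \<and> 0 \<in> I \<and> (\<forall>a\<in>I. \<forall>b\<in>I. a + b \<in> I \<and> - a \<in> I) \<and>
     (\<forall>r\<in>V. \<forall>a\<in>I. r * a \<in> I)"

definition prime_ideal_of :: "'a::comm_ring_1 set \<Rightarrow> 'a set \<Rightarrow> bool" where
  "prime_ideal_of V P \<longleftrightarrow> ideal_of V P \<and> P \<noteq> V \<and>
     (\<forall>a\<in>V. \<forall>b\<in>V. a * b \<in> P \<longrightarrow> a \<in> P \<or> b \<in> P)"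

definition krull_dim_one :: "'a::comm_ring_1 set \<Rightarrow> bool" where
  "krull_dim_one V \<longleftrightarrow>
     (\<exists>P Q. prime_ideal_of V P \<and> prime_ideal_of V Q \<and> P \<subset> Q) \<and>
     \<not> (\<exists>P Q R. prime_ideal_of V P \<and> prime_ideal_of V Q \<and> prime_ideal_of V R \<and> P \<subset> Q \<and> Q \<subset> R)"

definition henselian :: "'a::field set \<Rightarrow> 'a set \<Rightarrow> bool" where
  "henselian V m \<longleftrightarrow>
     (\<forall>f a. poly_over V f \<and> lead_coeff f = 1 \<and> a \<in> V \<and> poly f a \<in> m \<and> poly (pderiv f) a \<notin> m \<longrightarrow>
        (\<exists>b\<in>V. poly f b = 0 \<and> b - a \<in> m))"

definition poly_subalg :: "'a::field set \<Rightarrow> 'a \<Rightarrow> 'a set" where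
  "poly_subalg V z = {poly p z | p. poly_over V p}"

definition is_loc_poly_subalg :: "'a::field set \<Rightarrow> 'a set \<Rightarrow> bool" where
  "is_loc_poly_subalg V R \<longleftrightarrow>
     (\<exists>z S. transcendental_over V z \<and> S \<subseteq> poly_subalg V z \<and> 1 \<in> S \<and> 0 \<notin> S \<and>
        (\<forall>s\<in>S. \<forall>t\<in>S. s * t \<in> S) \<and>
        R = {a / s | a s. a \<in> poly_subalg V z \<and> s \<in> S})"

definition filtered_union_loc_poly :: "'a::field set \<Rightarrow> 'a set \<Rightarrow> bool" where
  "filtered_union_loc_poly V V' \<longleftrightarrow>
     (\<exists>F. F \<noteq> {} \<and> (\<forall>R\<in>F. is_loc_poly_subalg V R \<and> R \<subseteq> V') \<and>
        (\<forall>R1\<in>F. \<forall>R2\<in>F. \<exists>R3\<in>F. R1 \<union> R2 \<subseteq> R3) \<and> \<Union>F = V')"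

end

theory Submission
  imports "HOL-Algebra.Algebraic_Closure_Type" Defs
begin

text \<open>
  For a polynomial f over K, one monomial of the Taylor expansion of f at x eventually dominates
  f(v i) - f(x) (Kaplansky). Hence val (f (v i)) is either eventually equal to val (f x), or eventually
  strictly increasing and below val (f x). In the first case f(x) is, for large i, a constant times a unit of
  V[(x - v i) / u i] with val (u i) = val (x - v i), which gives the filtered union; conversely, a point of
  V' in a localization of V[z] is specialized by replacing z with an element of V in the same residue class.

  The remaining implication is proved by contradiction. Let f be of minimal degree with val (f (v i))
  increasing, and let y in V be as in (2). As y is not a pseudo limit, x and almost all v i have the
  same distance to y; rescaling f around y with that distance gives a primitive h in V[T] whose
  reduction is divisible by T but not a scalar multiple of the leading monomial. If dim V = 1, a linear
  Hensel iteration factors h up to an arbitrarily small error. If V is henselian, h factors exactly: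
  writing h = c (T - a 1) ... (T - a n) and letting k be the multiplicity of the root 0 of the reduction,
  the polynomial with roots the c-fold products of n - k of the a i has coefficients in V and
  reduction with one simple nonzero root, so one such product lies in K; repeating this after
  translating by elements of the maximal ideal and interpolating gives a factor of h. In both cases one
  factor contradicts the minimality of f.
\<close>

section \<open>Integral polynomial functions and symmetric functions of roots\<close>

text \<open>Two obstacles shape the henselian case. First, \<open>henselian\<close> lifts simple
  roots of monic polynomials, while \<open>h\<close> may have its leading coefficient in the maximal
  ideal, so that its roots need not be integral. Hence products of roots carry the factor c, and the
  coefficients of the polynomial formed from these products must be integer polynomials in the
  coefficients of \<open>h\<close>, without division by c. Products of n - k roots are taken because
  modulo m one may replace \<open>h\<close> by a multiple of T^k: any other choice of n - k roots
  then contains the root 0. Second, such a product is only one value of a factor of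
  \<open>h\<close>, and the subset of roots may change under translation; as there are finitely many
  subsets, one of them serves infinitely many translations. In dimension 1 an approximate
  factorization is enough because val (f (v i)) stays strictly below val (f x): a perturbation of
  value above the rescaled val (f x) is not noticed by the values along v. These are then the values
  of a product of two polynomials of smaller degree, which are eventually constant.\<close>

text \<open>Integer polynomials in n variables, modelled by the functions they induce on sequences.\<close>

inductive_set pfun :: "nat \<Rightarrow> ((nat \<Rightarrow> 'b::comm_ring_1) \<Rightarrow> 'b) set" for n where
  one: "(\<lambda>_. 1) \<in> pfun n"
| var: "i < n \<Longrightarrow> (\<lambda>\<alpha>. \<alpha> i) \<in> pfun n"
| add: "F \<in> pfun n \<Longrightarrow> G \<in> pfun n \<Longrightarrow> (\<lambda>\<alpha>. F \<alpha> + G \<alpha>) \<in> pfun n"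
| mult: "F \<in> pfun n \<Longrightarrow> G \<in> pfun n \<Longrightarrow> (\<lambda>\<alpha>. F \<alpha> * G \<alpha>) \<in> pfun n"
| neg: "F \<in> pfun n \<Longrightarrow> (\<lambda>\<alpha>. - F \<alpha>) \<in> pfun n"

lemma pfun_zero: "(\<lambda>_. 0) \<in> pfun n"
  using pfun.add[OF pfun.one pfun.neg[OF pfun.one]] by simp

lemma pfun_diff: "F \<in> pfun n \<Longrightarrow> G \<in> pfun n \<Longrightarrow> (\<lambda>\<alpha>. F \<alpha> - G \<alpha>) \<in> pfun n"
  using pfun.add[OF _ pfun.neg, of F n G] by simp

lemma pfun_sum: "(\<And>i. i \<in> I \<Longrightarrow> F i \<in> pfun n) \<Longrightarrow> (\<lambda>\<alpha>. \<Sum>i\<in>I. F i \<alpha>) \<in> pfun n"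
  by (induction I rule: infinite_finite_induct) (auto intro: pfun_zero pfun.add)

lemma pfun_prod: "(\<And>i. i \<in> I \<Longrightarrow> F i \<in> pfun n) \<Longrightarrow> (\<lambda>\<alpha>. \<Prod>i\<in>I. F i \<alpha>) \<in> pfun n"
  by (induction I rule: infinite_finite_induct) (auto intro: pfun.one pfun.mult)

lemma pfun_power: "F \<in> pfun n \<Longrightarrow> (\<lambda>\<alpha>. F \<alpha> ^ k) \<in> pfun n"
  by (induction k) (auto intro: pfun.one pfun.mult)

lemma pfun_cong:
  assumes "F \<in> pfun n" "\<And>i. i < n \<Longrightarrow> \<alpha> i = \<beta> i"
  shows "F \<alpha> = F \<beta>"
  using assms(1) by induction (auto simp: assms(2))

lemma pfun_mono:
  assumes "F \<in> pfun n" "n \<le> m"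
  shows "F \<in> pfun m"
  using assms(1) by induction (use assms(2) in \<open>auto intro: pfun.intros\<close>)

lemma pfun_subst:
  assumes "F \<in> pfun n" "\<And>i. i < n \<Longrightarrow> G i \<in> pfun m"
  shows "(\<lambda>\<alpha>. F (\<lambda>i. G i \<alpha>)) \<in> pfun m"
  using assms(1) by induction (use assms(2) in \<open>auto intro: pfun.intros\<close>)

lemma pfun_closed:
  assumes "F \<in> pfun n"
    and "1 \<in> A" "\<And>a b. a \<in> A \<Longrightarrow> b \<in> A \<Longrightarrow> a + b \<in> A" "\<And>a b. a \<in> A \<Longrightarrow> b \<in> A \<Longrightarrow> a * b \<in> A"
      "\<And>a. a \<in> A \<Longrightarrow> - a \<in> A"
    and "\<And>i. i < n \<Longrightarrow> \<alpha> i \<in> A"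
  shows "F \<alpha> \<in> A"
  using assms(1) by induction (use assms(2-) in auto)

text \<open>Replaces a reduction homomorphism: with A = V and I = m embedded in the algebraic
  closure, it compares two evaluations modulo m without forming a quotient.\<close>

lemma pfun_cong_ideal:
  assumes "F \<in> pfun n"
    and "1 \<in> A" "\<And>a b. a \<in> A \<Longrightarrow> b \<in> A \<Longrightarrow> a + b \<in> A" "\<And>a b. a \<in> A \<Longrightarrow> b \<in> A \<Longrightarrow> a * b \<in> A"
      "\<And>a. a \<in> A \<Longrightarrow> - a \<in> A"
    and "0 \<in> I" "\<And>a b. a \<in> I \<Longrightarrow> b \<in> I \<Longrightarrow> a + b \<in> I" "\<And>a b. a \<in> A \<Longrightarrow> b \<in> I \<Longrightarrow> a * b \<in> I"
      "\<And>a. a \<in> I \<Longrightarrow> - a \<in> I"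
    and "\<And>i. i < n \<Longrightarrow> \<alpha> i \<in> A" "\<And>i. i < n \<Longrightarrow> \<beta> i \<in> A" "\<And>i. i < n \<Longrightarrow> \<alpha> i - \<beta> i \<in> I"
  shows "F \<alpha> - F \<beta> \<in> I"
  using assms(1)
proof induction
  case (add F G)
  have "F \<alpha> + G \<alpha> - (F \<beta> + G \<beta>) = (F \<alpha> - F \<beta>) + (G \<alpha> - G \<beta>)" by simp
  with add assms(7) show ?case by metis
next
  case (mult F G)
  have "G \<alpha> \<in> A" "F \<beta> \<in> A"
    using mult pfun_closed[of _ n A] assms(2-5,10,11) by blast+
  moreover have "F \<alpha> * G \<alpha> - F \<beta> * G \<beta> = G \<alpha> * (F \<alpha> - F \<beta>) + F \<beta> * (G \<alpha> - G \<beta>)"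
    by (simp add: algebra_simps)
  ultimately show ?case using mult assms(7,8) by metis
next
  case (neg F)
  have "- F \<alpha> - - F \<beta> = - (F \<alpha> - F \<beta>)" by simp
  with neg assms(9) show ?case by metis
qed (use assms in auto)

text \<open>Restriction to a curve with polynomial coordinates. Density arguments in several
  variables thereby become the identity theorem for polynomials in one variable.\<close>

lemma pfun_along_polys:
  assumes "F \<in> pfun n"
  shows "\<exists>p. \<forall>s. F (\<lambda>i. poly (A i) s) = poly p s"
  using assms
proof induction
  case one
  show ?case by (rule exI[of _ 1]) simp
next
  case (var i)
  show ?case by blast
next
  case (add F G)
  then obtain p q where "\<forall>s. F (\<lambda>i. poly (A i) s) = poly p s" "\<forall>s. G (\<lambda>i. poly (A i) s) = poly q s"
    by blast
  then show ?case by (intro exI[of _ "p + q"]) simp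
next
  case (mult F G)
  then obtain p q where "\<forall>s. F (\<lambda>i. poly (A i) s) = poly p s" "\<forall>s. G (\<lambda>i. poly (A i) s) = poly q s"
    by blast
  then show ?case by (intro exI[of _ "p * q"]) simp
next
  case (neg F)
  then obtain p where "\<forall>s. F (\<lambda>i. poly (A i) s) = poly p s" by blast
  then show ?case by (intro exI[of _ "- p"]) simp
qed

section \<open>Polynomials whose coefficients are integer polynomials in n variables\<close>

definition pfun_poly :: "nat \<Rightarrow> ((nat \<Rightarrow> 'b::comm_ring_1) \<Rightarrow> 'b poly) set" where
  "pfun_poly n = {\<Phi>. \<forall>j. (\<lambda>\<alpha>. coeff (\<Phi> \<alpha>) j) \<in> pfun n}"

lemma pfun_poly_coeff: "\<Phi> \<in> pfun_poly n \<Longrightarrow> (\<lambda>\<alpha>. coeff (\<Phi> \<alpha>) j) \<in> pfun n"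
  by (simp add: pfun_poly_def)

lemma pfun_poly_add: "\<Phi> \<in> pfun_poly n \<Longrightarrow> \<Psi> \<in> pfun_poly n \<Longrightarrow> (\<lambda>\<alpha>. \<Phi> \<alpha> + \<Psi> \<alpha>) \<in> pfun_poly n"
  by (auto simp: pfun_poly_def intro: pfun.add)

lemma pfun_poly_neg: "\<Phi> \<in> pfun_poly n \<Longrightarrow> (\<lambda>\<alpha>. - \<Phi> \<alpha>) \<in> pfun_poly n"
  by (auto simp: pfun_poly_def intro: pfun.neg)

lemma pfun_poly_mult: "\<Phi> \<in> pfun_poly n \<Longrightarrow> \<Psi> \<in> pfun_poly n \<Longrightarrow> (\<lambda>\<alpha>. \<Phi> \<alpha> * \<Psi> \<alpha>) \<in> pfun_poly n"
  by (auto simp: pfun_poly_def coeff_mult intro!: pfun_sum pfun.mult)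

lemma pfun_poly_0: "(\<lambda>_. 0) \<in> pfun_poly n"
  by (auto simp: pfun_poly_def intro: pfun_zero)

lemma pfun_poly_pCons:
  assumes "F \<in> pfun n" "\<Phi> \<in> pfun_poly n"
  shows "(\<lambda>\<alpha>. pCons (F \<alpha>) (\<Phi> \<alpha>)) \<in> pfun_poly n"
  unfolding pfun_poly_def
proof safe
  fix j show "(\<lambda>\<alpha>. coeff (pCons (F \<alpha>) (\<Phi> \<alpha>)) j) \<in> pfun n"
    using assms by (cases j) (auto simp: pfun_poly_def)
qed

lemma pfun_poly_1: "(\<lambda>_. 1) \<in> pfun_poly n"
  using pfun_poly_pCons[OF pfun.one pfun_poly_0] by (simp add: one_pCons)

lemma pfun_poly_prod: "(\<And>i. i \<in> I \<Longrightarrow> \<Phi> i \<in> pfun_poly n) \<Longrightarrow> (\<lambda>\<alpha>. \<Prod>i\<in>I. \<Phi> i \<alpha>) \<in> pfun_poly n"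
  by (induction I rule: infinite_finite_induct) (auto intro: pfun_poly_1 pfun_poly_mult)

lemma pfun_poly_linear: "F \<in> pfun n \<Longrightarrow> (\<lambda>\<alpha>. [:- F \<alpha>, 1:]) \<in> pfun_poly n"
  by (intro pfun_poly_pCons pfun.neg pfun.one pfun_poly_0)

text \<open>The isomorphism of Z[X_0, ..., X_n] with Z[X_0, ..., X_{n-1}][X_n]. Membership in
  \<open>pfun_poly\<close> bounds no degree, so the uniform bound \<open>d\<close> is supplied here;
  it makes the expansion a finite sum whose range is independent of \<alpha>.\<close>

lemma pfun_expand_last:
  assumes "F \<in> pfun (Suc n)"
  shows "\<exists>\<Phi>\<in>pfun_poly n. \<exists>d. \<forall>\<alpha>. degree (\<Phi> \<alpha>) \<le> d \<and> F \<alpha> = poly (\<Phi> \<alpha>) (\<alpha> n)"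
  using assms
proof induction
  case one
  show ?case by (rule bexI[of _ "\<lambda>_. 1"]) (auto intro: pfun_poly_1)
next
  case (var i)
  show ?case
  proof (cases "i = n")
    case True
    then show ?thesis
      by (intro bexI[of _ "\<lambda>_. [:0, 1:]"]) (auto intro!: pfun_poly_pCons pfun_zero pfun.one pfun_poly_0)
  next
    case False
    with var show ?thesis
      by (intro bexI[of _ "\<lambda>\<alpha>. [:\<alpha> i:]"]) (auto intro!: pfun_poly_pCons pfun.var pfun_poly_0)
  qed
next
  case (add F G)
  then obtain \<Phi> d \<Psi> e where *: "\<Phi> \<in> pfun_poly n" "\<Psi> \<in> pfun_poly n"
    "\<And>\<alpha>. degree (\<Phi> \<alpha>) \<le> d \<and> F \<alpha> = poly (\<Phi> \<alpha>) (\<alpha> n)" "\<And>\<alpha>. degree (\<Psi> \<alpha>) \<le> e \<and> G \<alpha> = poly (\<Psi> \<alpha>) (\<alpha> n)"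
    by metis
  then have "degree (\<Phi> \<alpha> + \<Psi> \<alpha>) \<le> max d e" for \<alpha>
    by (meson degree_add_le_max max.mono order_trans)
  with * show ?case
    by (intro bexI[of _ "\<lambda>\<alpha>. \<Phi> \<alpha> + \<Psi> \<alpha>"] exI[of _ "max d e"]) (auto intro: pfun_poly_add)
next
  case (mult F G)
  then obtain \<Phi> d \<Psi> e where *: "\<Phi> \<in> pfun_poly n" "\<Psi> \<in> pfun_poly n"
    "\<And>\<alpha>. degree (\<Phi> \<alpha>) \<le> d \<and> F \<alpha> = poly (\<Phi> \<alpha>) (\<alpha> n)" "\<And>\<alpha>. degree (\<Psi> \<alpha>) \<le> e \<and> G \<alpha> = poly (\<Psi> \<alpha>) (\<alpha> n)"
    by metis
  then have "degree (\<Phi> \<alpha> * \<Psi> \<alpha>) \<le> d + e" for \<alpha>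
    by (meson degree_mult_le add_mono order_trans)
  with * show ?case
    by (intro bexI[of _ "\<lambda>\<alpha>. \<Phi> \<alpha> * \<Psi> \<alpha>"] exI[of _ "d + e"]) (auto intro: pfun_poly_mult)
next
  case (neg F)
  then obtain \<Phi> d where *: "\<Phi> \<in> pfun_poly n"
    "\<And>\<alpha>. degree (\<Phi> \<alpha>) \<le> d \<and> F \<alpha> = poly (\<Phi> \<alpha>) (\<alpha> n)"
    by metis
  then show ?case
    by (intro bexI[of _ "\<lambda>\<alpha>. - \<Phi> \<alpha>"] exI[of _ d]) (auto intro: pfun_poly_neg)
qed

section \<open>Elementary symmetric functions and the fundamental theorem on symmetric
  polynomials\<close>

lemma poly_eqI_cofinite:
  fixes p q :: "'b::idom poly"
  assumes "infinite (UNIV :: 'b set)" "finite B" "\<And>s. s \<notin> B \<Longrightarrow> poly p s = poly q s"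
  shows "p = q"
proof (rule ccontr)
  assume "p \<noteq> q"
  then have "finite {s. poly (p - q) s = 0}" by (intro poly_roots_finite) simp
  moreover have "- B \<subseteq> {s. poly (p - q) s = 0}" using assms(3) by auto
  ultimately have "finite (- B)" by (rule finite_subset[rotated])
  with assms(2) have "finite (B \<union> - B)" by blast
  with assms(1) show False by simp
qed

text \<open>Up to sign its coefficients are the elementary symmetric functions, which are never
  introduced separately.\<close>

definition linprod :: "nat \<Rightarrow> (nat \<Rightarrow> 'b::comm_ring_1) \<Rightarrow> 'b poly" where
  "linprod n \<alpha> = (\<Prod>i<n. [:- \<alpha> i, 1:])"

lemma linprod_Suc: "linprod (Suc n) \<alpha> = linprod n \<alpha> * [:- \<alpha> n, 1:]"
  by (simp add: linprod_def)

lemma pfun_poly_linprod: "linprod n \<in> pfun_poly n"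
  unfolding linprod_def by (intro pfun_poly_prod pfun_poly_linear pfun.var) simp

lemma degree_linprod [simp]: "degree (linprod n (\<alpha> :: nat \<Rightarrow> 'b::idom)) = n"
  unfolding linprod_def by (subst degree_prod_eq_sum_degree) auto

lemma lead_coeff_linprod [simp]: "coeff (linprod n (\<alpha> :: nat \<Rightarrow> 'b::idom)) n = 1"
  using lead_coeff_prod[of "\<lambda>i. [:- \<alpha> i, 1:]" "{..<n}"]
  by (simp add: linprod_def[symmetric])

lemma poly_linprod_eq_0: "i < n \<Longrightarrow> poly (linprod n \<alpha>) (\<alpha> i) = 0"
  by (auto simp: linprod_def poly_prod intro!: prod_zero)

lemma linprod_transpose:
  assumes "i < n" "j < n"
  shows "linprod n (\<alpha> \<circ> Transposition.transpose i j) = linprod n \<alpha>"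
  unfolding linprod_def o_def
  by (rule prod.reindex_bij_betw[OF bij_betw_transpose_iff, of i "{..<n}" j "\<lambda>i. [:- \<alpha> i, 1:]"])
     (use assms in auto)

text \<open>Synthetic division by T - \<alpha> n, descending from the leading coefficient. Slot
  \<open>Suc n\<close> of the coefficient vector would only hold the leading coefficient 1, so it is
  reused to carry \<open>\<alpha> n\<close>.\<close>

lemma linprod_coeff_from_Suc:
  "\<exists>B. (\<forall>i. B i \<in> pfun (Suc (Suc n))) \<and>
     (\<forall>(\<alpha> :: nat \<Rightarrow> 'b::idom). \<forall>i. coeff (linprod n \<alpha>) i =
        B i (\<lambda>j. if j = Suc n then \<alpha> n else coeff (linprod (Suc n) \<alpha>) j))"
proof -
  let ?e = "\<lambda>\<alpha> :: nat \<Rightarrow> 'b. \<lambda>j. if j = Suc n then \<alpha> n else coeff (linprod (Suc n) \<alpha>) j"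
  have rec: "coeff (linprod n \<alpha>) i = coeff (linprod (Suc n) \<alpha>) (Suc i) + \<alpha> n * coeff (linprod n \<alpha>) (Suc i)"
    for \<alpha> :: "nat \<Rightarrow> 'b" and i
    by (simp add: linprod_Suc algebra_simps)
  have "\<exists>B\<in>pfun (Suc (Suc n)). \<forall>\<alpha> :: nat \<Rightarrow> 'b. coeff (linprod n \<alpha>) i = B (?e \<alpha>)" for i
  proof (induction "n - i" arbitrary: i rule: less_induct)
    case less
    consider "i > n" | "i = n" | "i < n" by linarith
    then show ?case
    proof cases
      case 1
      then have "coeff (linprod n \<alpha>) i = 0" for \<alpha> :: "nat \<Rightarrow> 'b"
        by (intro coeff_eq_0) simp
      then show ?thesis by (intro bexI[of _ "\<lambda>_. 0"]) (auto intro: pfun_zero)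
    next
      case 2
      then show ?thesis by (intro bexI[of _ "\<lambda>_. 1"]) (auto intro: pfun.one)
    next
      case 3
      then have "n - Suc i < n - i" by simp
      from less[OF this] obtain B where B: "B \<in> pfun (Suc (Suc n))"
        "\<And>\<alpha> :: nat \<Rightarrow> 'b. coeff (linprod n \<alpha>) (Suc i) = B (?e \<alpha>)" by blast
      show ?thesis
      proof (rule bexI[of _ "\<lambda>a. a (Suc i) + a (Suc n) * B a"])
        show "(\<lambda>a. a (Suc i) + a (Suc n) * B a) \<in> pfun (Suc (Suc n))"
          using 3 by (intro pfun.intros B) auto
        show "\<forall>\<alpha> :: nat \<Rightarrow> 'b. coeff (linprod n \<alpha>) i = ?e \<alpha> (Suc i) + ?e \<alpha> (Suc n) * B (?e \<alpha>)"
          using 3 by (subst rec) (auto simp: B(2))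
      qed
    qed
  qed
  then show ?thesis by metis
qed

text \<open>Remainder of T^m modulo the monic polynomial of degree n + 1 with lower coefficients
  \<open>a\<close>. It depends on these coefficients by integer polynomials because no division by a
  leading coefficient occurs.\<close>

lemma pfun_reduce_power:
  "\<exists>C. (\<forall>j. C j \<in> pfun (Suc n)) \<and>
     (\<forall>a (t :: 'b::comm_ring_1). t ^ Suc n + (\<Sum>i\<le>n. a i * t ^ i) = 0 \<longrightarrow> t ^ m = (\<Sum>j\<le>n. C j a * t ^ j))"
proof (induction m)
  case 0
  have "(\<Sum>j\<le>n. (if j = 0 then 1 else 0) * t ^ j) = (1::'b)" for t
    by (subst sum.remove[of _ 0]) (auto intro!: sum.neutral)
  then show ?case
    by (intro exI[of _ "\<lambda>j _. if j = 0 then 1 else 0"]) (auto intro: pfun.one pfun_zero)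
next
  case (Suc m)
  then obtain C where C: "\<And>j. C j \<in> pfun (Suc n)"
    "\<And>a (t :: 'b). t ^ Suc n + (\<Sum>i\<le>n. a i * t ^ i) = 0 \<Longrightarrow> t ^ m = (\<Sum>j\<le>n. C j a * t ^ j)" by blast
  define D where "D = (\<lambda>j a. (if j = 0 then 0 else C (j - 1) a) - C n a * a j)"
  have D: "(\<lambda>a. if j = 0 then 0 else C (j - 1) a) \<in> pfun (Suc n)" for j
    using C(1) by (cases "j = 0") (auto intro: pfun_zero)
  \<comment> \<open>The value 0 above n keeps every \<open>?D j\<close> an integer polynomial in n +
    1 variables; there \<open>a j\<close> is no longer one of the variables.\<close>
  let ?D = "\<lambda>j. if j \<le> n then D j else (\<lambda>_. 0)"
  have "t ^ Suc m = (\<Sum>j\<le>n. ?D j a * t ^ j)"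
    if h: "t ^ Suc n + (\<Sum>i\<le>n. a i * t ^ i) = 0" for a and t :: 'b
  proof -
    have "t ^ Suc m = (\<Sum>j\<le>n. C j a * t ^ Suc j)"
      using C(2)[OF h] by (simp add: sum_distrib_left algebra_simps)
    also have "\<dots> = (\<Sum>j\<le>Suc n. (if j = 0 then 0 else C (j - 1) a) * t ^ j)"
      by (subst sum.atMost_Suc_shift) simp
    also have "\<dots> = (\<Sum>j\<le>n. (if j = 0 then 0 else C (j - 1) a) * t ^ j) + C n a * t ^ Suc n"
      by simp
    also have "t ^ Suc n = - (\<Sum>i\<le>n. a i * t ^ i)" using h by (simp add: eq_neg_iff_add_eq_0)
    finally show ?thesis
      by (simp add: D_def sum_distrib_left left_diff_distrib sum_subtractf algebra_simps)
  qed
  moreover have "?D j \<in> pfun (Suc n)" for j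
    unfolding D_def using D C(1) by (auto intro!: pfun_diff pfun.mult pfun.var pfun_zero)
  ultimately show ?case by (intro exI[of _ ?D]) blast
qed

lemma poly_as_sum_atMost:
  fixes p :: "'b::comm_ring_1 poly"
  assumes "degree p \<le> d"
  shows "poly p t = (\<Sum>i\<le>d. coeff p i * t ^ i)"
  unfolding poly_altdef using assms by (intro sum.mono_neutral_left) (auto simp: coeff_eq_0)

text \<open>Induction on the number of variables. Expanded in the last variable, F has symmetric
  coefficients, so it becomes an integer polynomial in \<open>\<alpha> n\<close> and the
  coefficients of \<open>linprod (Suc n) \<alpha>\<close>. As \<open>\<alpha> n\<close> is a root of
  the latter, its degree in \<open>\<alpha> n\<close> can be reduced to at most n. By symmetry this
  reduced polynomial takes the value F \<alpha> at all n + 1 roots, hence it is constant when they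
  are distinct.\<close>

lemma symmetric_in_linprod_coeffs:
  fixes F :: "(nat \<Rightarrow> 'b::idom) \<Rightarrow> 'b"
  assumes inf: "infinite (UNIV :: 'b set)"
    and F: "F \<in> pfun n"
    and sym: "\<And>\<alpha> i j. i < n \<Longrightarrow> j < n \<Longrightarrow> F (\<alpha> \<circ> Transposition.transpose i j) = F \<alpha>"
  shows "\<exists>Q\<in>pfun n. \<forall>\<alpha>. F \<alpha> = Q (coeff (linprod n \<alpha>))"
  using F sym
proof (induction n arbitrary: F)
  case 0
  then show ?case by (metis pfun_cong not_less0)
next
  case (Suc n)
  obtain \<Phi> d where \<Phi>: "\<Phi> \<in> pfun_poly n" and deg: "\<And>\<alpha>. degree (\<Phi> \<alpha>) \<le> d"
    and F\<Phi>: "\<And>\<alpha>. F \<alpha> = poly (\<Phi> \<alpha>) (\<alpha> n)"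
    using pfun_expand_last[OF Suc.prems(1)] by metis
  have \<Phi>_sym: "\<Phi> (\<alpha> \<circ> Transposition.transpose i j) = \<Phi> \<alpha>" if ij: "i < n" "j < n" for \<alpha> i j
  proof (rule poly_eqI_cofinite[OF inf, of "{}"])
    fix s
    let ?\<sigma> = "Transposition.transpose i j"
    \<comment> \<open>The coefficients of \<open>\<Phi>\<close> read only entries below n, and the
      transposition moves only these, so entry n is free to be the evaluation point s.\<close>
    have indep: "\<Phi> (\<beta>(n := s)) = \<Phi> \<beta>" for \<beta>
      by (rule poly_eqI) (rule pfun_cong[OF pfun_poly_coeff[OF \<Phi>]], simp)
    have upd: "(\<alpha> \<circ> ?\<sigma>)(n := s) = \<alpha>(n := s) \<circ> ?\<sigma>"
      using ij by (auto simp: fun_eq_iff Transposition.transpose_def)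
    have "poly (\<Phi> (\<alpha> \<circ> ?\<sigma>)) s = F ((\<alpha> \<circ> ?\<sigma>)(n := s))" by (simp add: F\<Phi> indep)
    also have "\<dots> = F (\<alpha>(n := s))" unfolding upd using ij by (intro Suc.prems) auto
    also have "\<dots> = poly (\<Phi> \<alpha>) s" by (simp add: F\<Phi> indep)
    finally show "poly (\<Phi> (\<alpha> \<circ> ?\<sigma>)) s = poly (\<Phi> \<alpha>) s" .
  qed simp
  have "\<exists>Q\<in>pfun n. \<forall>\<alpha>. coeff (\<Phi> \<alpha>) j = Q (coeff (linprod n \<alpha>))" for j
    by (intro Suc.IH pfun_poly_coeff[OF \<Phi>]) (simp only: \<Phi>_sym)
  then obtain Q where Q: "\<And>j. Q j \<in> pfun n" "\<And>j \<alpha>. coeff (\<Phi> \<alpha>) j = Q j (coeff (linprod n \<alpha>))"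
    by metis
  obtain B where B: "\<And>i. B i \<in> pfun (Suc (Suc n))"
    "\<And>(\<alpha> :: nat \<Rightarrow> 'b) i. coeff (linprod n \<alpha>) i =
        B i (\<lambda>j. if j = Suc n then \<alpha> n else coeff (linprod (Suc n) \<alpha>) j)"
    using linprod_coeff_from_Suc[of n] by metis
  define R where "R = (\<lambda>a. \<Sum>j\<le>d. Q j (\<lambda>i. B i a) * a (Suc n) ^ j)"
  have R: "R \<in> pfun (Suc (Suc n))"
    unfolding R_def by (intro pfun_sum pfun.mult pfun_subst[OF Q(1)] B pfun_power pfun.var) auto
  obtain \<Psi> e where \<Psi>: "\<Psi> \<in> pfun_poly (Suc n)" and dege: "\<And>a. degree (\<Psi> a) \<le> e"
    and R\<Psi>: "\<And>a. R a = poly (\<Psi> a) (a (Suc n))"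
    using pfun_expand_last[OF R] by metis
  have F1: "F \<alpha> = poly (\<Psi> (coeff (linprod (Suc n) \<alpha>))) (\<alpha> n)" for \<alpha>
  proof -
    let ?a = "\<lambda>j. if j = Suc n then \<alpha> n else coeff (linprod (Suc n) \<alpha>) j"
    have "F \<alpha> = (\<Sum>j\<le>d. coeff (\<Phi> \<alpha>) j * \<alpha> n ^ j)"
      unfolding F\<Phi> by (rule poly_as_sum_atMost[OF deg])
    also have "\<dots> = R ?a" unfolding R_def by (simp add: Q(2) B(2)[symmetric])
    also have "\<dots> = poly (\<Psi> ?a) (\<alpha> n)" by (simp add: R\<Psi>)
    also have "\<Psi> ?a = \<Psi> (coeff (linprod (Suc n) \<alpha>))"
      by (rule poly_eqI) (rule pfun_cong[OF pfun_poly_coeff[OF \<Psi>]], simp)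
    finally show ?thesis .
  qed
  have "\<forall>m. \<exists>C. (\<forall>j. C j \<in> pfun (Suc n)) \<and>
     (\<forall>a (t :: 'b). t ^ Suc n + (\<Sum>i\<le>n. a i * t ^ i) = 0 \<longrightarrow> t ^ m = (\<Sum>j\<le>n. C j a * t ^ j))"
    using pfun_reduce_power by blast
  then obtain C where C: "\<And>m j. C m j \<in> pfun (Suc n)"
     "\<And>m a (t :: 'b). t ^ Suc n + (\<Sum>i\<le>n. a i * t ^ i) = 0 \<Longrightarrow> t ^ m = (\<Sum>j\<le>n. C m j a * t ^ j)"
    by metis
  define c where "c = (\<lambda>j a. \<Sum>m\<le>e. coeff (\<Psi> a) m * C m j a)"
  have c: "c j \<in> pfun (Suc n)" for j
    unfolding c_def by (intro pfun_sum pfun.mult C pfun_poly_coeff[OF \<Psi>])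
  have F2: "F \<alpha> = (\<Sum>j\<le>n. c j (coeff (linprod (Suc n) \<alpha>)) * \<alpha> n ^ j)" for \<alpha>
  proof -
    let ?a = "coeff (linprod (Suc n) \<alpha>)"
    have "0 = poly (linprod (Suc n) \<alpha>) (\<alpha> n)" by (simp add: poly_linprod_eq_0)
    also have "\<dots> = (\<Sum>i\<le>Suc n. ?a i * \<alpha> n ^ i)"
      by (rule poly_as_sum_atMost) simp
    also have "\<dots> = \<alpha> n ^ Suc n + (\<Sum>i\<le>n. ?a i * \<alpha> n ^ i)" by (simp add: lead_coeff_linprod)
    finally have pw: "\<alpha> n ^ m = (\<Sum>j\<le>n. C m j ?a * \<alpha> n ^ j)" for m
      by (intro C(2)) simp
    have "F \<alpha> = (\<Sum>m\<le>e. coeff (\<Psi> ?a) m * \<alpha> n ^ m)"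
      unfolding F1 by (rule poly_as_sum_atMost[OF dege])
    also have "\<dots> = (\<Sum>m\<le>e. coeff (\<Psi> ?a) m * (\<Sum>j\<le>n. C m j ?a * \<alpha> n ^ j))"
      by (subst pw) (rule refl)
    also have "\<dots> = (\<Sum>j\<le>n. c j ?a * \<alpha> n ^ j)"
      unfolding c_def sum_distrib_left sum_distrib_right
      by (subst sum.swap) (simp add: mult.assoc)
    finally show ?thesis .
  qed
  \<comment> \<open>A polynomial of degree at most n that agrees with a constant at n + 1 distinct
    points is that constant; its coefficient 0 is the wanted expression.\<close>
  have F3: "F \<alpha> = c 0 (coeff (linprod (Suc n) \<alpha>))" if inj: "inj_on \<alpha> {..n}" for \<alpha>
  proof -
    let ?a = "coeff (linprod (Suc n) \<alpha>)"
    let ?p = "(\<Sum>j\<le>n. monom (c j ?a) j) :: 'b poly"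
    have "?p = [:F \<alpha>:]"
    proof (rule poly_eqI_degree)
      fix t assume "t \<in> \<alpha> ` {..n}"
      then obtain i where i: "i \<le> n" "t = \<alpha> i" by auto
      let ?\<sigma> = "Transposition.transpose i n"
      have "F \<alpha> = F (\<alpha> \<circ> ?\<sigma>)" using i by (subst Suc.prems) auto
      also have "\<dots> = (\<Sum>j\<le>n. c j ?a * \<alpha> i ^ j)"
        unfolding F2 using i by (subst linprod_transpose) (auto simp: Transposition.transpose_def)
      also have "\<dots> = poly ?p t" by (simp add: poly_sum poly_monom i)
      finally show "poly ?p t = poly [:F \<alpha>:] t" by simp
    next
      have "card (\<alpha> ` {..n}) = Suc n" using inj by (simp add: card_image)
      moreover have "degree ?p \<le> n" by (intro degree_sum_le) (auto intro: order_trans[OF degree_monom_le])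
      ultimately show "degree ?p < card (\<alpha> ` {..n})" "degree [:F \<alpha>:] < card (\<alpha> ` {..n})" by auto
    qed
    then have "coeff ?p 0 = F \<alpha>" by simp
    then show ?thesis by (simp add: coeff_sum)
  qed
  have "F \<alpha> = c 0 (coeff (linprod (Suc n) \<alpha>))" for \<alpha>
  proof -
    \<comment> \<open>Move \<alpha> along a line on which almost all points have distinct entries.\<close>
    obtain \<tau> :: "nat \<Rightarrow> 'b" where \<tau>: "inj \<tau>" using inf infinite_countable_subset by blast
    define A where "A = (\<lambda>i. [:\<alpha> i, \<tau> i:])"
    have D: "(\<lambda>\<alpha>. F \<alpha> - c 0 (coeff (linprod (Suc n) \<alpha>))) \<in> pfun (Suc n)"
      using pfun_subst[OF c, of "\<lambda>i \<alpha>. coeff (linprod (Suc n) \<alpha>) i"]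
      by (intro pfun_diff Suc.prems) (auto intro: pfun_poly_coeff pfun_poly_linprod)
    obtain p where p: "\<And>s. F (\<lambda>i. poly (A i) s) - c 0 (coeff (linprod (Suc n) (\<lambda>i. poly (A i) s))) = poly p s"
      using pfun_along_polys[OF D, of A] by metis
    define bad where "bad = (\<Union>i\<le>n. \<Union>j\<in>{..n} - {i}. {s. poly (A i - A j) s = 0})"
    have "A i - A j \<noteq> 0" if "j \<noteq> i" for i j
      using \<tau> that by (auto simp: A_def inj_eq)
    then have "finite bad" unfolding bad_def by (intro finite_UN_I poly_roots_finite) auto
    moreover have "poly p s = poly 0 s" if "s \<notin> bad" for s
    proof -
      have "inj_on (\<lambda>i. poly (A i) s) {..n}"
        using that by (auto simp: inj_on_def bad_def)
      from F3[OF this] show ?thesis by (simp add: p[symmetric])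
    qed
    ultimately have "p = 0" by (intro poly_eqI_cofinite[OF inf]) auto
    then have "F (\<lambda>i. poly (A i) 0) = c 0 (coeff (linprod (Suc n) (\<lambda>i. poly (A i) 0)))"
      using p[of 0] by simp
    then show ?thesis by (simp add: A_def)
  qed
  with c show ?case by blast
qed

section \<open>Resolvents built from products of k roots\<close>

definition ksubsets :: "nat \<Rightarrow> nat \<Rightarrow> nat set set" where
  "ksubsets n k = {S. S \<subseteq> {..<n} \<and> card S = k}"

lemma finite_ksubsets [simp]: "finite (ksubsets n k)"
  unfolding ksubsets_def by (rule finite_subset[of _ "Pow {..<n}"]) auto

text \<open>The roots \<alpha> belong to a polynomial with leading coefficient c. The factor c makes
  the products integral over the coefficients of that polynomial even when the single roots are
  not.\<close>

definition subset_product_poly :: "nat \<Rightarrow> nat \<Rightarrow> 'b::comm_ring_1 \<Rightarrow> (nat \<Rightarrow> 'b) \<Rightarrow> 'b poly" where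
  "subset_product_poly n k c \<alpha> = (\<Prod>S\<in>ksubsets n k. [:- (c * (\<Prod>i\<in>S. \<alpha> i)), 1:])"

lemma lead_coeff_subset_product_poly:
  "lead_coeff (subset_product_poly n k c (\<alpha> :: nat \<Rightarrow> 'b::idom)) = 1"
  unfolding subset_product_poly_def by (subst lead_coeff_prod) simp

lemma ksubsets_image_transpose:
  assumes "i < n" "j < n"
  shows "bij_betw ((`) (Transposition.transpose i j)) (ksubsets n k) (ksubsets n k)"
proof (rule bij_betwI[where g = "(`) (Transposition.transpose i j)"])
  have "Transposition.transpose i j ` S \<in> ksubsets n k" if "S \<in> ksubsets n k" for S
    using that assms unfolding ksubsets_def mem_Collect_eq
    by (auto simp: card_image[OF inj_on_transpose]) (auto simp: Transposition.transpose_def)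
  then show "(`) (Transposition.transpose i j) \<in> ksubsets n k \<rightarrow> ksubsets n k"
    "(`) (Transposition.transpose i j) \<in> ksubsets n k \<rightarrow> ksubsets n k" by auto
qed (auto simp: image_image)

lemma subset_product_poly_pfun:
  assumes "infinite (UNIV :: 'b::idom set)"
  shows "\<exists>Q\<in>pfun n. \<forall>\<alpha> :: nat \<Rightarrow> 'b. coeff (subset_product_poly n k 1 \<alpha>) r = Q (coeff (linprod n \<alpha>))"
proof (rule symmetric_in_linprod_coeffs[OF assms])
  have "(subset_product_poly n k 1 :: (nat \<Rightarrow> 'b) \<Rightarrow> 'b poly) \<in> pfun_poly n"
    unfolding subset_product_poly_def mult_1_left
    by (intro pfun_poly_prod pfun_poly_linear pfun_prod pfun.var) (auto simp: ksubsets_def)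
  then show "(\<lambda>\<alpha> :: nat \<Rightarrow> 'b. coeff (subset_product_poly n k 1 \<alpha>) r) \<in> pfun n"
    by (rule pfun_poly_coeff)
next
  fix \<alpha> :: "nat \<Rightarrow> 'b" and i j assume "i < n" "j < n"
  have *: "(\<Prod>l\<in>S. (\<alpha> \<circ> Transposition.transpose i j) l) = (\<Prod>l\<in>Transposition.transpose i j ` S. \<alpha> l)" for S
    by (subst prod.reindex) (auto simp: inj_on_transpose)
  show "coeff (subset_product_poly n k 1 (\<alpha> \<circ> Transposition.transpose i j)) r
      = coeff (subset_product_poly n k 1 \<alpha>) r"
    unfolding subset_product_poly_def *
    by (subst prod.reindex_bij_betw[OF ksubsets_image_transpose[OF \<open>i < n\<close> \<open>j < n\<close>],
          of "\<lambda>S. [:- (1 * (\<Prod>l\<in>S. \<alpha> l)), 1:]"]) (rule refl)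
qed

text \<open>Clears denominators. Slot n, beyond the variables of Q, carries the leading coefficient,
  and Q is evaluated at the coefficients of the monic normalization; M is a common exponent for the
  denominators that occur.\<close>

lemma pfun_homogenize:
  assumes "Q \<in> pfun n"
  shows "\<exists>M. \<exists>P\<in>pfun (Suc n). \<forall>c :: nat \<Rightarrow> 'b::field. c n \<noteq> 0 \<longrightarrow> P c = c n ^ M * Q (\<lambda>i. c i / c n)"
  using assms
proof induction
  case one
  show ?case by (rule exI[of _ 0], rule bexI[of _ "\<lambda>_. 1"]) (auto intro: pfun.one)
next
  case (var i)
  then show ?case by (intro exI[of _ 1] bexI[of _ "\<lambda>c. c i"]) (auto intro: pfun.var)
next
  case (add F G)
  then obtain M P M' P' where *: "P \<in> pfun (Suc n)" "P' \<in> pfun (Suc n)"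
    "\<And>c. c n \<noteq> 0 \<Longrightarrow> P c = c n ^ M * F (\<lambda>i. c i / c n)"
    "\<And>c. c n \<noteq> 0 \<Longrightarrow> P' c = c n ^ M' * G (\<lambda>i. c i / c n)"
    by metis
  show ?case
    by (rule exI[of _ "M + M'"], rule bexI[of _ "\<lambda>c. c n ^ M' * P c + c n ^ M * P' c"])
       (auto simp: * power_add algebra_simps intro!: pfun.add pfun.mult pfun_power pfun.var *(1,2))
next
  case (mult F G)
  then obtain M P M' P' where *: "P \<in> pfun (Suc n)" "P' \<in> pfun (Suc n)"
    "\<And>c. c n \<noteq> 0 \<Longrightarrow> P c = c n ^ M * F (\<lambda>i. c i / c n)"
    "\<And>c. c n \<noteq> 0 \<Longrightarrow> P' c = c n ^ M' * G (\<lambda>i. c i / c n)"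
    by metis
  show ?case
    by (rule exI[of _ "M + M'"], rule bexI[of _ "\<lambda>c. P c * P' c"])
       (auto simp: * power_add algebra_simps intro!: pfun.mult *(1,2))
next
  case (neg F)
  then obtain M P where *: "P \<in> pfun (Suc n)"
    "\<And>c. c n \<noteq> 0 \<Longrightarrow> P c = c n ^ M * F (\<lambda>i. c i / c n)"
    by metis
  show ?case
    by (rule exI[of _ M], rule bexI[of _ "\<lambda>c. - P c"]) (auto simp: * intro!: pfun.neg *(1))
qed

text \<open>Multiplying all roots of a monic polynomial of degree N by c multiplies its coefficient
  r by c^(N - r); the form chosen avoids the subtraction.\<close>

lemma coeff_subset_product_poly_scale:
  fixes c :: "'b::field"
  assumes "c \<noteq> 0"
  shows "c ^ r * coeff (subset_product_poly n k c \<alpha>) r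
    = c ^ card (ksubsets n k) * coeff (subset_product_poly n k 1 \<alpha>) r"
proof -
  have "subset_product_poly n k c \<alpha>
      = (\<Prod>S\<in>ksubsets n k. smult c ([:- (1 * (\<Prod>i\<in>S. \<alpha> i)), 1:] \<circ>\<^sub>p [:0, inverse c:]))"
    unfolding subset_product_poly_def using assms by (simp add: pcompose_pCons)
  also have "\<dots> = smult (c ^ card (ksubsets n k)) (subset_product_poly n k 1 \<alpha> \<circ>\<^sub>p [:0, inverse c:])"
    unfolding prod_smult prod_constant subset_product_poly_def pcompose_prod ..
  finally show ?thesis
    using assms by (simp add: coeff_pcompose_linear field_simps)
qed

lemma subset_product_poly_pfun_upto_power:
  assumes "infinite (UNIV :: 'b::field set)"
  shows "\<exists>M. \<exists>P\<in>pfun (Suc n). \<forall>c (\<alpha> :: nat \<Rightarrow> 'b). c \<noteq> 0 \<longrightarrow>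
     P (coeff (smult c (linprod n \<alpha>))) = c ^ M * coeff (subset_product_poly n k c \<alpha>) r"
proof -
  obtain Q where Q: "Q \<in> pfun n" "\<And>\<alpha> :: nat \<Rightarrow> 'b. coeff (subset_product_poly n k 1 \<alpha>) r = Q (coeff (linprod n \<alpha>))"
    using subset_product_poly_pfun[OF assms] by metis
  obtain M P where P: "P \<in> pfun (Suc n)" "\<And>c :: nat \<Rightarrow> 'b. c n \<noteq> 0 \<Longrightarrow> P c = c n ^ M * Q (\<lambda>i. c i / c n)"
    using pfun_homogenize[OF Q(1)] by metis
  let ?N = "card (ksubsets n k)"
  show ?thesis
  proof (rule exI[of _ "M + r"], rule bexI[of _ "\<lambda>c. c n ^ ?N * P c"], safe)
    fix c :: 'b and \<alpha> :: "nat \<Rightarrow> 'b" assume c: "c \<noteq> 0"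
    let ?v = "coeff (smult c (linprod n \<alpha>))"
    have vn: "?v n = c" by simp
    have "(\<lambda>i. ?v i / ?v n) = coeff (linprod n \<alpha>)" using c by (auto simp: vn)
    then have "P ?v = c ^ M * coeff (subset_product_poly n k 1 \<alpha>) r"
      using P(2)[of ?v] c unfolding vn by (simp add: Q(2))
    then have "?v n ^ ?N * P ?v = c ^ M * (c ^ ?N * coeff (subset_product_poly n k 1 \<alpha>) r)"
      by (simp add: vn)
    also have "\<dots> = c ^ (M + r) * coeff (subset_product_poly n k c \<alpha>) r"
      by (simp add: coeff_subset_product_poly_scale[OF c, symmetric] power_add)
    finally show "?v n ^ ?N * P ?v = c ^ (M + r) * coeff (subset_product_poly n k c \<alpha>) r" .
  qed (auto intro!: pfun.mult pfun_power pfun.var P(1))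
qed

text \<open>The product over S is the product of all roots times the product of the inverse roots
  over the complement of S. The new factor \<open>c * (\<Prod>i<n. \<alpha> i)\<close> is, up to
  sign, the constant coefficient of the original polynomial, so the roles of c n and c 0 are
  exchanged.\<close>

lemma subset_product_poly_inverse:
  fixes c :: "'b::field"
  assumes "\<And>i. i < n \<Longrightarrow> \<alpha> i \<noteq> 0" "k \<le> n"
  shows "subset_product_poly n k c \<alpha>
    = subset_product_poly n (n - k) (c * (\<Prod>i<n. \<alpha> i)) (\<lambda>i. inverse (\<alpha> i))"
proof -
  have bij: "bij_betw (\<lambda>S. {..<n} - S) (ksubsets n k) (ksubsets n (n - k))"
    using \<open>k \<le> n\<close>
    by (intro bij_betwI[where g = "\<lambda>S. {..<n} - S"]) (auto simp: ksubsets_def card_Diff_subset finite_subset)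
  have eq: "(\<Prod>i<n. \<alpha> i) * (\<Prod>i\<in>{..<n} - S. inverse (\<alpha> i)) = (\<Prod>i\<in>S. \<alpha> i)" if "S \<in> ksubsets n k" for S
  proof -
    have S: "S \<subseteq> {..<n}" using that by (auto simp: ksubsets_def)
    have split: "(\<Prod>i<n. \<alpha> i) = (\<Prod>i\<in>{..<n} - S. \<alpha> i) * (\<Prod>i\<in>S. \<alpha> i)"
      using S by (intro prod.subset_diff) auto
    have "(\<Prod>i<n. \<alpha> i) * (\<Prod>i\<in>{..<n} - S. inverse (\<alpha> i))
        = ((\<Prod>i\<in>{..<n} - S. \<alpha> i) * (\<Prod>i\<in>{..<n} - S. inverse (\<alpha> i))) * (\<Prod>i\<in>S. \<alpha> i)"
      unfolding split by (simp only: ac_simps)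
    also have "(\<Prod>i\<in>{..<n} - S. \<alpha> i) * (\<Prod>i\<in>{..<n} - S. inverse (\<alpha> i)) = 1"
      using assms(1) by (auto simp flip: prod.distrib intro!: prod.neutral)
    finally show ?thesis by simp
  qed
  have "subset_product_poly n (n - k) (c * (\<Prod>i<n. \<alpha> i)) (\<lambda>i. inverse (\<alpha> i))
      = (\<Prod>S\<in>ksubsets n k. [:- (c * (\<Prod>i<n. \<alpha> i) * (\<Prod>i\<in>{..<n} - S. inverse (\<alpha> i))), 1:])"
    unfolding subset_product_poly_def by (rule prod.reindex_bij_betw[OF bij, symmetric])
  also have "\<dots> = subset_product_poly n k c \<alpha>"
    unfolding subset_product_poly_def by (intro prod.cong refl) (simp only: mult.assoc eq)
  finally show ?thesis ..
qed

text \<open>Inverting the roots reverses the coefficients, as in \<open>reflect_poly\<close>. The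
  sign appears because the new leading coefficient is c times the product of the roots, which is
  (-1)^n times the old constant coefficient.\<close>

lemma coeff_linprod_inverse:
  fixes c :: "'b::field"
  assumes "\<And>i. i < n \<Longrightarrow> \<alpha> i \<noteq> 0" "j \<le> n"
  shows "coeff (smult (c * (\<Prod>i<n. \<alpha> i)) (linprod n (\<lambda>i. inverse (\<alpha> i)))) j
    = (-1) ^ n * coeff (smult c (linprod n \<alpha>)) (n - j)"
proof -
  have "reflect_poly [:- a, 1:] = smult (- a) [:- inverse a, 1:]" if "a \<noteq> 0" for a :: 'b
    using that by (simp add: reflect_poly_def)
  then have "reflect_poly (linprod n \<alpha>) = (\<Prod>i<n. smult (- \<alpha> i) [:- inverse (\<alpha> i), 1:])"
    unfolding linprod_def reflect_poly_prod using assms(1) by (intro prod.cong) auto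
  also have "\<dots> = smult ((-1) ^ n * (\<Prod>i<n. \<alpha> i)) (linprod n (\<lambda>i. inverse (\<alpha> i)))"
    unfolding prod_smult linprod_def by (simp add: prod_uminus)
  finally have "(-1) ^ n * (\<Prod>i<n. \<alpha> i) * coeff (linprod n (\<lambda>i. inverse (\<alpha> i))) j = coeff (linprod n \<alpha>) (n - j)"
    using assms(2) by (metis coeff_smult coeff_reflect_poly degree_linprod not_less)
  then have "(-1) ^ n * coeff (linprod n \<alpha>) (n - j)
      = ((-1) ^ n * (-1) ^ n) * (\<Prod>i<n. \<alpha> i) * coeff (linprod n (\<lambda>i. inverse (\<alpha> i))) j"
    by (simp only: mult.assoc)
  also have "(-1) ^ n * (-1 :: 'b) ^ n = 1" by (simp flip: power_mult_distrib)
  finally show ?thesis by (simp add: mult.left_commute)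
qed

lemma alg_closed_linprod:
  fixes p :: "'b::alg_closed_field poly"
  assumes "p \<noteq> 0"
  shows "\<exists>\<alpha>. p = smult (lead_coeff p) (linprod (degree p) \<alpha>)"
proof -
  obtain A where A: "size A = degree p" "p = smult (lead_coeff p) (\<Prod>x\<in>#A. [:- x, 1:])"
    using alg_closed_imp_factorization[OF assms] by blast
  obtain xs where xs: "A = mset xs" by (metis ex_mset)
  have "(\<Prod>x\<in>#A. [:- x, 1:]) = linprod (degree p) (\<lambda>i. xs ! i)"
    using A(1) by (simp add: xs linprod_def prod.list_conv_set_nth atLeast0LessThan prod_mset_prod_list flip: mset_map)
  with A(2) show ?thesis by metis
qed

lemma coeff_poly_of_vector:
  "coeff (\<Sum>i\<le>n. monom (c i) i) j = (if j \<le> n then c j else 0)"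
  by (simp add: coeff_sum)

text \<open>Since \<open>\<Prod>i<n. \<alpha> i\<close> is \<open>\<plusminus>c 0 / c n\<close>, the coefficients lie both in \<open>\<int>[c 0, \<dots>, c n, 1 / c n]\<close>
  and (passing to complements and to the inverse roots) in \<open>\<int>[c 0, \<dots>, c n, 1 / c 0]\<close>; hence they are
  polynomials.\<close>

lemma subset_product_poly_coeff_pfun:
  assumes inf: "infinite (UNIV :: 'b::alg_closed_field set)" and "k \<le> n" "n > 0"
  shows "\<exists>R\<in>pfun (Suc n). \<forall>c (\<alpha> :: nat \<Rightarrow> 'b). c \<noteq> 0 \<longrightarrow>
     coeff (subset_product_poly n k c \<alpha>) r = R (coeff (smult c (linprod n \<alpha>)))"
proof -
  obtain M P where P: "P \<in> pfun (Suc n)" "\<And>c (\<alpha> :: nat \<Rightarrow> 'b). c \<noteq> 0 \<Longrightarrow>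
     P (coeff (smult c (linprod n \<alpha>))) = c ^ M * coeff (subset_product_poly n k c \<alpha>) r"
    using subset_product_poly_pfun_upto_power[OF inf] by metis
  obtain M' P' where P': "P' \<in> pfun (Suc n)" "\<And>c (\<alpha> :: nat \<Rightarrow> 'b). c \<noteq> 0 \<Longrightarrow>
     P' (coeff (smult c (linprod n \<alpha>))) = c ^ M' * coeff (subset_product_poly n (n - k) c \<alpha>) r"
    using subset_product_poly_pfun_upto_power[OF inf, of n "n - k" r] by metis
  obtain \<Phi> d where \<Phi>: "\<Phi> \<in> pfun_poly n" and deg: "\<And>c. degree (\<Phi> c) \<le> d"
    and P\<Phi>: "\<And>c. P c = poly (\<Phi> c) (c n)"
    using pfun_expand_last[OF P(1)] by metis
  \<comment> \<open>The vector is reversed and signed as in \<open>coeff_linprod_inverse\<close>, so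
    this is \<open>P'\<close> for the polynomial with the inverse roots.\<close>
  define P'' where "P'' = (\<lambda>c. P' (\<lambda>i. (-1) ^ n * c (n - i)))"
  have "P'' \<in> pfun (Suc n)"
    unfolding P''_def by (intro pfun_subst[OF P'(1)] pfun.mult pfun_power pfun.neg pfun.one pfun.var) auto
  then obtain \<Psi> where \<Psi>: "\<Psi> \<in> pfun_poly n" and P''\<Psi>: "\<And>c. P'' c = poly (\<Psi> c) (c n)"
    using pfun_expand_last by metis
  \<comment> \<open>Both sides contain the same coefficient of the resolvent: \<open>P\<close> gives
    it up to a power of c n, and \<open>P''\<close> up to a power of the signed c 0.\<close>
  have eq: "((-1) ^ n * c 0) ^ M' * P c = c n ^ M * P'' c" if c: "c 0 \<noteq> 0" "c n \<noteq> 0" for c :: "nat \<Rightarrow> 'b"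
  proof -
    let ?p = "(\<Sum>i\<le>n. monom (c i) i) :: 'b poly"
    have "degree ?p = n"
      using c(2) by (intro antisym degree_le le_degree) (auto simp: coeff_poly_of_vector)
    moreover have "?p \<noteq> 0" using coeff_poly_of_vector[of c n n] c(2) by fastforce
    ultimately obtain \<alpha> where "?p = smult (c n) (linprod n \<alpha>)"
      using alg_closed_linprod[of ?p] by (auto simp: coeff_poly_of_vector)
    then have ci: "coeff (smult (c n) (linprod n \<alpha>)) i = c i" if "i \<le> n" for i
      using coeff_poly_of_vector[of c n i] that by simp
    have c0: "c 0 = c n * ((-1) ^ n * (\<Prod>i<n. \<alpha> i))"
      using ci[of 0] by (simp add: linprod_def poly_prod prod_uminus flip: poly_0_coeff_0)
    with c have nz: "\<alpha> i \<noteq> 0" if "i < n" for i using that by auto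
    define c' where "c' = c n * (\<Prod>i<n. \<alpha> i)"
    have "(-1) ^ n * c 0 = ((-1) ^ n * (-1) ^ n) * c'"
      unfolding c'_def by (simp only: c0 ac_simps)
    also have "(-1) ^ n * (-1 :: 'b) ^ n = 1" by (simp flip: power_mult_distrib)
    finally have c': "c' = (-1) ^ n * c 0" by simp
    with c have "c' \<noteq> 0" by simp
    have "P c = P (coeff (smult (c n) (linprod n \<alpha>)))"
      by (rule pfun_cong[OF P(1)]) (use ci in simp)
    also have "\<dots> = c n ^ M * coeff (subset_product_poly n k (c n) \<alpha>) r"
      by (rule P(2)[OF c(2)])
    finally have 1: "P c = c n ^ M * coeff (subset_product_poly n k (c n) \<alpha>) r" .
    have "P'' c = P' (coeff (smult c' (linprod n (\<lambda>i. inverse (\<alpha> i)))))"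
      unfolding P''_def c'_def
      by (rule pfun_cong[OF P'(1)]) (subst coeff_linprod_inverse, use nz ci in auto)
    also have "\<dots> = c' ^ M' * coeff (subset_product_poly n (n - k) c' (\<lambda>i. inverse (\<alpha> i))) r"
      by (rule P'(2)[OF \<open>c' \<noteq> 0\<close>])
    also have "\<dots> = c' ^ M' * coeff (subset_product_poly n k (c n) \<alpha>) r"
      unfolding c'_def using nz \<open>k \<le> n\<close> by (subst subset_product_poly_inverse[of n \<alpha> k]) auto
    finally show ?thesis by (simp add: 1 c'[symmetric])
  qed
  \<comment> \<open>With the other entries fixed, \<open>eq\<close> is an identity of polynomials in
    c n, whose right side is divisible by the M-th power of c n. As n > 0, c 0 is a different
    variable and cannot contribute to that power.\<close>
  have \<Phi>0: "coeff (\<Phi> c) j = 0" if c: "c 0 \<noteq> 0" and j: "j < M" for c j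
  proof -
    have indep: "\<Phi> (c(n := s)) = \<Phi> c" "\<Psi> (c(n := s)) = \<Psi> c" for s
      by (rule poly_eqI, rule pfun_cong[OF pfun_poly_coeff[OF \<Phi>]], simp)
         (rule poly_eqI, rule pfun_cong[OF pfun_poly_coeff[OF \<Psi>]], simp)
    have "smult (((-1) ^ n * c 0) ^ M') (\<Phi> c) = monom 1 M * \<Psi> c"
    proof (rule poly_eqI_cofinite[OF inf, of "{0}"])
      fix s :: 'b assume "s \<notin> {0}"
      then show "poly (smult (((-1) ^ n * c 0) ^ M') (\<Phi> c)) s = poly (monom 1 M * \<Psi> c) s"
        using eq[of "c(n := s)"] c \<open>n > 0\<close> by (simp add: P\<Phi> P''\<Psi> indep poly_monom)
    qed simp
    then have "((-1) ^ n * c 0) ^ M' * coeff (\<Phi> c) j = 0"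
      using j by (metis coeff_smult coeff_monom_mult)
    with c show ?thesis by simp
  qed
  \<comment> \<open>The restriction c 0 \<noteq> 0 is removed by letting entry 0 vary: the
    coefficient is a polynomial in it that vanishes away from 0.\<close>
  have \<Phi>1: "coeff (\<Phi> c) j = 0" if j: "j < M" for c j
  proof -
    let ?A = "\<lambda>i. if i = 0 then [:0, 1:] else [:c i:]"
    obtain p where p: "\<And>s. coeff (\<Phi> (\<lambda>i. poly (?A i) s)) j = poly p s"
      using pfun_along_polys[OF pfun_poly_coeff[OF \<Phi>, of j], of ?A] by metis
    have "p = 0"
      by (rule poly_eqI_cofinite[OF inf, of "{0}"]) (use j in \<open>auto simp: p[symmetric] intro!: \<Phi>0\<close>)
    then have "coeff (\<Phi> (\<lambda>i. poly (?A i) (c 0))) j = 0" by (simp add: p)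
    also have "(\<lambda>i. poly (?A i) (c 0)) = c" by auto
    finally show ?thesis .
  qed
  define R where "R = (\<lambda>c. \<Sum>j\<in>{M..d}. coeff (\<Phi> c) j * c n ^ (j - M))"
  have "R \<in> pfun (Suc n)"
    unfolding R_def
    by (intro pfun_sum pfun.mult pfun_power pfun.var pfun_mono[OF pfun_poly_coeff[OF \<Phi>]]) auto
  moreover have PR: "P c = c n ^ M * R c" for c
  proof -
    have "P c = (\<Sum>j\<le>d. coeff (\<Phi> c) j * c n ^ j)"
      unfolding P\<Phi> by (rule poly_as_sum_atMost[OF deg])
    also have "\<dots> = (\<Sum>j\<in>{M..d}. coeff (\<Phi> c) j * c n ^ j)"
      by (rule sum.mono_neutral_right) (auto simp: \<Phi>1)
    also have "\<dots> = c n ^ M * R c"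
      unfolding R_def sum_distrib_left
      by (intro sum.cong) (auto simp: mult.left_commute simp flip: power_add)
    finally show ?thesis .
  qed
  moreover have "coeff (subset_product_poly n k c \<alpha>) r = R (coeff (smult c (linprod n \<alpha>)))"
    if "c \<noteq> 0" for c :: 'b and \<alpha>
    using P(2)[OF that, of \<alpha>] that by (simp add: PR)
  ultimately show ?thesis by blast
qed

section \<open>Factorization over henselian rings\<close>

lemma map_poly_to_ac_mult: "map_poly to_ac (p * q) = map_poly to_ac p * map_poly to_ac q"
  by (rule poly_eqI) (simp add: coeff_map_poly coeff_mult to_ac_sum)

lemma poly_map_poly_to_ac: "poly (map_poly to_ac p) (to_ac t) = to_ac (poly p t)"
  by (induction p) (simp_all add: map_poly_pCons)

lemma map_poly_to_ac_shift: "map_poly to_ac (p \<circ>\<^sub>p [:t, 1:]) = map_poly to_ac p \<circ>\<^sub>p [:to_ac t, 1:]"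
proof (induction p)
  case (pCons a p)
  have "map_poly to_ac (pCons a p \<circ>\<^sub>p [:t, 1:]) = [:to_ac a:] + map_poly to_ac ([:t, 1:] * p \<circ>\<^sub>p [:t, 1:])"
    by (rule poly_eqI) (simp add: pcompose_pCons coeff_map_poly coeff_pCons split: nat.split)
  also have "map_poly to_ac ([:t, 1:] * p \<circ>\<^sub>p [:t, 1:]) = [:to_ac t, 1:] * map_poly to_ac p \<circ>\<^sub>p [:to_ac t, 1:]"
    unfolding map_poly_to_ac_mult pCons.IH by (simp add: map_poly_pCons)
  finally show ?case by (simp add: map_poly_pCons pcompose_pCons)
qed simp

lemma map_poly_to_ac_inj: "map_poly to_ac p = map_poly to_ac q \<Longrightarrow> p = q"
  by (rule poly_eqI) (metis coeff_map_poly to_ac_0 to_ac_eq_iff)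

lemma poly_in_ideal:
  assumes "ideal_of V m" "poly_over m p" "t \<in> V"
  shows "poly p t \<in> m"
  using assms(2)
proof (induction p)
  case 0
  then show ?case using assms(1) by (simp add: ideal_of_def)
next
  case (pCons a p)
  have "a \<in> m" using pCons.prems unfolding poly_over_def by (metis coeff_pCons_0)
  moreover have "poly_over m p" using pCons.prems unfolding poly_over_def by (metis coeff_pCons_Suc)
  ultimately show ?case using pCons.IH assms(1,3) by (auto simp: ideal_of_def)
qed

text \<open>Newton interpolation: after division by T - t0, the values of the quotient at the
  remaining points are difference quotients, again in K, and the degree has dropped.\<close>

lemma poly_over_interpolate:
  fixes p :: "'b::field poly"
  assumes K: "subfield K" and "T \<subseteq> K" "infinite T" "\<And>t. t \<in> T \<Longrightarrow> poly p t \<in> K"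
  shows "poly_over K p"
  using assms(2-)
proof (induction "degree p" arbitrary: p T rule: less_induct)
  case less
  obtain t0 where t0: "t0 \<in> T" using less.prems(2) by fastforce
  have sub: "a - b \<in> K" if "a \<in> K" "b \<in> K" for a b
    using K that unfolding subfield_def by (metis add_uminus_conv_diff)
  show ?case
  proof (cases "degree p = 0")
    case True
    then obtain a where "p = [:a:]" by (metis degree_eq_zeroE)
    then show ?thesis using less.prems(3)[OF t0] K
      by (auto simp: poly_over_def subfield_def coeff_pCons split: nat.split)
  next
    case False
    define q where "q = synthetic_div p t0"
    have p: "p = [:- t0, 1:] * q + [:poly p t0:]"
      unfolding q_def by (rule synthetic_div_correct'[symmetric])
    have "poly_over K q"
    proof (rule less.hyps[of _ "T - {t0}"])
      show "degree q < degree p" using False by (simp add: q_def degree_synthetic_div)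
      fix t assume t: "t \<in> T - {t0}"
      have "poly p t = (t - t0) * poly q t + poly p t0"
        by (subst p) (simp add: algebra_simps)
      then have "poly q t = (poly p t - poly p t0) * inverse (t - t0)" using t by (simp add: field_simps)
      moreover have "poly p t - poly p t0 \<in> K" "t - t0 \<in> K"
        using t t0 less.prems by (auto intro!: sub)
      moreover have "t - t0 \<noteq> 0" using t by auto
      ultimately show "poly q t \<in> K" using K by (auto simp: subfield_def)
    qed (use less.prems in auto)
    show ?thesis
      unfolding poly_over_def
    proof
      fix i
      have "- t0 \<in> K" "poly p t0 \<in> K" using t0 less.prems K by (auto simp: subfield_def)
      then have "coeff ([:- t0, 1:] * q + [:poly p t0:]) i \<in> K"
        using t0 less.prems \<open>poly_over K q\<close> K
        by (auto simp: poly_over_def subfield_def coeff_pCons split: nat.split intro!: sub)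
      then show "coeff p i \<in> K" by (simp only: p[symmetric])
    qed
  qed
qed

text \<open>Infinity of m has two uses: it makes the algebraic closure infinite, so that polynomials
  are determined by their functions, and it provides infinitely many translations for the pigeonhole
  argument in \<open>hensel_factorization\<close>.\<close>

locale henselian_ring =
  fixes V m :: "'a::field set"
  assumes one_in: "1 \<in> V"
    and add_in: "\<And>a b. a \<in> V \<Longrightarrow> b \<in> V \<Longrightarrow> a + b \<in> V"
    and mult_in: "\<And>a b. a \<in> V \<Longrightarrow> b \<in> V \<Longrightarrow> a * b \<in> V"
    and neg_in: "\<And>a. a \<in> V \<Longrightarrow> - a \<in> V"
    and prime: "prime_ideal_of V m"
    and hens: "henselian V m"
    and inf: "infinite m"
begin

lemma zero_in: "0 \<in> V"
  using add_in[OF one_in neg_in[OF one_in]] by simp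

lemma ideal: "ideal_of V m"
  using prime by (simp add: prime_ideal_of_def)

lemma m_in: "a \<in> m \<Longrightarrow> a \<in> V"
  using ideal by (auto simp: ideal_of_def)

lemma power_notin: "a \<in> V \<Longrightarrow> a \<notin> m \<Longrightarrow> a ^ k \<in> V \<and> a ^ k \<notin> m"
proof (induction k)
  case 0
  have "1 \<notin> m"
  proof
    assume "1 \<in> m"
    then have "V \<subseteq> m" using ideal unfolding ideal_of_def by (metis mult_1_right subsetI)
    with prime show False by (auto simp: prime_ideal_of_def ideal_of_def)
  qed
  then show ?case by (simp add: one_in)
next
  case (Suc k)
  then show ?case using prime by (auto simp: prime_ideal_of_def intro: mult_in)
qed

lemma infinite_ac: "infinite (UNIV :: 'a alg_closure set)"
proof -
  have "infinite (to_ac ` m)" using inf inj_to_ac by (metis finite_imageD inj_on_subset subset_UNIV)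
  then show ?thesis by (metis finite_subset subset_UNIV)
qed

text \<open>The polynomial \<open>h\<close> is compared with X^k * \<open>h1\<close>, which has the
  same degree and leading coefficient and coefficients congruent to those of \<open>h\<close> modulo
  m. The same integer polynomials \<open>R\<close> compute both resolvents, so these are congruent,
  and the second one is explicitly (X - a) X^(N - 1). A root that lifts a must be one of the
  products.\<close>

lemma subset_product_in_V:
  assumes h: "poly_over V h" and low: "\<And>i. i < k \<Longrightarrow> coeff h i \<in> m" and k: "coeff h k \<notin> m" "k < degree h"
    and \<alpha>: "map_poly to_ac h = smult (to_ac (lead_coeff h)) (linprod (degree h) \<alpha>)"
  shows "\<exists>S\<in>ksubsets (degree h) (degree h - k). to_ac (lead_coeff h) * (\<Prod>i\<in>S. \<alpha> i) \<in> to_ac ` V"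
proof -
  define n where "n = degree h"
  define c where "c = to_ac (lead_coeff h)"
  have c: "c \<noteq> 0" using k by (auto simp: c_def)
  have kn: "k < n" using k by (simp add: n_def)
  let ?N = "card (ksubsets n (n - k))"
  define G where "G = subset_product_poly n (n - k) c \<alpha>"
  have "\<forall>r. \<exists>R\<in>pfun (Suc n). \<forall>c (\<alpha> :: nat \<Rightarrow> 'a alg_closure). c \<noteq> 0 \<longrightarrow>
     coeff (subset_product_poly n (n - k) c \<alpha>) r = R (coeff (smult c (linprod n \<alpha>)))"
    using subset_product_poly_coeff_pfun[OF infinite_ac] kn by auto
  then obtain R where R: "\<And>r. R r \<in> pfun (Suc n)"
    "\<And>r c (\<alpha> :: nat \<Rightarrow> 'a alg_closure). c \<noteq> 0 \<Longrightarrow>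
     coeff (subset_product_poly n (n - k) c \<alpha>) r = R r (coeff (smult c (linprod n \<alpha>)))"
    by metis
  have R1: "coeff G r = R r (\<lambda>i. to_ac (coeff h i))" for r
  proof -
    have "coeff (smult c (linprod n \<alpha>)) = (\<lambda>i. to_ac (coeff h i))"
      unfolding c_def n_def \<alpha>[symmetric] by (simp add: coeff_map_poly fun_eq_iff)
    then show ?thesis unfolding G_def R(2)[OF c] by simp
  qed
  define A where "A = to_ac ` V"
  define I where "I = to_ac ` m"
  have A: "1 \<in> A" "\<And>a b. a \<in> A \<Longrightarrow> b \<in> A \<Longrightarrow> a + b \<in> A" "\<And>a b. a \<in> A \<Longrightarrow> b \<in> A \<Longrightarrow> a * b \<in> A"
      "\<And>a. a \<in> A \<Longrightarrow> - a \<in> A"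
    unfolding A_def using one_in add_in mult_in neg_in
    by (auto simp: image_iff) (metis to_ac_1 to_ac_add to_ac_mult to_ac_minus)+
  have I: "0 \<in> I" "\<And>a b. a \<in> I \<Longrightarrow> b \<in> I \<Longrightarrow> a + b \<in> I" "\<And>a b. a \<in> A \<Longrightarrow> b \<in> I \<Longrightarrow> a * b \<in> I"
      "\<And>a. a \<in> I \<Longrightarrow> - a \<in> I"
    unfolding A_def I_def using ideal
    by (auto simp: image_iff ideal_of_def) (metis to_ac_0 to_ac_add to_ac_mult to_ac_minus)+
  have hA: "to_ac (coeff h i) \<in> A" for i using h by (auto simp: A_def poly_over_def)
  have GA: "coeff G r \<in> A" for r
    unfolding R1 by (rule pfun_closed[OF R(1) A]) (use hA in auto)
  define G0 where "G0 = map_poly of_ac G"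
  have G0: "to_ac (coeff G0 r) = coeff G r" for r
    using GA[of r] by (auto simp: G0_def coeff_map_poly A_def)
  then have G0G: "map_poly to_ac G0 = G" by (intro poly_eqI) (simp add: coeff_map_poly)
  have G0V: "poly_over V G0"
    unfolding poly_over_def using GA G0 by (metis A_def imageE to_ac_eq_iff)

  \<comment> \<open>Modulo \<open>m\<close> the polynomial h is divisible by \<open>X ^ k\<close>, so only one subset avoids the root 0.\<close>
  define h1 where "h1 = poly_shift k h"
  have coeff_h1: "coeff h1 i = coeff h (i + k)" for i by (simp add: h1_def coeff_poly_shift)
  have deg_h1: "degree h1 = n - k"
    using k by (intro antisym degree_le le_degree) (auto simp: coeff_h1 n_def intro!: coeff_eq_0)
  have "h1 \<noteq> 0" using coeff_h1[of "n - k"] kn k by (auto simp: n_def)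
  then have "map_poly to_ac h1 \<noteq> 0" by (metis map_poly_0 map_poly_to_ac_inj)
  moreover have "degree (map_poly to_ac h1) = n - k" by (simp add: degree_map_poly deg_h1)
  ultimately obtain \<alpha>1 where \<alpha>1: "map_poly to_ac h1 = smult c (linprod (n - k) \<alpha>1)"
    using alg_closed_linprod[of "map_poly to_ac h1"] kn
    by (auto simp: coeff_map_poly coeff_h1 c_def n_def)
  \<comment> \<open>The roots of X^k * \<open>h1\<close>: those of \<open>h1\<close> in the first n
    - k slots, then k times the root 0.\<close>
  define \<alpha>' where "\<alpha>' = (\<lambda>i. if i < n - k then \<alpha>1 i else 0)"
  have "linprod n \<alpha>' = (\<Prod>i\<in>{..<n - k}. [:- \<alpha>' i, 1:]) * (\<Prod>i\<in>{n - k..<n}. [:- \<alpha>' i, 1:])"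
    unfolding linprod_def using kn by (subst prod.union_disjoint[symmetric]) (auto intro: prod.cong)
  also have "(\<Prod>i\<in>{..<n - k}. [:- \<alpha>' i, 1:]) = linprod (n - k) \<alpha>1"
    unfolding linprod_def by (intro prod.cong) (auto simp: \<alpha>'_def)
  also have "(\<Prod>i\<in>{n - k..<n}. [:- \<alpha>' i, 1:]) = (\<Prod>i\<in>{n - k..<n}. [:0, 1:])"
    by (intro prod.cong) (auto simp: \<alpha>'_def)
  also have "\<dots> = monom 1 k" using kn by (simp add: monom_altdef)
  finally have "smult c (linprod n \<alpha>') = monom 1 k * map_poly to_ac h1" by (simp add: \<alpha>1 mult.commute)
  then have coeff': "coeff (smult c (linprod n \<alpha>')) i = (if i < k then 0 else to_ac (coeff h i))" for i
    by (simp add: coeff_monom_mult coeff_map_poly coeff_h1 del: coeff_smult)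
  \<comment> \<open>By Vieta this is c times the product of all roots of \<open>h1\<close>, whose
    constant coefficient is \<open>coeff h k\<close>.\<close>
  define a where "a = (-1) ^ (n - k) * coeff h k"
  have neg1: "(-1) ^ j \<in> V" for j :: nat by (induction j) (auto intro: one_in neg_in)
  have aV: "a \<in> V" unfolding a_def using h by (intro mult_in neg1) (auto simp: poly_over_def)
  have am: "a \<notin> m"
  proof
    assume "a \<in> m"
    then have "(-1) ^ (n - k) * a \<in> m" using ideal neg1 by (auto simp: ideal_of_def)
    moreover have "(-1) ^ (n - k) * a = coeff h k"
      unfolding a_def by (simp flip: power_mult_distrib mult.assoc)
    ultimately show False using k by simp
  qed
  have ac: "c * (\<Prod>i<n - k. \<alpha>' i) = to_ac a"
  proof -
    have "to_ac (coeff h k) = coeff (map_poly to_ac h1) 0" by (simp add: coeff_map_poly coeff_h1)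
    also have "\<dots> = c * ((-1) ^ (n - k) * (\<Prod>i<n - k. \<alpha>1 i))"
      unfolding \<alpha>1 by (simp add: linprod_def poly_prod prod_uminus flip: poly_0_coeff_0)
    finally have "to_ac a = ((-1) ^ (n - k) * (-1) ^ (n - k)) * (c * (\<Prod>i<n - k. \<alpha>1 i))"
      unfolding a_def by (simp only: to_ac_mult to_ac_power to_ac_minus to_ac_1 ac_simps)
    also have "(-1) ^ (n - k) * (-1) ^ (n - k) = (1 :: 'a alg_closure)" by (simp flip: power_mult_distrib)
    finally show ?thesis by (simp add: \<alpha>'_def)
  qed
  define G' where "G' = subset_product_poly n (n - k) c \<alpha>'"
  have S0: "{..<n - k} \<in> ksubsets n (n - k)" by (auto simp: ksubsets_def)
  have "(\<Prod>i\<in>S. \<alpha>' i) = 0" if S: "S \<in> ksubsets n (n - k)" "S \<noteq> {..<n - k}" for S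
  proof -
    have "finite S" "card S = n - k" using S by (auto simp: ksubsets_def finite_subset)
    then have "\<not> S \<subseteq> {..<n - k}" using S(2) by (metis card_lessThan card_subset_eq finite_lessThan)
    then obtain i where "i \<in> S" "\<not> i < n - k" by auto
    with \<open>finite S\<close> show ?thesis by (auto simp: \<alpha>'_def)
  qed
  then have "(\<Prod>S\<in>ksubsets n (n - k) - {{..<n - k}}. [:- (c * (\<Prod>i\<in>S. \<alpha>' i)), 1:])
      = (\<Prod>S\<in>ksubsets n (n - k) - {{..<n - k}}. [:0, 1:])"
    by (intro prod.cong) auto
  also have "\<dots> = monom 1 (?N - 1)" using S0 by (simp add: monom_altdef)
  finally have G': "G' = [:- to_ac a, 1:] * monom 1 (?N - 1)"
    unfolding G'_def subset_product_poly_def by (subst prod.remove[OF _ S0]) (auto simp: ac)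
  define G0' where "G0' = [:- a, 1:] * monom 1 (?N - 1)"
  have "map_poly to_ac [:- a, 1:] = [:- to_ac a, 1:]" "map_poly to_ac (monom (1 :: 'a) (?N - 1)) = monom 1 (?N - 1)"
    by (simp_all add: map_poly_pCons map_poly_monom)
  then have G0'G': "map_poly to_ac G0' = G'"
    by (simp only: G' G0'_def map_poly_to_ac_mult)
  define D where "D = G0 - G0'"
  have "to_ac (coeff D r) \<in> I" for r
  proof -
    have "to_ac (coeff D r) = coeff G r - coeff G' r"
      unfolding D_def using G0 by (simp add: coeff_map_poly flip: G0'G')
    also have "\<dots> = R r (\<lambda>i. to_ac (coeff h i)) - R r (coeff (smult c (linprod n \<alpha>')))"
      by (simp only: R1 G'_def R(2)[OF c])
    also have "\<dots> \<in> I"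
    proof (rule pfun_cong_ideal[OF R(1) A I])
      fix i assume "i < Suc n"
      have "0 \<in> A" using A(2)[OF A(1) A(4)[OF A(1)]] by simp
      then show "to_ac (coeff h i) \<in> A" "coeff (smult c (linprod n \<alpha>')) i \<in> A"
        using hA by (auto simp: coeff' simp del: coeff_smult)
      show "to_ac (coeff h i) - coeff (smult c (linprod n \<alpha>')) i \<in> I"
        using I(1) low[of i] by (auto simp: coeff' I_def simp del: coeff_smult)
    qed
    finally show ?thesis .
  qed
  then have Dm: "poly_over m D"
    unfolding poly_over_def I_def by (metis imageE to_ac_eq_iff)
  have Dm': "poly_over m (pderiv D)"
    unfolding poly_over_def
  proof
    fix i
    have "of_nat j \<in> V" for j by (induction j) (auto intro: zero_in one_in add_in)
    then show "coeff (pderiv D) i \<in> m"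
      using Dm ideal unfolding coeff_pderiv poly_over_def ideal_of_def by blast
  qed
  have G0_eq: "G0 = G0' + D" by (simp add: D_def)
  have "poly G0 a \<in> m"
    using poly_in_ideal[OF ideal Dm aV] by (simp add: G0_eq G0'_def)
  moreover have "poly (pderiv G0) a \<notin> m"
  proof
    assume "poly (pderiv G0) a \<in> m"
    \<comment> \<open>The derivative of (X - a) X^(N - 1) at a is a^(N - 1), which is outside m
      because m is prime.\<close>
    moreover have "poly (pderiv G0) a = a ^ (?N - 1) + poly (pderiv D) a"
      unfolding G0_eq G0'_def pderiv_add pderiv_mult poly_add poly_mult
      by (simp add: pderiv_pCons poly_monom)
    ultimately have "(a ^ (?N - 1) + poly (pderiv D) a) + - poly (pderiv D) a \<in> m"
      using poly_in_ideal[OF ideal Dm' aV] ideal unfolding ideal_of_def by metis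
    then show False using power_notin[OF aV am] by simp
  qed
  moreover have "lead_coeff G0 = 1"
  proof -
    have "degree G0 = degree G" by (simp add: degree_map_poly flip: G0G)
    then have "to_ac (lead_coeff G0) = lead_coeff G" by (simp add: G0)
    also have "\<dots> = 1" unfolding G_def by (rule lead_coeff_subset_product_poly)
    finally show ?thesis by (metis to_ac_1 to_ac_eq_iff)
  qed
  ultimately obtain b where b: "b \<in> V" "poly G0 b = 0"
    using hens G0V aV unfolding henselian_def by blast
  then have "poly G (to_ac b) = 0" by (simp add: poly_map_poly_to_ac flip: G0G)
  then obtain S where "S \<in> ksubsets n (n - k)" "to_ac b = c * (\<Prod>i\<in>S. \<alpha> i)"
    by (auto simp: G_def subset_product_poly_def poly_prod)
  with b show ?thesis unfolding c_def n_def by (metis image_eqI)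
qed

lemma poly_over_shift_cong:
  assumes "t \<in> m" "poly_over V p"
  shows "poly_over V (p \<circ>\<^sub>p [:t, 1:]) \<and> poly_over m (p \<circ>\<^sub>p [:t, 1:] - p)"
  using assms(2)
proof (induction p)
  case 0
  then show ?case using ideal zero_in by (auto simp: poly_over_def ideal_of_def)
next
  case (pCons a p)
  let ?q = "p \<circ>\<^sub>p [:t, 1:]"
  have a: "a \<in> V" using pCons.prems unfolding poly_over_def by (metis coeff_pCons_0)
  have "poly_over V p" using pCons.prems unfolding poly_over_def by (metis coeff_pCons_Suc)
  with pCons.IH have IH: "\<And>i. coeff ?q i \<in> V" "\<And>i. coeff (?q - p) i \<in> m"
    unfolding poly_over_def by blast+
  have eq: "pCons a p \<circ>\<^sub>p [:t, 1:] = pCons a ?q + smult t ?q"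
    by (simp add: pcompose_pCons)
  have tq: "t * coeff ?q i \<in> m" for i
    using IH(1) assms(1) ideal by (metis ideal_of_def mult.commute)
  have "coeff (pCons a p \<circ>\<^sub>p [:t, 1:]) i \<in> V" for i
    unfolding eq using IH(1) a m_in[OF tq] by (cases i) (auto intro!: add_in simp del: coeff_pcompose_0)
  moreover have "coeff (pCons a p \<circ>\<^sub>p [:t, 1:] - pCons a p) i \<in> m" for i
  proof (cases i)
    case 0
    then show ?thesis unfolding eq using tq[of 0] by (simp del: coeff_pcompose_0)
  next
    case (Suc j)
    have "coeff (?q - p) j + t * coeff ?q (Suc j) \<in> m"
      using IH(2) tq ideal unfolding ideal_of_def by blast
    then show ?thesis unfolding eq using Suc by (simp add: algebra_simps)
  qed
  ultimately show ?case by (simp add: poly_over_def)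
qed

text \<open>The product obtained from the translate of \<open>h\<close> by t is, up to sign, the
  value at t of the candidate factor \<open>P\<close>. Translation by t in m preserves the leading
  coefficient and changes the coefficients only within m, so the same k applies for every t.\<close>

theorem hensel_factorization:
  assumes K: "subfield K" "V \<subseteq> K"
    and h: "poly_over V h" and low: "\<And>i. i < k \<Longrightarrow> coeff h i \<in> m" and k: "coeff h k \<notin> m" "0 < k" "k < degree h"
  shows "\<exists>A B. poly_over K A \<and> poly_over K B \<and> degree A < degree h \<and> degree B < degree h \<and> h = A * B"
proof -
  define n where "n = degree h"
  define c where "c = to_ac (lead_coeff h)"
  have "h \<noteq> 0" using k by auto
  then have c: "c \<noteq> 0" by (simp add: c_def)
  have "map_poly to_ac h \<noteq> 0" using \<open>h \<noteq> 0\<close> by (metis map_poly_0 map_poly_to_ac_inj)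
  moreover have "degree (map_poly to_ac h) = n" by (simp add: degree_map_poly n_def)
  ultimately obtain \<alpha> where \<alpha>: "map_poly to_ac h = smult c (linprod n \<alpha>)"
    using alg_closed_linprod[of "map_poly to_ac h"] by (auto simp: coeff_map_poly c_def n_def)
  have "\<exists>S\<in>ksubsets n (n - k). c * (\<Prod>i\<in>S. \<alpha> i - to_ac t) \<in> to_ac ` V" if t: "t \<in> m" for t
  proof -
    define ht where "ht = h \<circ>\<^sub>p [:t, 1:]"
    have cong: "poly_over V ht" "\<And>i. coeff ht i - coeff h i \<in> m"
      using poly_over_shift_cong[OF t h] by (auto simp: ht_def poly_over_def)
    have deg: "degree ht = n" by (simp add: ht_def n_def degree_pcompose)
    have lc: "lead_coeff ht = lead_coeff h" unfolding ht_def by (subst lead_coeff_comp) auto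
    have lin: "map_poly to_ac ht = smult c (linprod n (\<lambda>i. \<alpha> i - to_ac t))"
      unfolding ht_def map_poly_to_ac_shift \<alpha>
      by (simp add: linprod_def pcompose_smult pcompose_prod pcompose_pCons)
    have "\<exists>S\<in>ksubsets (degree ht) (degree ht - k).
        to_ac (lead_coeff ht) * (\<Prod>i\<in>S. \<alpha> i - to_ac t) \<in> to_ac ` V"
    proof (rule subset_product_in_V[OF cong(1)])
      fix i assume "i < k"
      then have "(coeff ht i - coeff h i) + coeff h i \<in> m"
        using cong(2) low ideal unfolding ideal_of_def by blast
      then show "coeff ht i \<in> m" by simp
    next
      show "coeff ht k \<notin> m"
      proof
        assume "coeff ht k \<in> m"
        then have "coeff ht k + - (coeff ht k - coeff h k) \<in> m"
          using cong(2) ideal unfolding ideal_of_def by blast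
        with k show False by simp
      qed
      show "k < degree ht" using k deg by (simp add: n_def)
      show "map_poly to_ac ht = smult (to_ac (lead_coeff ht)) (linprod (degree ht) (\<lambda>i. \<alpha> i - to_ac t))"
        by (simp only: lin lc c_def) (simp only: deg)
    qed
    from this[unfolded lc, unfolded deg] show ?thesis by (simp only: c_def)
  qed
  then obtain \<Sigma> where \<Sigma>: "\<And>t. t \<in> m \<Longrightarrow> \<Sigma> t \<in> ksubsets n (n - k)"
    "\<And>t. t \<in> m \<Longrightarrow> c * (\<Prod>i\<in>\<Sigma> t. \<alpha> i - to_ac t) \<in> to_ac ` V"
    by metis
  \<comment> \<open>Pigeonhole: finitely many subsets for infinitely many t, so some subset S is
    chosen infinitely often.\<close>
  have "finite (\<Sigma> ` m)" by (rule finite_subset[OF _ finite_ksubsets[of n "n - k"]]) (use \<Sigma>(1) in auto)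
  then obtain t0 where t0: "t0 \<in> m" "infinite {t \<in> m. \<Sigma> t = \<Sigma> t0}"
    using pigeonhole_infinite[OF inf] by blast
  define S where "S = \<Sigma> t0"
  have S: "S \<subseteq> {..<n}" "card S = n - k" "finite S"
    using \<Sigma>(1)[OF t0(1)] by (auto simp: S_def ksubsets_def finite_subset)
  \<comment> \<open>The roots of \<open>h\<close> are discarded so that \<open>P\<close> does not
    vanish on \<open>T\<close>; the values of the cofactor \<open>Q\<close> are then quotients of
    elements of K.\<close>
  define T where "T = {t \<in> m. \<Sigma> t = S} - {t. poly h t = 0}"
  have T_inf: "infinite T"
    unfolding T_def using t0(2) poly_roots_finite[OF \<open>h \<noteq> 0\<close>] by (auto simp: S_def intro: Diff_infinite_finite)
  define P where "P = smult c (\<Prod>i\<in>S. [:- \<alpha> i, 1:])"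
  define Q where "Q = (\<Prod>i\<in>{..<n} - S. [:- \<alpha> i, 1:])"
  have PQ: "map_poly to_ac h = P * Q"
    unfolding \<alpha> P_def Q_def linprod_def using S by (subst prod.subset_diff[of S]) (auto simp: mult.commute)
  have KK: "subfield (to_ac ` K)"
  proof -
    note K' = K(1)[unfolded subfield_def]
    show ?thesis
      unfolding subfield_def
    proof (intro conjI ballI impI)
      show "0 \<in> to_ac ` K" "1 \<in> to_ac ` K" using K' to_ac_0 to_ac_1 by (metis image_eqI)+
    qed (use K' in \<open>auto simp flip: to_ac_add to_ac_mult to_ac_minus to_ac_inverse\<close>)
  qed
  have PK: "poly P t \<in> to_ac ` K" if "t \<in> to_ac ` T" for t
  proof -
    obtain s where s: "s \<in> m" "\<Sigma> s = S" "t = to_ac s" using \<open>t \<in> to_ac ` T\<close> by (auto simp: T_def)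
    obtain b where b: "b \<in> V" "c * (\<Prod>i\<in>S. \<alpha> i - to_ac s) = to_ac b" using \<Sigma>(2)[OF s(1)] s(2) by auto
    have "poly P t = c * (\<Prod>i\<in>S. - (\<alpha> i - to_ac s))"
      by (simp add: P_def poly_prod s)
    also have "\<dots> = (-1) ^ card S * (c * (\<Prod>i\<in>S. \<alpha> i - to_ac s))" by (simp only: prod_uminus mult.left_commute)
    also have "\<dots> = to_ac ((-1) ^ card S * b)" by (simp add: b)
    finally have "poly P t = to_ac ((-1) ^ card S * b)" .
    moreover have "(-1) ^ card S * b \<in> K"
      using b K unfolding subfield_def by (cases "even (card S)") auto
    ultimately show ?thesis by blast
  qed
  have "poly_over (to_ac ` K) P"
  proof (rule poly_over_interpolate[OF KK])
    show "to_ac ` T \<subseteq> to_ac ` K" using K(2) m_in by (auto simp: T_def)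
    show "infinite (to_ac ` T)" using T_inf by (metis finite_imageD inj_on_subset inj_to_ac subset_UNIV)
  qed (rule PK)
  moreover have "poly_over (to_ac ` K) Q"
  proof (rule poly_over_interpolate[OF KK])
    show "to_ac ` T \<subseteq> to_ac ` K" using K(2) m_in by (auto simp: T_def)
    show "infinite (to_ac ` T)" using T_inf by (metis finite_imageD inj_on_subset inj_to_ac subset_UNIV)
    fix t assume t: "t \<in> to_ac ` T"
    then obtain s where s: "s \<in> m" "poly h s \<noteq> 0" "t = to_ac s" by (auto simp: T_def)
    have "poly h s \<in> K"
      using s(1) h m_in K(2) poly_in_ideal[of V V h s] add_in mult_in neg_in zero_in
      by (auto simp: ideal_of_def)
    have eq: "poly P t * poly Q t = to_ac (poly h s)"
      using poly_map_poly_to_ac[of h s] unfolding PQ by (simp add: s)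
    with s(2) have "poly P t \<noteq> 0" by auto
    with eq have "poly Q t = to_ac (poly h s) * inverse (poly P t)" by (simp add: field_simps)
    moreover have "inverse (poly P t) \<in> to_ac ` K"
      using PK[OF t] \<open>poly P t \<noteq> 0\<close> KK unfolding subfield_def by blast
    moreover have "to_ac (poly h s) \<in> to_ac ` K" using \<open>poly h s \<in> K\<close> by blast
    ultimately show "poly Q t \<in> to_ac ` K"
      using KK unfolding subfield_def by metis
  qed
  moreover have descend: "\<exists>A. poly_over K A \<and> map_poly to_ac A = p" if "poly_over (to_ac ` K) p" for p
  proof (intro exI conjI)
    have *: "of_ac (coeff p i) \<in> K \<and> to_ac (of_ac (coeff p i)) = coeff p i" for i
      using that unfolding poly_over_def by (metis imageE of_ac_to_ac)
    show "poly_over K (map_poly of_ac p)" using * by (simp add: poly_over_def coeff_map_poly)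
    show "map_poly to_ac (map_poly of_ac p) = p" by (rule poly_eqI) (simp add: coeff_map_poly *)
  qed
  ultimately obtain A B where AB: "poly_over K A" "map_poly to_ac A = P" "poly_over K B" "map_poly to_ac B = Q"
    by meson
  have "map_poly to_ac h = map_poly to_ac (A * B)" by (simp add: PQ map_poly_to_ac_mult AB)
  then have "h = A * B" by (rule map_poly_to_ac_inj)
  moreover have "degree P = n - k"
    unfolding P_def using c S by (simp add: degree_prod_eq_sum_degree)
  then have "degree A < n" using k AB(2) by (metis degree_map_poly diff_less less_trans n_def to_ac_eq_0_iff)
  moreover have "degree Q = n - (n - k)"
    unfolding Q_def using S by (subst degree_prod_eq_sum_degree) (auto simp: card_Diff_subset)
  then have "degree Q < n" using k by (simp add: n_def)
  then have "degree B < n" using AB(4) by (metis degree_map_poly to_ac_eq_0_iff)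
  ultimately show ?thesis using AB unfolding n_def by blast
qed

end

section \<open>Valued fields\<close>

interpretation vord: linorder vle vless
proof
  fix a b c :: "'g::linorder option"
  show "vless a b \<longleftrightarrow> vle a b \<and> \<not> vle b a" by (rule vless_def)
  show "vle a a" by (cases a) auto
  show "vle a b \<Longrightarrow> vle b c \<Longrightarrow> vle a c" by (cases a; cases b; cases c) auto
  show "vle a b \<Longrightarrow> vle b a \<Longrightarrow> a = b" by (cases a; cases b) auto
  show "vle a b \<or> vle b a" by (cases a; cases b) auto
qed

lemma vless_imp_Some: "vless a b \<Longrightarrow> a \<noteq> None"
  by (cases a; cases b) (auto simp: vless_def)

lemma vless_None_iff: "vless a None \<longleftrightarrow> a \<noteq> None"
  by (cases a) (auto simp: vless_def)

lemma vplus_mono: "vle b c \<Longrightarrow> vle (vplus a b) (vplus a (c :: 'g::linordered_ab_group_add option))"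
  by (cases a; cases b; cases c) auto

lemma vplus_strict_mono:
  "vless b c \<Longrightarrow> a \<noteq> None \<Longrightarrow> vless (vplus a b) (vplus a (c :: 'g::linordered_ab_group_add option))"
  by (cases a; cases b; cases c) (auto simp: vless_def)

lemma finite_vle_least:
  assumes "finite A" "A \<noteq> {}"
  shows "\<exists>k\<in>A. \<forall>i\<in>A. vle (g k) (g i)"
  using assms
proof (induction rule: finite_ne_induct)
  case (insert a A)
  then obtain k where k: "k \<in> A" "\<forall>i\<in>A. vle (g k) (g i)" by blast
  show ?case
  proof (cases "vle (g a) (g k)")
    case True
    with k have "\<forall>i\<in>insert a A. vle (g a) (g i)" using vord.order_trans by blast
    then show ?thesis by blast
  next
    case False
    with k have "\<forall>i\<in>insert a A. vle (g k) (g i)" using vord.linear by blast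
    with k show ?thesis by blast
  qed
qed simp

section \<open>Subrings, subfields and polynomials over them\<close>

definition subring_set :: "'a::comm_ring_1 set \<Rightarrow> bool" where
  "subring_set R \<longleftrightarrow> 1 \<in> R \<and> (\<forall>a\<in>R. \<forall>b\<in>R. a + b \<in> R \<and> a * b \<in> R \<and> - a \<in> R)"

lemma subring_set_closed:
  assumes "subring_set R"
  shows "0 \<in> R" "1 \<in> R" "a \<in> R \<Longrightarrow> b \<in> R \<Longrightarrow> a + b \<in> R" "a \<in> R \<Longrightarrow> b \<in> R \<Longrightarrow> a * b \<in> R"
    "a \<in> R \<Longrightarrow> - a \<in> R" "a \<in> R \<Longrightarrow> b \<in> R \<Longrightarrow> a - b \<in> R" "a \<in> R \<Longrightarrow> a ^ n \<in> R"
proof -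
  note R = assms[unfolded subring_set_def]
  show one: "1 \<in> R" and add: "\<And>a b. a \<in> R \<Longrightarrow> b \<in> R \<Longrightarrow> a + b \<in> R"
    and mult: "\<And>a b. a \<in> R \<Longrightarrow> b \<in> R \<Longrightarrow> a * b \<in> R" and neg: "\<And>a. a \<in> R \<Longrightarrow> - a \<in> R"
    using R by blast+
  show "0 \<in> R" using add[OF one neg[OF one]] by simp
  show "a \<in> R \<Longrightarrow> b \<in> R \<Longrightarrow> a - b \<in> R" using add[of a "- b"] neg by simp
  show "a \<in> R \<Longrightarrow> a ^ n \<in> R" by (induction n) (auto intro: one mult)
qed

lemma poly_over_closed:
  assumes "subring_set R"
  shows "poly_over R 0" "poly_over R 1" "a \<in> R \<Longrightarrow> poly_over R p \<Longrightarrow> poly_over R (pCons a p)"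
    "poly_over R p \<Longrightarrow> poly_over R q \<Longrightarrow> poly_over R (p + q)"
    "poly_over R p \<Longrightarrow> poly_over R q \<Longrightarrow> poly_over R (p - q)"
    "poly_over R p \<Longrightarrow> poly_over R q \<Longrightarrow> poly_over R (p * q)"
    "poly_over R p \<Longrightarrow> poly_over R q \<Longrightarrow> poly_over R (p \<circ>\<^sub>p q)"
    "a \<in> R \<Longrightarrow> poly_over R p \<Longrightarrow> poly_over R (smult a p)"
  using subring_set_closed[OF assms] unfolding poly_over_def
  by (auto simp: coeff_pCons split: nat.split
        intro!: coeff_mult_semiring_closed coeff_pcompose_semiring_closed)

lemma poly_over_power: "subring_set R \<Longrightarrow> poly_over R p \<Longrightarrow> poly_over R (p ^ n)"
  by (induction n) (auto intro: poly_over_closed)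

lemma poly_over_mono: "poly_over R p \<Longrightarrow> R \<subseteq> S \<Longrightarrow> poly_over S p"
  by (auto simp: poly_over_def)

lemma poly_over_coeff: "poly_over R p \<Longrightarrow> coeff p i \<in> R"
  by (simp add: poly_over_def)

lemma poly_over_poly:
  assumes "subring_set R" "poly_over R p" "t \<in> R"
  shows "poly p t \<in> R"
  using assms(2)
proof (induction p)
  case (pCons a p)
  have "a \<in> R" using pCons.prems unfolding poly_over_def by (metis coeff_pCons_0)
  moreover have "poly_over R p" using pCons.prems unfolding poly_over_def by (metis coeff_pCons_Suc)
  ultimately show ?case using pCons.IH assms(1,3) by (auto intro: subring_set_closed)
qed (simp add: subring_set_closed[OF assms(1)])

lemma subfield_subring: "subfield F \<Longrightarrow> subring_set F"
  by (auto simp: subfield_def subring_set_def)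

lemma subfield_inverse: "subfield F \<Longrightarrow> a \<in> F \<Longrightarrow> inverse a \<in> F"
  by (cases "a = 0") (auto simp: subfield_def)

lemma subfield_divide: "subfield F \<Longrightarrow> a \<in> F \<Longrightarrow> b \<in> F \<Longrightarrow> a / b \<in> F"
  unfolding divide_inverse by (intro subring_set_closed subfield_subring subfield_inverse)

section \<open>Ultrametric inequalities and dominant monomials\<close>

locale valued_field =
  fixes F :: "'a::field set" and val :: "'a \<Rightarrow> 'g::linordered_ab_group_add option"
  assumes subF: "subfield F" and valF: "valuation_on F val"
begin

lemmas F_closed = subring_set_closed[OF subfield_subring[OF subF]]
  subfield_inverse[OF subF] subfield_divide[OF subF]
lemmas F_poly_closed = poly_over_closed[OF subfield_subring[OF subF]]
lemmas F_poly = poly_over_poly[OF subfield_subring[OF subF]]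

lemma F_sum: "(\<And>i. i \<in> I \<Longrightarrow> f i \<in> F) \<Longrightarrow> sum f I \<in> F"
  by (induction I rule: infinite_finite_induct) (auto intro: F_closed)

lemma val_None_iff: "a \<in> F \<Longrightarrow> val a = None \<longleftrightarrow> a = 0"
  using valF by (simp add: valuation_on_def)

lemma val_0 [simp]: "val 0 = None"
  by (simp add: val_None_iff F_closed)

lemma val_mult: "a \<in> F \<Longrightarrow> b \<in> F \<Longrightarrow> val (a * b) = vplus (val a) (val b)"
  using valF by (simp add: valuation_on_def)

lemma val_1 [simp]: "val 1 = Some 0"
proof -
  obtain g where "val 1 = Some g" using val_None_iff[of 1] F_closed(2) by fastforce
  with val_mult[of 1 1] F_closed(2) show ?thesis by simp
qed

lemma val_uminus [simp]: "a \<in> F \<Longrightarrow> val (- a) = val a"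
proof -
  assume a: "a \<in> F"
  have m1: "-1 \<in> F" by (intro F_closed)
  obtain g where g: "val (-1) = Some g" using val_None_iff[of "-1"] m1 by fastforce
  have "vplus (val (-1)) (val (-1)) = Some 0"
    using val_mult[OF m1 m1] by simp
  with g have "g = 0" by (simp add: double_zero)
  then show ?thesis using val_mult[OF m1 a] g by (cases "val a") auto
qed

lemma val_diff_commute: "a \<in> F \<Longrightarrow> b \<in> F \<Longrightarrow> val (a - b) = val (b - a)"
  using val_uminus[of "a - b"] F_closed by simp

lemma val_add_ge:
  assumes "a \<in> F" "b \<in> F" "vle c (val a)" "vle c (val b)"
  shows "vle c (val (a + b))"
  using assms valF unfolding valuation_on_def by (metis vord.order_trans)

lemma val_add_gt:
  assumes "a \<in> F" "b \<in> F" "vless c (val a)" "vless c (val b)"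
  shows "vless c (val (a + b))"
  using assms valF unfolding valuation_on_def by (metis vord.less_le_trans)

text \<open>If a + b had larger value than a, then so would a = (a + b) - b.\<close>

lemma val_add_eq:
  assumes "a \<in> F" "b \<in> F" "vless (val a) (val b)"
  shows "val (a + b) = val a"
proof (rule vord.order.antisym)
  show "vle (val a) (val (a + b))" using assms by (intro val_add_ge) auto
  show "vle (val (a + b)) (val a)"
  proof (rule ccontr)
    assume "\<not> vle (val (a + b)) (val a)"
    then have "vless (val a) (val (a + b))" by simp
    then have "vless (val a) (val ((a + b) + - b))"
      by (rule val_add_gt[rotated 2]) (use assms in \<open>auto intro: F_closed\<close>)
    then show False by simp
  qed
qed

lemma val_sum_ge:
  assumes "\<And>i. i \<in> I \<Longrightarrow> f i \<in> F \<and> vle c (val (f i))"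
  shows "vle c (val (sum f I))"
  using assms
proof (induction I rule: infinite_finite_induct)
  case (insert i I)
  then have "vle c (val (f i + sum f I))" by (intro val_add_ge) (auto intro: F_sum)
  with insert show ?case by simp
qed auto

text \<open>The bound c has to be finite because the empty sum has value \<open>None\<close>, above
  which there is nothing.\<close>

lemma val_sum_gt:
  assumes "c \<noteq> None" "\<And>i. i \<in> I \<Longrightarrow> f i \<in> F \<and> vless c (val (f i))"
  shows "vless c (val (sum f I))"
  using assms(2)
proof (induction I rule: infinite_finite_induct)
  case (insert i I)
  then have "vless c (val (f i + sum f I))" by (intro val_add_gt) (auto intro: F_sum)
  with insert show ?case by simp
qed (use assms(1) in \<open>auto simp: vless_None_iff\<close>)

lemma val_mult_mono: "\<lbrakk>a \<in> F; b \<in> F; c \<in> F; vle (val a) (val b)\<rbrakk> \<Longrightarrow> vle (val (c * a)) (val (c * b))"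
  by (simp add: val_mult vplus_mono)

lemma val_mult_strict_mono:
  "\<lbrakk>a \<in> F; b \<in> F; c \<in> F; c \<noteq> 0; vless (val a) (val b)\<rbrakk> \<Longrightarrow> vless (val (c * a)) (val (c * b))"
  by (simp add: val_mult vplus_strict_mono val_None_iff)

lemma val_mult_le_iff: "\<lbrakk>a \<in> F; b \<in> F; c \<in> F; c \<noteq> 0\<rbrakk> \<Longrightarrow> vle (val (c * a)) (val (c * b)) \<longleftrightarrow> vle (val a) (val b)"
  using val_mult_mono[of a b c] val_mult_strict_mono[of b a c] by (meson vord.leD vord.not_le)

lemma val_mult_less_iff: "\<lbrakk>a \<in> F; b \<in> F; c \<in> F; c \<noteq> 0\<rbrakk> \<Longrightarrow> vless (val (c * a)) (val (c * b)) \<longleftrightarrow> vless (val a) (val b)"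
  by (simp add: val_mult_le_iff flip: vord.not_le)

lemma val_mult_eq_iff: "\<lbrakk>a \<in> F; b \<in> F; c \<in> F; c \<noteq> 0\<rbrakk> \<Longrightarrow> val (c * a) = val (c * b) \<longleftrightarrow> val a = val b"
  by (simp add: val_mult_le_iff vord.order.eq_iff)

lemma val_mult_nonneg:
  "\<lbrakk>a \<in> F; b \<in> F; vle (Some 0) (val a); vle c (val b)\<rbrakk> \<Longrightarrow> vle c (val (a * b))"
  using val_mult_mono[of 1 a b] F_closed(2) by (simp add: mult.commute)

lemma val_power_nonneg: "a \<in> F \<Longrightarrow> vle (Some 0) (val a) \<Longrightarrow> vle (Some 0) (val (a ^ n))"
  by (induction n) (auto intro: val_mult_nonneg F_closed)

lemma val_divide_nonneg_iff:
  assumes "a \<in> F" "b \<in> F" "b \<noteq> 0"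
  shows "vle (Some 0) (val (a / b)) \<longleftrightarrow> vle (val b) (val a)"
  using val_mult_le_iff[of 1 "a / b" b] assms by (simp add: F_closed)

lemma val_divide_pos_iff:
  assumes "a \<in> F" "b \<in> F" "b \<noteq> 0"
  shows "vless (Some 0) (val (a / b)) \<longleftrightarrow> vless (val b) (val a)"
  using val_mult_less_iff[of 1 "a / b" b] assms by (simp add: F_closed)

lemma val_divide_zero_iff:
  assumes "a \<in> F" "b \<in> F" "b \<noteq> 0"
  shows "val (a / b) = Some 0 \<longleftrightarrow> val a = val b"
  using val_mult_eq_iff[of "a / b" 1 b] assms by (simp add: F_closed)

lemma val_power_pos:
  assumes "a \<in> F" "vless (Some 0) (val a)" "n > 0"
  shows "vless (Some 0) (val (a ^ n))"
  using assms(3)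
proof (induction n)
  case (Suc n)
  have "vle (Some 0) (val (a ^ n))"
    using Suc by (cases n) (auto dest: vord.less_imp_le)
  moreover have "vle (val a) (val (a ^ n * a))" using calculation assms(1) by (intro val_mult_nonneg) (auto intro: F_closed)
  ultimately show ?case using assms(2) by (simp add: mult.commute)
qed simp

lemma val_power_strict:
  assumes "a \<in> F" "a \<noteq> 0" "vless (Some 0) (val a)" "k < l"
  shows "vless (val (a ^ k)) (val (a ^ l))"
proof -
  have "vless (val (a ^ k * 1)) (val (a ^ k * a ^ (l - k)))"
    using assms val_power_pos[of a "l - k"] by (intro val_mult_strict_mono) (auto intro: F_closed)
  then show ?thesis using assms(4) by (simp flip: power_add)
qed

text \<open>The quotient of the two terms is (b / a) d^(l - k), and its value strictly increases
  with the index. So once the term of exponent l is not below the other, it lies strictly above it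
  at every later index.\<close>

lemma eventually_dominates:
  fixes d :: "'i::wellorder \<Rightarrow> 'a"
  assumes d: "\<And>i. d i \<in> F" and incr: "\<And>i j. i < j \<Longrightarrow> vless (val (d i)) (val (d j))"
    and unb: "\<And>i :: 'i. \<exists>j. i < j"
    and c: "a \<in> F" "a \<noteq> 0" "b \<in> F" "b \<noteq> 0" and "k < l"
  shows "eventually (\<lambda>i. vless (val (a * d i ^ k)) (val (b * d i ^ l))) at_top
       \<or> eventually (\<lambda>i. vless (val (b * d i ^ l)) (val (a * d i ^ k))) at_top"
proof (cases "\<exists>i. vle (val (a * d i ^ k)) (val (b * d i ^ l))")
  case True
  then obtain i where i: "vle (val (a * d i ^ k)) (val (b * d i ^ l))" by blast
  have nz: "d i \<noteq> 0" for i using unb[of i] incr[of i] vless_imp_Some by fastforce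
  have "vless (val (a * d j ^ k)) (val (b * d j ^ l))" if "i < j" for j
  proof -
    define r where "r = d j / d i"
    have r: "r \<in> F" "r \<noteq> 0" "d j = d i * r" "vless (Some 0) (val r)"
      using d nz incr[OF that] by (auto simp: r_def val_divide_pos_iff F_closed)
    have "vless (val (a * d i ^ k * r ^ k)) (val (a * d i ^ k * r ^ l))"
      using c nz d r by (intro val_mult_strict_mono val_power_strict \<open>k < l\<close>) (auto intro!: F_closed)
    also have "vle \<dots> (val (b * d i ^ l * r ^ l))"
      using val_mult_mono[of "a * d i ^ k" "b * d i ^ l" "r ^ l"] c d r i
      by (simp add: F_closed mult.commute mult.left_commute)
    finally (vord.less_le_trans) show ?thesis by (simp add: r(3) power_mult_distrib mult_ac)
  qed
  moreover obtain j0 where "i < j0" using unb by blast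
  ultimately have "\<forall>j\<ge>j0. vless (val (a * d j ^ k)) (val (b * d j ^ l))" by auto
  then show ?thesis unfolding eventually_at_top_linorder by blast
next
  case False
  then have "\<forall>i. vless (val (b * d i ^ l)) (val (a * d i ^ k))" by (simp add: vord.not_le)
  then show ?thesis by simp
qed

lemma dominant_term:
  fixes d :: "'i::wellorder \<Rightarrow> 'a"
  assumes d: "\<And>i. d i \<in> F" and incr: "\<And>i j. i < j \<Longrightarrow> vless (val (d i)) (val (d j))"
    and unb: "\<And>i :: 'i. \<exists>j. i < j"
    and A: "finite A" "A \<noteq> {}" "\<And>k. k \<in> A \<Longrightarrow> c k \<in> F \<and> c k \<noteq> 0"
  shows "\<exists>m\<in>A. eventually (\<lambda>i. \<forall>k\<in>A - {m}. vless (val (c m * d i ^ m)) (val (c k * d i ^ k))) at_top"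
  using A
proof (induction A rule: finite_ne_induct)
  case (singleton k)
  show ?case by simp
next
  case (insert l A)
  then obtain m where m: "m \<in> A"
    "eventually (\<lambda>i. \<forall>k\<in>A - {m}. vless (val (c m * d i ^ m)) (val (c k * d i ^ k))) at_top"
    by auto
  have "m \<noteq> l" using m insert by auto
  then consider "m < l" | "l < m" by linarith
  then have "eventually (\<lambda>i. vless (val (c m * d i ^ m)) (val (c l * d i ^ l))) at_top
       \<or> eventually (\<lambda>i. vless (val (c l * d i ^ l)) (val (c m * d i ^ m))) at_top"
  proof cases
    case 1
    show ?thesis by (rule eventually_dominates[OF d incr unb]) (use insert.prems m(1) 1 in auto)
  next
    case 2
    have "eventually (\<lambda>i. vless (val (c l * d i ^ l)) (val (c m * d i ^ m))) at_top
       \<or> eventually (\<lambda>i. vless (val (c m * d i ^ m)) (val (c l * d i ^ l))) at_top"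
      by (rule eventually_dominates[OF d incr unb]) (use insert.prems m(1) 2 in auto)
    then show ?thesis by blast
  qed
  then show ?case
  proof
    assume "eventually (\<lambda>i. vless (val (c m * d i ^ m)) (val (c l * d i ^ l))) at_top"
    with m(2) have "eventually (\<lambda>i. \<forall>k\<in>insert l A - {m}. vless (val (c m * d i ^ m)) (val (c k * d i ^ k))) at_top"
      by eventually_elim auto
    with m(1) show ?thesis by blast
  next
    assume "eventually (\<lambda>i. vless (val (c l * d i ^ l)) (val (c m * d i ^ m))) at_top"
    with m(2) have "eventually (\<lambda>i. \<forall>k\<in>insert l A - {l}. vless (val (c l * d i ^ l)) (val (c k * d i ^ k))) at_top"
    proof eventually_elim
      case (elim i)
      show ?case
      proof
        fix k assume "k \<in> insert l A - {l}"
        then have "k = m \<or> k \<in> A - {m}" by auto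
        with elim show "vless (val (c l * d i ^ l)) (val (c k * d i ^ k))"
          using vord.less_trans by blast
      qed
    qed
    then show ?thesis by blast
  qed
qed

text \<open>Applied to the Taylor polynomial at x with d i = v i - x. The minimality over all k > 0
  is recorded as well, since integrality of the rescaled Taylor coefficients is needed for
  \<open>unit_representation\<close>.\<close>

lemma poly_increment:
  fixes d :: "'i::wellorder \<Rightarrow> 'a"
  assumes d: "\<And>i. d i \<in> F" and incr: "\<And>i j. i < j \<Longrightarrow> vless (val (d i)) (val (d j))"
    and unb: "\<And>i :: 'i. \<exists>j. i < j"
    and p: "poly_over F p" "degree p > 0"
  shows "\<exists>m>0. coeff p m \<noteq> 0 \<and> eventually (\<lambda>i. val (poly p (d i) - coeff p 0) = val (coeff p m * d i ^ m)
     \<and> (\<forall>k>0. vle (val (coeff p m * d i ^ m)) (val (coeff p k * d i ^ k)))) at_top"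
proof -
  define A where "A = {k. 0 < k \<and> k \<le> degree p \<and> coeff p k \<noteq> 0}"
  have A: "finite A" "A \<noteq> {}" "\<And>k. k \<in> A \<Longrightarrow> coeff p k \<in> F \<and> coeff p k \<noteq> 0"
    using p by (auto simp: A_def poly_over_def intro!: exI[of _ "degree p"])
  obtain m where m: "m \<in> A"
    "eventually (\<lambda>i. \<forall>k\<in>A - {m}. vless (val (coeff p m * d i ^ m)) (val (coeff p k * d i ^ k))) at_top"
    using dominant_term[where d = d and c = "coeff p", OF d incr unb A] by blast
  have nz: "d i \<noteq> 0" for i using unb[of i] incr[of i] vless_imp_Some by fastforce
  have cF: "coeff p k * d i ^ k \<in> F" for k i
    using p d by (intro F_closed) (auto simp: poly_over_def)
  from m(2) have "eventually (\<lambda>i. val (poly p (d i) - coeff p 0) = val (coeff p m * d i ^ m)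
     \<and> (\<forall>k>0. vle (val (coeff p m * d i ^ m)) (val (coeff p k * d i ^ k)))) at_top"
  proof eventually_elim
    case (elim i)
    let ?t = "\<lambda>k. coeff p k * d i ^ k"
    have "poly p (d i) = (\<Sum>k\<in>{..degree p}. ?t k)" by (simp add: poly_altdef)
    also have "\<dots> = ?t 0 + (\<Sum>k\<in>{..degree p} - {0}. ?t k)" by (subst sum.remove[of _ 0]) auto
    also have "(\<Sum>k\<in>{..degree p} - {0}. ?t k) = (\<Sum>k\<in>A. ?t k)"
      by (rule sum.mono_neutral_right) (auto simp: A_def)
    also have "\<dots> = ?t m + (\<Sum>k\<in>A - {m}. ?t k)" using m(1) A(1) by (rule sum.remove[rotated])
    finally have eq: "poly p (d i) - coeff p 0 = ?t m + (\<Sum>k\<in>A - {m}. ?t k)" by simp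
    have "?t m \<noteq> 0" using m(1) nz by (auto simp: A_def)
    then have "vless (val (?t m)) (val (\<Sum>k\<in>A - {m}. ?t k))"
      using elim by (intro val_sum_gt) (auto simp: val_None_iff cF simp del: mult_eq_0_iff)
    then have "val (poly p (d i) - coeff p 0) = val (?t m)"
      unfolding eq by (intro val_add_eq F_sum) (auto intro: cF)
    moreover have "vle (val (?t m)) (val (?t k))" if "k > 0" for k
    proof (cases "k \<in> A")
      case True
      then show ?thesis using elim by (cases "k = m") (auto intro: vord.less_imp_le)
    next
      case False
      then have "coeff p k = 0" using that by (auto simp: A_def intro: coeff_eq_0)
      then show ?thesis by simp
    qed
    ultimately show ?case by blast
  qed
  with m(1) show ?thesis by (auto simp: A_def)
qed

end

section \<open>Pseudo-convergent sequences with a pseudo limit\<close>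

locale pseudo_limit_extension = valued_field K' val
  for K' :: "'a::field set" and val :: "'a \<Rightarrow> 'g::linordered_ab_group_add option" +
  fixes K :: "'a set" and v :: "'i::wellorder \<Rightarrow> 'a" and x :: 'a
  assumes subK: "subfield K" and KK': "K \<subseteq> K'"
    and group_eq: "val ` (K' - {0}) = val ` (K - {0})"
    and v_in: "v i \<in> K" and v_nonneg: "vle (Some 0) (val (v i))"
    and x_in: "x \<in> K'" and x_nonneg: "vle (Some 0) (val x)"
    and pc: "pseudo_convergent val v"
    and lim: "pseudo_limit val v x"
    and no_lim: "\<not> (\<exists>y\<in>K. pseudo_limit val v y)"
    and trans: "transcendental_over K x"
begin

definition V where "V = {a \<in> K. vle (Some 0) (val a)}"
definition V' where "V' = {a \<in> K'. vle (Some 0) (val a)}"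
definition mm where "mm = {a \<in> V. vless (Some 0) (val a)}"

lemmas K_closed = subring_set_closed[OF subfield_subring[OF subK]]
  subfield_inverse[OF subK] subfield_divide[OF subK]
lemmas K_poly_closed = poly_over_closed[OF subfield_subring[OF subK]]

lemma K_in: "a \<in> K \<Longrightarrow> a \<in> K'" using KK' by blast

lemma v_in': "v i \<in> K'" using v_in K_in by blast

lemma V_in: "a \<in> V \<Longrightarrow> a \<in> K" by (simp add: V_def)

lemma V_in_V': "a \<in> V \<Longrightarrow> a \<in> V'" by (simp add: V_def V'_def K_in)

lemma V'_in: "a \<in> V' \<Longrightarrow> a \<in> K'" by (simp add: V'_def)

lemma subring_V': "subring_set V'"
  unfolding subring_set_def V'_def using F_closed(2-5) val_add_ge val_mult_nonneg val_uminus
  by (auto simp: val_uminus)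

lemma subring_V: "subring_set V"
proof -
  have "V = K \<inter> V'" using KK' by (auto simp: V_def V'_def)
  then show ?thesis
    using subring_V' subfield_subring[OF subK] unfolding subring_set_def by blast
qed

lemmas V_closed = subring_set_closed[OF subring_V]
lemmas V'_closed = subring_set_closed[OF subring_V']
lemmas V_poly_closed = poly_over_closed[OF subring_V]

lemma poly_over_V_K: "poly_over V p \<Longrightarrow> poly_over K p"
  by (rule poly_over_mono) (auto dest: V_in)

lemma poly_over_K_K': "poly_over K p \<Longrightarrow> poly_over K' p"
  by (rule poly_over_mono[OF _ KK'])

lemma poly_over_V_V': "poly_over V p \<Longrightarrow> poly_over V' p"
  by (rule poly_over_mono) (auto dest: V_in_V')

lemma exists_same_value: "a \<in> K' \<Longrightarrow> a \<noteq> 0 \<Longrightarrow> \<exists>b\<in>K. b \<noteq> 0 \<and> val b = val a"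
proof -
  assume "a \<in> K'" "a \<noteq> 0"
  then have "val a \<in> val ` (K - {0})" unfolding group_eq[symmetric] by blast
  then show ?thesis by force
qed

lemma prime_mm: "prime_ideal_of V mm"
proof -
  have "1 \<notin> mm" by (simp add: mm_def)
  then have neq: "mm \<noteq> V" using V_closed(2) by blast
  have "a * b \<in> mm" if "a \<in> V" "b \<in> mm" for a b
  proof -
    have "vle (val b) (val (a * b))"
      using that by (intro val_mult_nonneg) (auto simp: mm_def V_def K_in)
    then show ?thesis using that V_closed(4)[of a b] by (auto simp: mm_def)
  qed
  moreover have "a \<in> mm \<or> b \<in> mm" if "a \<in> V" "b \<in> V" "a * b \<in> mm" for a b
  proof (rule ccontr)
    assume "\<not> (a \<in> mm \<or> b \<in> mm)"
    with that have "val a = Some 0" "val b = Some 0" by (auto simp: mm_def V_def)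
    with that show False by (simp add: mm_def V_def val_mult K_in)
  qed
  moreover have "0 \<in> mm" "\<And>a b. a \<in> mm \<Longrightarrow> b \<in> mm \<Longrightarrow> a + b \<in> mm" "\<And>a. a \<in> mm \<Longrightarrow> - a \<in> mm"
    using V_closed(1,3,5) by (auto simp: mm_def V_in K_in vless_None_iff intro!: val_add_gt)
  ultimately show ?thesis using neq unfolding prime_ideal_of_def ideal_of_def
    by (auto simp: mm_def)
qed

text \<open>If there were a last index i, then v i would itself be a pseudo limit in K.\<close>

lemma index_unbounded: "\<exists>j. (i :: 'i) < j"
proof (rule ccontr)
  assume "\<nexists>j. i < j"
  then have top: "j \<le> i" for j by (meson not_le)
  have "pseudo_limit val v (v i)"
    unfolding pseudo_limit_def
  proof safe
    fix a b :: 'i assume "a < b"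
    show "val (v i - v a) = val (v a - v b)"
    proof (cases "b = i")
      case True
      then show ?thesis by (simp add: val_diff_commute v_in')
    next
      case False
      then have "vless (val (v a - v i)) (val (v b - v i))"
        using pc top[of b] \<open>a < b\<close> unfolding pseudo_convergent_def by force
      then have "val ((v a - v i) + - (v b - v i)) = val (v a - v i)"
        using val_uminus[of "v b - v i"] by (intro val_add_eq F_closed v_in') (simp only: F_closed v_in')
      then show ?thesis by (simp add: val_diff_commute v_in')
    qed
  qed
  then show False using no_lim v_in by blast
qed

lemma x_v_less: "i < j \<Longrightarrow> vless (val (x - v i)) (val (x - v j))"
proof -
  assume "i < j"
  obtain l where l: "j < l" using index_unbounded by blast
  then have "vless (val (v i - v l)) (val (v j - v l))"
    using pc \<open>i < j\<close> unfolding pseudo_convergent_def by blast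
  moreover have "val (x - v i) = val (v i - v l)" "val (x - v j) = val (v j - v l)"
    using lim l less_trans[OF \<open>i < j\<close> l] unfolding pseudo_limit_def by blast+
  ultimately show ?thesis by simp
qed

lemma x_v_neq: "x - v i \<noteq> 0"
proof -
  obtain j where "i < j" using index_unbounded by blast
  then have "val (x - v i) \<noteq> None" by (rule vless_imp_Some[OF x_v_less])
  then show ?thesis by auto
qed

lemma exists_mm_nonzero: "\<exists>a\<in>mm. a \<noteq> 0"
proof -
  obtain i :: 'i where True by simp
  obtain j where j: "i < j" using index_unbounded by blast
  obtain l where l: "j < l" using index_unbounded by blast
  \<comment> \<open>The values of v i - v l strictly increase with i below l, so this quotient has
    positive value.\<close>
  let ?a = "(v j - v l) / (v i - v l)"
  have "vless (val (v i - v l)) (val (v j - v l))"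
    using pc j l unfolding pseudo_convergent_def by blast
  moreover from this have nz: "v i - v l \<noteq> 0" using vless_imp_Some by fastforce
  ultimately have "vless (Some 0) (val ?a)"
    by (subst val_divide_pos_iff) (auto intro: F_closed v_in')
  moreover have "?a \<in> K" by (intro K_closed v_in)
  moreover have "val (v j - v l) \<noteq> None"
    using lim l x_v_neq[of j] val_None_iff[of "x - v j"] unfolding pseudo_limit_def
    by (metis F_closed(6) v_in' x_in)
  then have "v j - v l \<noteq> 0" by auto
  ultimately show ?thesis using nz by (intro bexI[of _ ?a]) (auto simp: mm_def V_def vord.less_imp_le)
qed

lemma mm_infinite: "infinite mm"
proof -
  obtain a where a: "a \<in> mm" "a \<noteq> 0" using exists_mm_nonzero by blast
  have "a ^ Suc n \<in> mm" for n
    using a val_power_pos[of a "Suc n"] V_closed(7)[of a "Suc n"] by (auto simp: mm_def V_in K_in simp del: power_Suc)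
  moreover have "inj (\<lambda>n. a ^ Suc n)"
  proof (rule injI)
    fix k l assume eq: "a ^ Suc k = a ^ Suc l"
    have "\<not> Suc k < Suc l" "\<not> Suc l < Suc k"
      using val_power_strict[of a] eq a by (metis K_in V_in mem_Collect_eq mm_def vord.less_irrefl)+
    then show "k = l" by simp
  qed
  ultimately show ?thesis by (meson image_subset_iff infinite_super range_inj_infinite)
qed

text \<open>The comparison is with the value at x rather than between terms of the sequence: by
  \<open>value_dichotomy\<close>, values that are eventually constant must equal that one.\<close>

definition ev_const :: "'a poly \<Rightarrow> bool" where
  "ev_const f \<longleftrightarrow> eventually (\<lambda>i. val (poly f (v i)) = val (poly f x)) at_top"

text \<open>The dominant monomial of f(v i) - f(x) has strictly increasing value. If it ever reaches
  val (f x), it is strictly larger afterwards and f(v i) has the value of f(x); if not, f(v i) has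
  the value of the monomial. In the first case the dominance also bounds every Taylor monomial from
  below, which is the second claim.\<close>

lemma value_dichotomy:
  assumes f: "poly_over K' f"
  shows "ev_const f \<or> eventually (\<lambda>i. vless (val (poly f (v i))) (val (poly f x))
    \<and> (\<forall>j>i. vless (val (poly f (v i))) (val (poly f (v j))))) at_top"
    (is "_ \<or> ?incr")
    and "ev_const f \<Longrightarrow> eventually (\<lambda>i. \<forall>k. vle (val (poly f x))
      (val (coeff (f \<circ>\<^sub>p [:x, 1:]) k * (v i - x) ^ k))) at_top"
proof -
  define p where "p = f \<circ>\<^sub>p [:x, 1:]"
  have p: "poly_over K' p" unfolding p_def by (intro F_poly_closed f x_in F_closed)
  have pv: "poly p (t - x) = poly f t" for t by (simp add: p_def poly_pcompose)
  have p0: "coeff p 0 = poly f x" by (simp add: p_def)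
  let ?d = "\<lambda>i. v i - x"
  have d: "?d i \<in> K'" for i by (intro F_closed v_in' x_in)
  have fK: "poly f (v i) \<in> K'" "poly f x \<in> K'" for i by (intro F_poly f v_in' x_in)+
  have "(ev_const f \<or> ?incr) \<and> (ev_const f \<longrightarrow> eventually (\<lambda>i. \<forall>k. vle (val (poly f x))
      (val (coeff p k * ?d i ^ k))) at_top)"
  proof (cases "degree p = 0")
    case True
    then obtain a where a: "p = [:a:]" by (metis degree_eq_zeroE)
    then have "poly f t = a" for t using pv[of t] by simp
    then have "ev_const f" by (simp add: ev_const_def)
    moreover have "vle (val (poly f x)) (val (coeff p k * ?d i ^ k))" for i k
      using a p0 by (cases k) auto
    ultimately show ?thesis by simp
  next
    case False
    have incr: "vless (val (?d i)) (val (?d j))" if "i < j" for i j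
      using x_v_less[OF that] by (simp add: val_diff_commute x_in v_in')
    obtain m where m: "m > 0" "coeff p m \<noteq> 0"
      and ev: "eventually (\<lambda>i. val (poly p (?d i) - coeff p 0) = val (coeff p m * ?d i ^ m)
       \<and> (\<forall>k>0. vle (val (coeff p m * ?d i ^ m)) (val (coeff p k * ?d i ^ k)))) at_top"
      using poly_increment[where d = ?d, OF d incr index_unbounded p] False by blast
    then obtain i0 where i0: "\<And>i. i \<ge> i0 \<Longrightarrow> val (poly f (v i) - poly f x) = val (coeff p m * ?d i ^ m)"
      "\<And>i k. i \<ge> i0 \<Longrightarrow> k > 0 \<Longrightarrow> vle (val (coeff p m * ?d i ^ m)) (val (coeff p k * ?d i ^ k))"
      unfolding eventually_at_top_linorder pv p0 by blast
    have cK: "coeff p m * ?d i ^ m \<in> K'" for i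
      using p by (intro F_closed(4) F_closed(7) d) (auto simp: poly_over_def)
    have L_incr: "vless (val (coeff p m * ?d i ^ m)) (val (coeff p m * ?d j ^ m))" if "i < j" for i j
    proof -
      have nz: "?d i \<noteq> 0" using x_v_neq[of i] by auto
      define r where "r = ?d j / ?d i"
      have r: "r \<in> K'" "?d j = ?d i * r" "vless (Some 0) (val r)"
        using d nz incr[OF that] by (auto simp: r_def val_divide_pos_iff F_closed)
      have "vless (val (coeff p m * ?d i ^ m * 1)) (val (coeff p m * ?d i ^ m * r ^ m))"
        using val_power_pos[OF r(1,3) m(1)] r m nz cK[of i]
        by (intro val_mult_strict_mono) (auto intro: F_closed)
      then show ?thesis unfolding r(2) by (simp add: power_mult_distrib mult.assoc)
    qed
    show ?thesis
    proof (cases "\<exists>i1\<ge>i0. vle (val (poly f x)) (val (coeff p m * ?d i1 ^ m))")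
      case True
      then obtain i1 where i1: "i1 \<ge> i0" "vle (val (poly f x)) (val (coeff p m * ?d i1 ^ m))" by blast
      obtain i2 where i2: "i1 < i2" using index_unbounded by blast
      have big: "vless (val (poly f x)) (val (coeff p m * ?d i ^ m))" if "i \<ge> i2" for i
        using L_incr[of i1 i] i1(2) i2 that by (meson less_le_trans vord.le_less_trans)
      have ge: "i \<ge> i0" if "i \<ge> i2" for i using that i1(1) i2 by auto
      have "val (poly f (v i)) = val (poly f x)" if "i \<ge> i2" for i
      proof -
        have "val (poly f x + (poly f (v i) - poly f x)) = val (poly f x)"
          using big[OF that] i0(1)[OF ge[OF that]] by (intro val_add_eq F_closed fK) simp
        then show ?thesis by simp
      qed
      then have "ev_const f" unfolding ev_const_def eventually_at_top_linorder by blast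
      moreover have "vle (val (poly f x)) (val (coeff p k * ?d i ^ k))" if "i \<ge> i2" for i k
        using p0 i0(2)[OF ge[OF that], of k] big[OF that]
        by (cases "k = 0") (auto intro: vord.order_trans vord.less_imp_le)
      ultimately show ?thesis unfolding eventually_at_top_linorder by blast
    next
      case False
      have eq: "val (poly f (v i)) = val (coeff p m * ?d i ^ m)"
        and less: "vless (val (poly f (v i))) (val (poly f x))" if "i \<ge> i0" for i
      proof -
        have lt: "vless (val (coeff p m * ?d i ^ m)) (val (poly f x))" using False that by (auto simp: vord.not_le)
        have "val ((poly f (v i) - poly f x) + poly f x) = val (poly f (v i) - poly f x)"
          using lt i0(1)[OF that] by (intro val_add_eq F_closed fK) simp
        then show "val (poly f (v i)) = val (coeff p m * ?d i ^ m)" using i0(1)[OF that] by simp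
        with lt show "vless (val (poly f (v i))) (val (poly f x))" by simp
      qed
      have "vless (val (poly f (v i))) (val (poly f (v j)))" if "i \<ge> i0" "i < j" for i j
        using L_incr[OF that(2)] that eq[of i] eq[of j] by simp
      with less have ?incr unfolding eventually_at_top_linorder by blast
      moreover have "\<not> ev_const f"
      proof
        assume "ev_const f"
        then obtain i1 where "\<And>i. i \<ge> i1 \<Longrightarrow> val (poly f (v i)) = val (poly f x)"
          unfolding ev_const_def eventually_at_top_linorder by blast
        from this[of "max i0 i1"] less[of "max i0 i1"] show False by simp
      qed
      ultimately show ?thesis by blast
    qed
  qed
  then show "ev_const f \<or> ?incr"
    and "ev_const f \<Longrightarrow> eventually (\<lambda>i. \<forall>k. vle (val (poly f x)) (val (coeff (f \<circ>\<^sub>p [:x, 1:]) k * ?d i ^ k))) at_top"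
    unfolding p_def by blast+
qed

lemma ev_const_mult:
  assumes "poly_over K' f" "poly_over K' g" "ev_const f" "ev_const g"
  shows "ev_const (f * g)"
  using assms(3,4) unfolding ev_const_def
  by eventually_elim (simp add: val_mult F_poly assms v_in' x_in)

lemma ev_const_smult_iff:
  assumes "poly_over K' f" "c \<in> K'" "c \<noteq> 0"
  shows "ev_const (smult c f) \<longleftrightarrow> ev_const f"
  using assms unfolding ev_const_def by (simp add: val_mult_eq_iff F_poly v_in' x_in)

lemma min_value_coeff:
  assumes "poly_over K' f" "f \<noteq> 0"
  shows "\<exists>k. coeff f k \<noteq> 0 \<and> (\<forall>i. vle (val (coeff f k)) (val (coeff f i)))"
proof -
  obtain k where k: "\<And>i. i \<le> degree f \<Longrightarrow> vle (val (coeff f k)) (val (coeff f i))"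
    using finite_vle_least[of "{..degree f}" "\<lambda>i. val (coeff f i)"] by auto
  have "coeff f k \<noteq> 0"
  proof
    assume "coeff f k = 0"
    then have "val (lead_coeff f) = None" using k[of "degree f"] by (cases "val (lead_coeff f)") auto
    then show False using assms val_None_iff[of "lead_coeff f"] by (auto simp: poly_over_def)
  qed
  moreover have "vle (val (coeff f k)) (val (coeff f i))" for i
    using k[of i] by (cases "i \<le> degree f") (auto simp: coeff_eq_0)
  ultimately show ?thesis by blast
qed

lemma clear_denominators:
  assumes f: "poly_over K f" "f \<noteq> 0"
  shows "\<exists>c\<in>K. c \<noteq> 0 \<and> poly_over V (smult c f) \<and> (\<exists>k. val (coeff (smult c f) k) = Some 0)"
proof -
  obtain k where k: "coeff f k \<noteq> 0" "\<And>i. vle (val (coeff f k)) (val (coeff f i))"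
    using min_value_coeff[OF poly_over_K_K'] f by blast
  let ?c = "inverse (coeff f k)"
  have fK: "coeff f i \<in> K" for i using f(1) by (simp add: poly_over_def)
  have "?c * coeff f i \<in> V" for i
    using val_divide_nonneg_iff[of "coeff f i" "coeff f k"] k fK K_closed
    by (simp add: V_def K_in field_simps)
  then have "poly_over V (smult ?c f)" by (simp add: poly_over_def)
  moreover have "coeff (smult ?c f) k = 1" using k by simp
  then have "val (coeff (smult ?c f) k) = Some 0" by (simp only: val_1)
  moreover have "?c \<in> K" "?c \<noteq> 0" using k(1) fK K_closed by auto
  ultimately show ?thesis by blast
qed

text \<open>Clearing denominators passes from V to K, and by the dichotomy a failure of
  \<open>ev_const\<close> makes the values increase strictly, against eventual constancy.\<close>

lemma transcendental_seq_iff: "transcendental_seq V val v \<longleftrightarrow> (\<forall>f. poly_over K f \<longrightarrow> ev_const f)"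
proof safe
  fix f assume ts: "transcendental_seq V val v" and f: "poly_over K f"
  show "ev_const f"
  proof (cases "f = 0")
    case True
    then show ?thesis by (simp add: ev_const_def)
  next
    case False
    then obtain c where c: "c \<in> K" "c \<noteq> 0" "poly_over V (smult c f)" using clear_denominators[OF f] by blast
    have "ev_const (smult c f)"
    proof (rule ccontr)
      assume "\<not> ev_const (smult c f)"
      then obtain i1 where i1: "\<And>i j. i \<ge> i1 \<Longrightarrow> i < j \<Longrightarrow> vless (val (poly (smult c f) (v i))) (val (poly (smult c f) (v j)))"
        using value_dichotomy(1)[OF poly_over_K_K'[OF poly_over_V_K[OF c(3)]]]
        unfolding eventually_at_top_linorder by blast
      obtain i0 where "\<And>i i'. i0 \<le> i \<and> i < i' \<Longrightarrow> val (poly (smult c f) (v i)) = val (poly (smult c f) (v i'))"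
        using ts c(3) unfolding transcendental_seq_def by blast
      moreover obtain j where "max i0 i1 < j" using index_unbounded by blast
      ultimately show False using i1[of "max i0 i1" j] by (metis max.cobounded1 max.cobounded2 vord.less_irrefl)
    qed
    then show ?thesis using ev_const_smult_iff[OF poly_over_K_K'[OF f]] c K_in by blast
  qed
next
  assume ev: "\<forall>f. poly_over K f \<longrightarrow> ev_const f"
  show "transcendental_seq V val v"
    unfolding transcendental_seq_def
  proof safe
    fix f assume "poly_over V f"
    then have "ev_const f" using ev poly_over_V_K by blast
    then obtain i0 where "\<And>i. i \<ge> i0 \<Longrightarrow> val (poly f (v i)) = val (poly f x)"
      unfolding ev_const_def eventually_at_top_linorder by blast
    then show "\<exists>i0. \<forall>i i'. i0 \<le> i \<and> i < i' \<longrightarrow> val (poly f (v i)) = val (poly f (v i'))"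
      by (intro exI[of _ i0]) auto
  qed
qed

end

section \<open>Polynomials with eventually increasing values\<close>

lemma poly_cutoff_shift: "(p :: 'a::comm_ring_1 poly) = poly_cutoff k p + monom 1 k * poly_shift k p"
  by (rule poly_eqI) (auto simp: coeff_poly_cutoff coeff_monom_mult coeff_poly_shift)

lemma degree_poly_cutoff_le: "degree (poly_cutoff k p) \<le> k - 1"
  by (rule degree_le) (auto simp: coeff_poly_cutoff)

lemma degree_poly_shift_le: "degree (poly_shift k p) \<le> degree p - k"
  by (rule degree_le) (auto simp: coeff_poly_shift intro: coeff_eq_0)

lemma poly_over_cutoff: "subring_set R \<Longrightarrow> poly_over R p \<Longrightarrow> poly_over R (poly_cutoff k p)"
  by (auto simp: poly_over_def coeff_poly_cutoff subring_set_closed)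

lemma poly_over_shift: "poly_over R p \<Longrightarrow> poly_over R (poly_shift k p)"
  by (auto simp: poly_over_def coeff_poly_shift)

lemma poly_over_monom: "subring_set R \<Longrightarrow> a \<in> R \<Longrightarrow> poly_over R (monom a k)"
  by (auto simp: poly_over_def subring_set_closed)

text \<open>As \<epsilon> inverts the constant coefficient, 1 - \<epsilon> q is divisible by X, and
  the truncated geometric series inverts q modulo X^k.\<close>

lemma inverse_mod_monom:
  fixes q :: "'a::idom poly"
  assumes R: "subring_set R" and q: "poly_over R q" and \<epsilon>: "\<epsilon> \<in> R" "\<epsilon> * coeff q 0 = 1"
  shows "\<exists>w s. poly_over R w \<and> poly_over R s \<and> w * q = 1 + monom 1 k * s"
proof -
  note cl = poly_over_closed[OF R]
  define g where "g = poly_shift 1 (1 - smult \<epsilon> q)"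
  have g: "poly_over R g" unfolding g_def by (intro poly_over_shift cl \<epsilon> q)
  have "poly_cutoff 1 (1 - smult \<epsilon> q) = 0"
    by (rule poly_eqI) (auto simp: coeff_poly_cutoff \<epsilon>)
  then have g1: "1 - smult \<epsilon> q = monom 1 1 * g"
    using poly_cutoff_shift[of "1 - smult \<epsilon> q" 1] by (simp add: g_def)
  define w where "w = smult \<epsilon> (\<Sum>j<k. (monom 1 1 * g) ^ j)"
  have "poly_over R (\<Sum>j<l. (monom 1 1 * g) ^ j)" for l
    by (induction l) (auto intro!: cl poly_over_power[OF R] poly_over_monom[OF R] g simp: subring_set_closed[OF R])
  then have "poly_over R w" unfolding w_def by (intro cl \<epsilon>)
  moreover have "w * q = (1 - monom 1 1 * g) * (\<Sum>j<k. (monom 1 1 * g) ^ j)"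
    unfolding w_def g1[symmetric] by (simp add: mult.commute)
  then have "w * q = 1 - (monom 1 1 * g) ^ k" by (simp only: one_diff_power_eq)
  then have "w * q = 1 + monom 1 k * (- (g ^ k))"
    by (simp add: power_mult_distrib monom_power)
  moreover have "poly_over R (- (g ^ k))"
    using cl(5)[OF cl(1) poly_over_power[OF R g]] by simp
  ultimately show ?thesis by blast
qed

text \<open>The starting product X^k * \<open>poly_shift k h\<close> differs from h by the
  coefficients below k, all divisible by \<pi>. An error \<pi>^(r+1) E is absorbed by solving E = q
  A1 + X^k B1, which is possible since q = \<open>poly_shift k h\<close> is invertible modulo X^k.
  Finitely many steps are taken, so no completeness is involved.\<close>

lemma approximate_factorization:
  fixes h :: "'a::idom poly"
  assumes R: "subring_set R" and \<pi>: "\<pi> \<in> R" and h: "poly_over R h" and k: "0 < k" "k \<le> degree h"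
    and \<epsilon>: "\<epsilon> \<in> R" "\<epsilon> * coeff h k = 1" and low: "\<And>i. i < k \<Longrightarrow> \<exists>b\<in>R. coeff h i = \<pi> * b"
  shows "\<exists>A B E. poly_over R A \<and> poly_over R B \<and> poly_over R E \<and> degree A < k \<and> degree B \<le> degree h - k
    \<and> degree E \<le> degree h
    \<and> h = (monom 1 k + smult \<pi> A) * (poly_shift k h + smult \<pi> B) + smult (\<pi> ^ Suc r) E"
proof (induction r)
  case 0
  from low obtain b where b: "\<And>i. i < k \<Longrightarrow> b i \<in> R \<and> coeff h i = \<pi> * b i" by metis
  define E where "E = (\<Sum>i<k. monom (b i) i)"
  have cE: "coeff E i = (if i < k then b i else 0)" for i by (simp add: E_def coeff_sum)
  have "poly_over R E" using b subring_set_closed[OF R] by (simp add: poly_over_def cE)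
  moreover have "degree E \<le> degree h" by (rule degree_le) (use k in \<open>auto simp: cE\<close>)
  moreover have "poly_cutoff k h = smult \<pi> E"
    by (rule poly_eqI) (auto simp: coeff_poly_cutoff cE b)
  then have "h = (monom 1 k + smult \<pi> 0) * (poly_shift k h + smult \<pi> 0) + smult (\<pi> ^ Suc 0) E"
    using poly_cutoff_shift[of h k] by (simp add: add.commute)
  ultimately show ?case using k poly_over_closed(1)[OF R]
    by (intro exI[of _ 0] exI[of _ E]) simp
next
  case (Suc r)
  then obtain A B E where ABE: "poly_over R A" "poly_over R B" "poly_over R E" "degree A < k" "degree B \<le> degree h - k"
    "degree E \<le> degree h" "h = (monom 1 k + smult \<pi> A) * (poly_shift k h + smult \<pi> B) + smult (\<pi> ^ Suc r) E"
    by blast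
  note cl = poly_over_closed[OF R]
  define q where "q = poly_shift k h"
  have q: "poly_over R q" unfolding q_def by (rule poly_over_shift[OF h])
  have deg_q: "degree q \<le> degree h - k" unfolding q_def by (rule degree_poly_shift_le)
  have "\<epsilon> * coeff q 0 = 1" using \<epsilon> by (simp add: q_def coeff_poly_shift)
  then obtain w s where w: "poly_over R w" "poly_over R s" "w * q = 1 + monom 1 k * s"
    using inverse_mod_monom[OF R q \<epsilon>(1)] by blast
  \<comment> \<open>Remainder and quotient of \<open>E * w\<close> by X^k. Since
    \<open>w * q\<close> is 1 modulo X^k, \<open>q * A1\<close> agrees with \<open>E\<close> modulo
    X^k, and \<open>B1\<close> collects the rest.\<close>
  define A1 where "A1 = poly_cutoff k (E * w)"
  define z where "z = poly_shift k (E * w)"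
  define B1 where "B1 = q * z - E * s"
  have A1: "poly_over R A1" unfolding A1_def by (intro poly_over_cutoff[OF R] cl ABE w)
  have B1: "poly_over R B1" unfolding B1_def z_def by (intro poly_over_shift cl ABE w q)
  have deg_A1: "degree A1 \<le> k - 1" unfolding A1_def by (rule degree_poly_cutoff_le)
  have Ew: "E * w = A1 + monom 1 k * z" unfolding A1_def z_def by (rule poly_cutoff_shift)
  have "q * A1 = E * (w * q) - monom 1 k * (q * z)"
  proof -
    have "E * (w * q) = q * (E * w)" by (simp only: ac_simps)
    also have "\<dots> = q * A1 + monom 1 k * (q * z)" unfolding Ew by (simp add: algebra_simps)
    finally show ?thesis by simp
  qed
  then have E_eq: "E = q * A1 + monom 1 k * B1"
    unfolding w(3) B1_def by (simp add: algebra_simps)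
  \<comment> \<open>The degrees of \<open>w\<close> and \<open>s\<close> are not controlled, so the
    bound is read off from \<open>E_eq\<close> instead of the definition of
    \<open>B1\<close>.\<close>
  have deg_B1: "degree B1 \<le> degree h - k"
  proof (rule degree_le, safe)
    fix i assume i: "degree h - k < i"
    have "degree (q * A1) \<le> (degree h - k) + (k - 1)"
      using degree_mult_le[of q A1] deg_q deg_A1 by linarith
    then have "coeff (q * A1) (i + k) = 0" using i k by (intro coeff_eq_0) linarith
    moreover have "coeff E (i + k) = 0" using i ABE(6) by (intro coeff_eq_0) linarith
    ultimately have "coeff (monom 1 k * B1) (i + k) = 0" using E_eq by (metis add_cancel_right_left coeff_add)
    then show "coeff B1 i = 0" by (simp add: coeff_monom_mult)
  qed
  define A2 where "A2 = A + smult (\<pi> ^ r) A1"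
  define B2 where "B2 = B + smult (\<pi> ^ r) B1"
  \<comment> \<open>What remains after the correction: cross terms with factor \<pi>^(r+2), and A1 *
    B1 with factor \<pi>^(2r+2) = \<pi>^(r+2) \<pi>^r.\<close>
  define E2 where "E2 = 0 - (A * B1 + B * A1) - smult (\<pi> ^ r) (A1 * B1)"
  have \<pi>r: "\<pi> ^ j \<in> R" for j using subring_set_closed(7)[OF R \<pi>] .
  have "poly_over R A2" "poly_over R B2" "poly_over R E2"
    unfolding A2_def B2_def E2_def by (intro cl ABE A1 B1 \<pi>r)+
  moreover have "degree A2 < k"
    unfolding A2_def using ABE(4) deg_A1 k(1) by (intro degree_add_less) (auto intro: le_less_trans[OF degree_smult_le])
  moreover have "degree B2 \<le> degree h - k"
    unfolding B2_def using ABE(5) deg_B1 by (intro degree_add_le) (auto intro: order_trans[OF degree_smult_le])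
  moreover have "degree E2 \<le> degree h"
  proof -
    have "degree (A * B1) \<le> degree h" using degree_mult_le[of A B1] ABE(4) deg_B1 k by linarith
    moreover have "degree (B * A1) \<le> degree h" using degree_mult_le[of B A1] ABE(5) deg_A1 k by linarith
    moreover have "degree (A1 * B1) \<le> degree h" using degree_mult_le[of A1 B1] deg_A1 deg_B1 k by linarith
    ultimately show ?thesis unfolding E2_def
      by (intro degree_diff_le degree_add_le) (auto intro: order_trans[OF degree_smult_le])
  qed
  moreover have "h = (monom 1 k + smult \<pi> A2) * (q + smult \<pi> B2) + smult (\<pi> ^ Suc (Suc r)) E2"
  proof -
    let ?a = "monom 1 k + smult \<pi> A" and ?b = "q + smult \<pi> B" and ?p = "\<pi> ^ Suc r"
    have a2: "monom 1 k + smult \<pi> A2 = ?a + smult ?p A1" by (simp add: A2_def smult_add_right)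
    have b2: "q + smult \<pi> B2 = ?b + smult ?p B1" by (simp add: B2_def smult_add_right)
    have "(?a + smult ?p A1) * (?b + smult ?p B1)
        = ?a * ?b + smult ?p (?a * B1 + ?b * A1) + smult (?p * ?p) (A1 * B1)"
      by (simp add: algebra_simps smult_add_right)
    also have "?a * B1 + ?b * A1 = E + smult \<pi> (A * B1 + B * A1)"
      unfolding E_eq by (simp add: algebra_simps smult_add_right)
    finally have "(monom 1 k + smult \<pi> A2) * (q + smult \<pi> B2)
      = ?a * ?b + smult ?p E + smult (?p * \<pi>) (A * B1 + B * A1) + smult (?p * ?p) (A1 * B1)"
      unfolding a2 b2 by (simp add: smult_add_right add.assoc)
    moreover have "smult (\<pi> ^ Suc (Suc r)) E2 = - smult (?p * \<pi>) (A * B1 + B * A1) - smult (?p * ?p) (A1 * B1)"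
      unfolding E2_def by (simp add: smult_diff_right smult_add_right algebra_simps)
    ultimately show ?thesis using ABE(7) by (simp add: q_def)
  qed
  ultimately show ?case unfolding q_def by blast
qed

section \<open>Factorization up to a small error, and transcendence of v from attained
  values\<close>

context pseudo_limit_extension
begin

text \<open>Otherwise the elements whose value is at least that of every power of a form a prime
  ideal. It contains w but not a, so it lies strictly between 0 and the maximal ideal, giving a
  chain of length two.\<close>

lemma dim_one_archimedean:
  assumes dim: "krull_dim_one V" and a: "a \<in> mm" "a \<noteq> 0" and w: "w \<in> V" "w \<noteq> 0"
  shows "\<exists>r. vless (val w) (val (a ^ r))"
proof (rule ccontr)
  assume "\<nexists>r. vless (val w) (val (a ^ r))"
  then have w_ge: "vle (val (a ^ r)) (val w)" for r by (simp add: vord.not_less)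
  have aV: "a \<in> V" "vless (Some 0) (val a)" using a by (auto simp: mm_def)
  have aK: "a ^ r \<in> K'" "a \<in> K'" for r using aV by (auto intro: K_in V_in V_closed)
  define P where "P = {b \<in> V. \<forall>r. vle (val (a ^ r)) (val b)}"
  have "1 \<notin> P"
  proof
    assume "1 \<in> P"
    then have "vle (val (a ^ 1)) (val 1)" unfolding P_def by blast
    with aV(2) show False by simp
  qed
  then have neq: "P \<noteq> V" using V_closed(2) by blast
  have ideal: "ideal_of V P"
    unfolding ideal_of_def
  proof (intro conjI ballI)
    show "P \<subseteq> V" "0 \<in> P" using V_closed(1) by (auto simp: P_def)
    fix b c assume "b \<in> P" "c \<in> P"
    then show "b + c \<in> P" "- b \<in> P"
      using V_closed(3,5) by (auto simp: P_def V_in K_in intro!: val_add_ge)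
  next
    fix b c assume "b \<in> V" "c \<in> P"
    then show "b * c \<in> P"
      using V_closed(4) by (auto simp: P_def V_def K_in intro!: val_mult_nonneg)
  qed
  have "b \<in> P \<or> c \<in> P" if bc: "b \<in> V" "c \<in> V" "b * c \<in> P" for b c
  proof (rule ccontr)
    assume "\<not> (b \<in> P \<or> c \<in> P)"
    then obtain r s where rs: "vless (val b) (val (a ^ r))" "vless (val c) (val (a ^ s))"
      using bc by (auto simp: P_def vord.not_le)
    have K: "b \<in> K'" "c \<in> K'" using bc V_in K_in by auto
    have "b \<noteq> 0" using vless_imp_Some[OF rs(1)] by auto
    then have "vless (val (b * c)) (val (b * a ^ s))" using K aK rs by (intro val_mult_strict_mono) auto
    moreover have "vless (val (a ^ s * b)) (val (a ^ s * a ^ r))"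
      using K aK rs a by (intro val_mult_strict_mono) auto
    ultimately have "vless (val (b * c)) (val (a ^ (s + r)))"
      by (simp add: power_add mult.commute)
    then show False using bc(3) by (auto simp: P_def vord.not_less[symmetric])
  qed
  then have "prime_ideal_of V P" using ideal neq by (auto simp: prime_ideal_of_def)
  moreover have "V \<noteq> {0}" using V_closed(2) by (metis singletonD zero_neq_one)
  then have "prime_ideal_of V {0}"
    using V_closed(1) by (auto simp: prime_ideal_of_def ideal_of_def)
  moreover have "{0} \<subset> P" using w w_ge V_closed(1) by (auto simp: P_def)
  moreover have "P \<subset> mm"
  proof -
    have "b \<in> mm" if "b \<in> P" for b
    proof -
      have "vle (val (a ^ 1)) (val b)" using that unfolding P_def by blast
      with aV(2) have "vless (Some 0) (val b)" by simp
      with that show ?thesis by (simp add: P_def mm_def)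
    qed
    moreover have "a \<notin> P"
    proof
      assume "a \<in> P"
      then have "vle (val (a ^ 2)) (val a)" unfolding P_def by blast
      moreover have "vless (val (a ^ 1)) (val (a ^ 2))"
        using aV a aK by (intro val_power_strict) auto
      ultimately show False by simp
    qed
    ultimately show ?thesis using a by blast
  qed
  ultimately show False using dim prime_mm unfolding krull_dim_one_def by blast
qed

lemma val_V_not_mm: "a \<in> V \<Longrightarrow> a \<notin> mm \<Longrightarrow> val a = Some 0"
  by (auto simp: V_def mm_def)

text \<open>The common output of the two cases: a factorization with error beyond any prescribed
  value. For henselian V the error is 0 and its value is \<open>None\<close>.\<close>

lemma gap_approximate_factorization:
  assumes D: "krull_dim_one V \<or> henselian V mm"
    and h: "poly_over V h" and low: "\<And>i. i < k \<Longrightarrow> coeff h i \<in> mm"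
    and k: "coeff h k \<notin> mm" "0 < k" "k < degree h" and w: "w \<in> V" "w \<noteq> 0"
  shows "\<exists>A B. poly_over K A \<and> poly_over K B \<and> degree A < degree h \<and> degree B < degree h
     \<and> (\<forall>i. vless (val w) (val (coeff (h - A * B) i)))"
  using D
proof
  assume "henselian V mm"
  then interpret henselian_ring V mm
    using V_closed prime_mm mm_infinite by unfold_locales auto
  obtain A B where "poly_over K A" "poly_over K B" "degree A < degree h" "degree B < degree h" "h = A * B"
    using hensel_factorization[OF subK _ h low k] V_in by blast
  moreover have "val w \<noteq> None" using w by (simp add: val_None_iff V_in K_in)
  ultimately show ?thesis by (intro exI[of _ A] exI[of _ B]) (auto simp: vless_None_iff)
next
  assume dim: "krull_dim_one V"
  have hV: "coeff h i \<in> V" for i using h by (simp add: poly_over_def)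
  have hK: "coeff h i \<in> K" "coeff h i \<in> K'" for i using hV V_in K_in by auto
  have unit: "val (coeff h k) = Some 0" by (rule val_V_not_mm[OF hV k(1)])
  then have ck: "coeff h k \<noteq> 0" by auto
  \<comment> \<open>A nonzero coefficient of least value among those below k divides them all; if
    they all vanish, any nonzero element of \<open>mm\<close> serves.\<close>
  have "\<exists>\<pi>\<in>mm. \<pi> \<noteq> 0 \<and> (\<forall>i<k. vle (val \<pi>) (val (coeff h i)))"
  proof (cases "poly_cutoff k h = 0")
    case True
    then have "coeff h i = 0" if "i < k" for i using that by (metis coeff_0 coeff_poly_cutoff)
    then show ?thesis using exists_mm_nonzero by auto
  next
    case False
    have "poly_over K' (poly_cutoff k h)"
      using hK F_closed(1) by (auto simp: poly_over_def coeff_poly_cutoff)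
    then obtain j where j: "coeff (poly_cutoff k h) j \<noteq> 0"
      "\<And>i. vle (val (coeff (poly_cutoff k h) j)) (val (coeff (poly_cutoff k h) i))"
      using min_value_coeff False by blast
    then have "j < k" "coeff h j \<noteq> 0" by (auto simp: coeff_poly_cutoff split: if_splits)
    moreover have "vle (val (coeff h j)) (val (coeff h i))" if "i < k" for i
      using j(2)[of i] that \<open>j < k\<close> by (simp add: coeff_poly_cutoff)
    ultimately show ?thesis using low by blast
  qed
  then obtain \<pi> where \<pi>: "\<pi> \<in> mm" "\<pi> \<noteq> 0" "\<And>i. i < k \<Longrightarrow> vle (val \<pi>) (val (coeff h i))" by blast
  have \<pi>V: "\<pi> \<in> V" "vless (Some 0) (val \<pi>)" using \<pi>(1) by (auto simp: mm_def)
  have \<pi>K: "\<pi> \<in> K" "\<pi> \<in> K'" using \<pi>V V_in K_in by auto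
  obtain r where r: "vless (val w) (val (\<pi> ^ r))" using dim_one_archimedean[OF dim \<pi>(1,2) w] by blast
  have "\<exists>b\<in>V. coeff h i = \<pi> * b" if "i < k" for i
  proof
    show "coeff h i / \<pi> \<in> V"
      using \<pi>(2) \<pi>(3)[OF that] hK \<pi>K by (simp add: V_def K_closed val_divide_nonneg_iff)
    show "coeff h i = \<pi> * (coeff h i / \<pi>)" using \<pi>(2) by simp
  qed
  moreover have "inverse (coeff h k) \<in> V"
    using val_divide_zero_iff[of 1 "coeff h k"] unit ck hK by (simp add: V_def K_closed F_closed divide_inverse)
  moreover have "inverse (coeff h k) * coeff h k = 1" using ck by simp
  ultimately obtain A B E where ABE: "poly_over V A" "poly_over V B" "poly_over V E" "degree A < k"
    "degree B \<le> degree h - k"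
    "h = (monom 1 k + smult \<pi> A) * (poly_shift k h + smult \<pi> B) + smult (\<pi> ^ Suc r) E"
    using approximate_factorization[OF subring_V \<pi>V(1) h k(2) less_imp_le[OF k(3)], of "inverse (coeff h k)" r] by blast
  let ?A = "monom 1 k + smult \<pi> A" and ?B = "poly_shift k h + smult \<pi> B"
  have "poly_over V ?A" "poly_over V ?B"
    by (intro V_poly_closed poly_over_monom[OF subring_V] poly_over_shift ABE h \<pi>V V_closed)+
  moreover have "degree ?A < degree h"
    using ABE(4) k by (intro degree_add_less) (auto intro: le_less_trans[OF degree_smult_le] le_less_trans[OF degree_monom_le])
  moreover have "degree ?B < degree h"
  proof -
    have "degree ?B \<le> degree h - k"
      using ABE(5) degree_poly_shift_le by (intro degree_add_le) (auto intro: order_trans[OF degree_smult_le])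
    then show ?thesis using k by linarith
  qed
  moreover have "vless (val w) (val (coeff (h - ?A * ?B) i))" for i
  proof -
    have "h - ?A * ?B = smult (\<pi> ^ Suc r) E" using ABE(6) by (simp add: algebra_simps)
    then have eq: "coeff (h - ?A * ?B) i = (\<pi> * coeff E i) * \<pi> ^ r" by simp
    have "\<pi> * coeff E i \<in> V" using ABE(3) \<pi>V V_closed(4) by (simp add: poly_over_def)
    then have "vle (val (\<pi> ^ r)) (val ((\<pi> * coeff E i) * \<pi> ^ r))"
      by (intro val_mult_nonneg[of "\<pi> * coeff E i"]) (simp_all add: V_def K_in F_closed \<pi>K)
    with r show ?thesis unfolding eq by (rule vord.less_le_trans)
  qed
  ultimately show ?thesis using poly_over_V_K by blast
qed

lemma val_poly_ge:
  assumes "poly_over K' p" "\<And>i. vle c (val (coeff p i))" "t \<in> K'" "vle (Some 0) (val t)"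
  shows "vle c (val (poly p t))"
  unfolding poly_altdef
proof (rule val_sum_ge)
  fix i
  have "vle c (val (t ^ i * coeff p i))"
    using assms by (intro val_mult_nonneg val_power_nonneg) (auto intro: F_closed simp: poly_over_def)
  moreover have "coeff p i * t ^ i \<in> K'" using assms by (intro F_closed) (auto simp: poly_over_def)
  ultimately show "coeff p i * t ^ i \<in> K' \<and> vle c (val (coeff p i * t ^ i))" by (simp add: mult.commute)
qed

lemma val_poly_gt:
  assumes "poly_over K' p" "\<And>i. vless c (val (coeff p i))" "t \<in> K'" "vle (Some 0) (val t)"
  shows "vless c (val (poly p t))"
  unfolding poly_altdef
proof (rule val_sum_gt)
  show "c \<noteq> None" by (rule vless_imp_Some[OF assms(2)])
  fix i
  have "vle (val (coeff p i)) (val (t ^ i * coeff p i))"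
    using assms by (intro val_mult_nonneg val_power_nonneg) (auto intro: F_closed simp: poly_over_def)
  with assms(2)[of i] have "vless c (val (t ^ i * coeff p i))" by (rule vord.less_le_trans)
  moreover have "coeff p i * t ^ i \<in> K'" using assms by (intro F_closed) (auto simp: poly_over_def)
  ultimately show "coeff p i * t ^ i \<in> K' \<and> vless c (val (coeff p i * t ^ i))" by (simp add: mult.commute)
qed

text \<open>The value bound at y makes the reduction of \<open>h\<close> vanish at 0, and the strict
  increase along v prevents this reduction from being a scalar multiple of the leading monomial. So
  0 < k < degree h, as the factorization lemma requires.\<close>

lemma ev_const_if_values_attained:
  assumes D: "krull_dim_one V \<or> henselian V mm"
    and H: "\<And>f. poly_over V f \<Longrightarrow> poly f x \<noteq> 0 \<Longrightarrow> \<exists>y\<in>V. vle (val (poly f x)) (val (poly f y))"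
    and g: "poly_over K g"
  shows "ev_const g"
proof (rule ccontr)
  assume "\<not> ev_const g"
  with g have "\<exists>g. poly_over K g \<and> \<not> ev_const g" by blast
  then obtain f where f: "poly_over K f" "\<not> ev_const f"
    and minimal: "\<And>g. poly_over K g \<Longrightarrow> degree g < degree f \<Longrightarrow> ev_const g"
    using ex_has_least_nat[of "\<lambda>g. poly_over K g \<and> \<not> ev_const g" _ degree] by (metis not_le)
  have fK': "poly_over K' f" by (rule poly_over_K_K'[OF f(1)])
  have f0: "f \<noteq> 0" using f(2) by (auto simp: ev_const_def)
  then have fx: "poly f x \<noteq> 0" using trans f(1) by (auto simp: transcendental_over_def)
  obtain i0 where less_x: "\<And>i. i \<ge> i0 \<Longrightarrow> vless (val (poly f (v i))) (val (poly f x))"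
    and incr: "\<And>i j. i \<ge> i0 \<Longrightarrow> i < j \<Longrightarrow> vless (val (poly f (v i))) (val (poly f (v j)))"
    using value_dichotomy(1)[OF fK'] f(2) unfolding eventually_at_top_linorder by blast
  obtain c where c: "c \<in> K" "c \<noteq> 0" "poly_over V (smult c f)" using clear_denominators[OF f(1) f0] by blast
  then obtain y where y: "y \<in> V" "vle (val (poly (smult c f) x)) (val (poly (smult c f) y))"
    using H[of "smult c f"] fx by auto
  have yK: "y \<in> K" "y \<in> K'" using y V_in K_in by auto
  have fy: "vle (val (poly f x)) (val (poly f y))"
    using y(2) c yK by (simp add: val_mult_le_iff K_in F_poly[OF fK'] x_in)

  have "\<not> pseudo_limit val v y" using no_lim yK by blast
  then obtain i1 i' where "i1 < i'" "val (y - v i1) \<noteq> val (v i1 - v i')" by (auto simp: pseudo_limit_def)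
  then have neq: "val (y - v i1) \<noteq> val (x - v i1)" using lim by (simp add: pseudo_limit_def)
  have dK: "x - v i \<in> K'" "y - v i \<in> K'" "- (y - v i) \<in> K'" "- (x - v i) \<in> K'" "x - y \<in> K'" for i
    by (intro F_closed x_in yK v_in')+
  \<comment> \<open>The distances from v i1 to x and to y are different, so val (x - y) is the
    smaller of the two values.\<close>
  have "vle (val (x - y)) (val (x - v i1))"
  proof (cases "vless (val (y - v i1)) (val (x - v i1))")
    case True
    have "val (- (y - v i1) + (x - v i1)) = val (- (y - v i1))"
      using True dK by (intro val_add_eq) (simp_all only: val_uminus)
    with True show ?thesis using val_uminus[OF dK(2)] by (simp add: vord.less_imp_le)
  next
    case False
    with neq have lt: "vless (val (x - v i1)) (val (y - v i1))" by (simp add: vord.not_less vord.less_le)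
    have "val ((x - v i1) + - (y - v i1)) = val (x - v i1)"
      using lt dK by (intro val_add_eq) (simp_all only: val_uminus)
    then show ?thesis by simp
  qed
  then have xy: "vless (val (x - y)) (val (x - v j))" if "i1 < j" for j
    using x_v_less[OF that] by (rule vord.le_less_trans)
  have vy: "val (v j - y) = val (x - y)" if "i1 < j" for j
  proof -
    have "val ((x - y) + - (x - v j)) = val (x - y)"
      using xy[OF that] dK by (intro val_add_eq) (simp_all only: val_uminus)
    then show ?thesis by simp
  qed
  obtain j1 where j1: "i1 < j1" using index_unbounded by blast
  \<comment> \<open>An element of K whose value is val (x - y). The affine map \<open>\<xi>\<close>
    then sends x and all v j with j > i1 to elements of value 0.\<close>
  define u where "u = v j1 - y"
  have uK: "u \<in> K" "u \<in> K'" unfolding u_def by (auto intro: K_closed F_closed v_in v_in' yK)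
  have val_u: "val u = val (x - y)" unfolding u_def by (rule vy[OF j1])
  have u0: "u \<noteq> 0" using val_u vless_imp_Some[OF xy[OF j1]] by auto
  define \<xi> where "\<xi> = (\<lambda>t. (t - y) / u)"
  have \<xi>K: "\<xi> t \<in> K'" if "t \<in> K'" for t unfolding \<xi>_def using that by (intro F_closed yK uK)
  have \<xi>_unit: "val (\<xi> (v j)) = Some 0" if "i1 < j" for j
    unfolding \<xi>_def using vy[OF that] uK u0 by (subst val_divide_zero_iff) (auto simp: val_u F_closed v_in' yK)
  have \<xi>x: "val (\<xi> x) = Some 0"
    unfolding \<xi>_def using uK u0 by (subst val_divide_zero_iff) (auto simp: val_u F_closed x_in yK)

  define h0 where "h0 = f \<circ>\<^sub>p [:y, u:]"
  have h0: "poly_over K h0" unfolding h0_def by (intro K_poly_closed f(1) yK uK)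
  have deg_h0: "degree h0 = degree f" unfolding h0_def using u0 by (simp add: degree_pcompose)
  have "h0 \<noteq> 0" unfolding h0_def using f0 u0 by (subst pcompose_eq_0_iff) auto
  then obtain e k0 where e: "e \<in> K" "e \<noteq> 0" "poly_over V (smult e h0)" "val (coeff (smult e h0) k0) = Some 0"
    using clear_denominators[OF h0] by blast
  define h where "h = smult e h0"
  have h: "poly_over V h" "val (coeff h k0) = Some 0" and deg_h: "degree h = degree f"
    using e deg_h0 by (auto simp: h_def)
  have hK': "poly_over K' h" by (intro poly_over_K_K' poly_over_V_K h)
  have poly_h: "poly h (\<xi> t) = e * poly f t" for t
    using u0 by (simp add: h_def h0_def \<xi>_def poly_pcompose)
  have h_0: "poly h 0 = e * poly f y" by (simp add: h_def h0_def poly_pcompose)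
  have eK: "e \<in> K'" by (rule K_in[OF e(1)])
  have fvK: "poly f (v i) \<in> K'" "poly f x \<in> K'" "poly f y \<in> K'" for i
    using F_poly[OF fK'] v_in' x_in yK by auto

  \<comment> \<open>The multiplicity of the root 0 of the reduction of \<open>h\<close>.\<close>
  define k where "k = (LEAST k. coeff h k \<notin> mm)"
  have "coeff h k0 \<notin> mm" using h(2) by (simp add: mm_def)
  then have k: "coeff h k \<notin> mm" and low: "\<And>i. i < k \<Longrightarrow> coeff h i \<in> mm"
    unfolding k_def by (rule LeastI) (use not_less_Least in blast)
  have hV: "coeff h i \<in> V" for i using h(1) by (simp add: poly_over_def)
  have "coeff h k \<noteq> 0" using val_V_not_mm[OF hV k] by auto
  then have "k \<le> degree h" by (rule le_degree)
  \<comment> \<open>The constant coefficient of \<open>h\<close> is e f(y). Its value is at least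
    that of e f(x), hence above that of e f(v j), which is nonnegative since \<open>h\<close> is
    integral.\<close>
  have "k \<noteq> 0"
  proof
    assume "k = 0"
    define j where "j = max i0 j1"
    have j: "j \<ge> i0" "i1 < j" using j1 by (auto simp: j_def less_max_iff_disj)
    have "vle (Some 0) (val (poly h (\<xi> (v j))))"
      using hV \<xi>_unit[OF j(2)] by (intro val_poly_ge hK' \<xi>K v_in') (auto simp: V_def)
    then have "vle (Some 0) (val (e * poly f (v j)))" by (simp add: poly_h)
    also have "vless \<dots> (val (e * poly f y))"
      using vord.less_le_trans[OF less_x[OF j(1)] fy] e eK fvK by (intro val_mult_strict_mono)
    finally (vord.le_less_trans) have "coeff h 0 \<in> mm"
      using hV[of 0] by (simp add: mm_def h_0 flip: poly_0_coeff_0)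
    with k \<open>k = 0\<close> show False by simp
  qed
  \<comment> \<open>Otherwise the top monomial alone decides the value of \<open>h\<close> at
    arguments of value 0, and val (f (v j)) would be constant.\<close>
  moreover have "k \<noteq> degree h"
  proof
    assume kn: "k = degree h"
    have "val (poly h (\<xi> (v j))) = Some 0" if "i1 < j" for j
    proof -
      let ?t = "\<lambda>i. coeff h i * \<xi> (v j) ^ i"
      have tK: "?t i \<in> K'" for i using hK' by (intro F_closed \<xi>K v_in') (simp add: poly_over_def)
      have pow: "val (\<xi> (v j) ^ i) = Some 0" for i
        by (induction i) (auto simp: val_mult \<xi>_unit[OF that] \<xi>K v_in' F_closed)
      have valt: "val (?t i) = val (coeff h i)" for i
        using hV[of i] pow[of i] by (cases "val (coeff h i)") (auto simp: val_mult V_in K_in F_closed \<xi>K v_in')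
      have "poly h (\<xi> (v j)) = ?t k + (\<Sum>i<k. ?t i)"
        unfolding poly_altdef kn by (simp flip: lessThan_Suc_atMost)
      moreover have "val (?t k + (\<Sum>i<k. ?t i)) = val (?t k)"
      proof (rule val_add_eq[OF tK F_sum[OF tK]])
        have tk: "val (?t k) = Some 0" using valt val_V_not_mm[OF hV k] by simp
        show "vless (val (?t k)) (val (\<Sum>i<k. ?t i))"
          unfolding tk by (rule val_sum_gt) (use low tK valt in \<open>auto simp: mm_def\<close>)
      qed
      ultimately show ?thesis using valt val_V_not_mm[OF hV k] by simp
    qed
    then have const: "val (e * poly f (v j)) = Some 0" if "i1 < j" for j using that by (simp add: poly_h)
    define j where "j = max i0 j1"
    obtain l where "j < l" using index_unbounded by blast
    have j: "j \<ge> i0" "i1 < j" using j1 by (auto simp: j_def less_max_iff_disj)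
    have "vless (val (e * poly f (v j))) (val (e * poly f (v l)))"
      using incr[OF j(1) \<open>j < l\<close>] e eK fvK by (intro val_mult_strict_mono)
    then show False using const j \<open>j < l\<close> by (simp add: less_trans[OF j(2)])
  qed
  ultimately have kk: "0 < k" "k < degree h" using \<open>k \<le> degree h\<close> by auto

  have hx0: "poly h (\<xi> x) \<noteq> 0" using poly_h fx e by simp
  have hxK: "poly h (\<xi> x) \<in> K'" by (intro F_poly hK' \<xi>K x_in)
  \<comment> \<open>The tolerance for the factorization is the value of e f(x), represented by an
    element of K.\<close>
  then obtain w where w: "w \<in> K" "w \<noteq> 0" "val w = val (poly h (\<xi> x))" using exists_same_value hx0 by blast
  moreover have "vle (Some 0) (val (poly h (\<xi> x)))"
    using hV \<xi>x by (intro val_poly_ge hK' \<xi>K x_in) (auto simp: V_def)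
  ultimately have wV: "w \<in> V" by (simp add: V_def)
  obtain A B where AB: "poly_over K A" "poly_over K B" "degree A < degree h" "degree B < degree h"
    "\<And>i. vless (val w) (val (coeff (h - A * B) i))"
    using gap_approximate_factorization[OF D h(1) low k kk wV w(2)] by blast
  \<comment> \<open>The map \<open>\<xi>\<close> as a linear polynomial over K: composition with it
    keeps degrees, so minimality of f applies to both factors.\<close>
  define s where "s = [:- y / u, 1 / u:]"
  have s: "poly_over K s" unfolding s_def by (intro K_poly_closed K_closed yK uK)
  have poly_s: "poly s t = \<xi> t" for t by (simp add: s_def \<xi>_def diff_divide_distrib)
  have "degree s = 1" using u0 by (simp add: s_def)
  then have "ev_const (A \<circ>\<^sub>p s)" "ev_const (B \<circ>\<^sub>p s)"
    using AB deg_h by (auto intro!: minimal K_poly_closed s simp: degree_pcompose)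
  then have "ev_const ((A \<circ>\<^sub>p s) * (B \<circ>\<^sub>p s))"
    using AB s by (intro ev_const_mult poly_over_K_K' K_poly_closed)
  then obtain i2 where i2: "\<And>i. i \<ge> i2 \<Longrightarrow> val (poly (A * B) (\<xi> (v i))) = val (poly (A * B) (\<xi> x))"
    unfolding ev_const_def eventually_at_top_linorder by (auto simp: poly_pcompose poly_s)
  have ABK: "poly_over K' (A * B)" "poly_over K' (h - A * B)"
    by (intro poly_over_K_K' K_poly_closed AB poly_over_V_K[OF h(1)])+
  \<comment> \<open>The error has value above that of e f(x), which in turn exceeds that of e f(v
    j), so it does not change the value.\<close>
  have same: "val (poly (A * B) (\<xi> (v j))) = val (e * poly f (v j))" if j: "j \<ge> i0" "i1 < j" for j
  proof -
    have \<xi>j: "\<xi> (v j) \<in> K'" "vle (Some 0) (val (\<xi> (v j)))" using \<xi>K v_in' \<xi>_unit[OF j(2)] by auto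
    have "vless (val (e * poly f (v j))) (val (e * poly f x))"
      using less_x[OF j(1)] e eK fvK by (intro val_mult_strict_mono)
    also have "val (e * poly f x) = val w" by (simp add: w(3) poly_h)
    also have "vless (val w) (val (poly (h - A * B) (\<xi> (v j))))"
      by (rule val_poly_gt[OF ABK(2) AB(5) \<xi>j])
    finally (vord.less_trans) have lt: "vless (val (e * poly f (v j))) (val (- poly (h - A * B) (\<xi> (v j))))"
      by (simp only: val_uminus[OF F_poly[OF ABK(2) \<xi>j(1)]])
    have "val (e * poly f (v j) + - poly (h - A * B) (\<xi> (v j))) = val (e * poly f (v j))"
      by (rule val_add_eq[OF _ _ lt]) (intro F_closed F_poly ABK \<xi>j eK fvK)+
    then show ?thesis by (simp add: poly_h)
  qed
  define j where "j = max i2 (max i0 j1)"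
  obtain l where jl: "j < l" using index_unbounded by blast
  have j: "j \<ge> i0" "i1 < j" "j \<ge> i2" using j1 by (auto simp: j_def less_max_iff_disj le_max_iff_disj)
  have "val (e * poly f (v j)) = val (e * poly f (v l))"
    using same[OF j(1,2)] same[of l] i2[OF j(3)] i2[of l] jl j by auto
  moreover have "vless (val (e * poly f (v j))) (val (e * poly f (v l)))"
    using incr[OF j(1) jl] e eK fvK by (intro val_mult_strict_mono)
  ultimately show False by simp
qed

end

section \<open>Filtered unions\<close>

lemma poly_over_sum: "subring_set R \<Longrightarrow> (\<And>i. i \<in> I \<Longrightarrow> poly_over R (f i)) \<Longrightarrow> poly_over R (sum f I)"
  by (induction I rule: infinite_finite_induct) (auto intro: poly_over_closed)

lemma poly_subalgI: "poly_over V p \<Longrightarrow> poly p z \<in> poly_subalg V z"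
  by (auto simp: poly_subalg_def)

lemma field_adjoin_subset_fractions:
  assumes K: "subfield K"
  shows "field_adjoin K x \<subseteq> {poly f x / poly g x | f g. poly_over K f \<and> poly_over K g \<and> poly g x \<noteq> 0}"
    (is "_ \<subseteq> ?Q")
proof -
  note cl = poly_over_closed[OF subfield_subring[OF K]]
  have I: "poly f x / poly g x \<in> ?Q" if "poly_over K f" "poly_over K g" "poly g x \<noteq> 0" for f g
    using that by blast
  have one: "poly (1 :: 'a poly) x \<noteq> 0" by simp
  have KQ: "a \<in> ?Q" if "a \<in> K" for a
    using I[OF cl(3)[OF that cl(1)] cl(2) one] by simp
  have "subfield ?Q"
    unfolding subfield_def
  proof (intro conjI ballI impI)
    show "0 \<in> ?Q" "1 \<in> ?Q" by (rule KQ, use K in \<open>simp add: subfield_def\<close>)+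
  next
    fix a b assume "a \<in> ?Q" "b \<in> ?Q"
    then obtain f g h k where eq: "a = poly f x / poly g x" "b = poly h x / poly k x"
      and fg: "poly_over K f" "poly_over K g" "poly g x \<noteq> 0" "poly_over K h" "poly_over K k" "poly k x \<noteq> 0" by blast
    have "a + b = poly (f * k + h * g) x / poly (g * k) x" using fg by (simp add: eq field_simps)
    moreover have "poly (f * k + h * g) x / poly (g * k) x \<in> ?Q"
      using fg by (intro I cl) auto
    ultimately show "a + b \<in> ?Q" by (simp only:)
    have "a * b = poly (f * h) x / poly (g * k) x" by (simp add: eq)
    moreover have "poly (f * h) x / poly (g * k) x \<in> ?Q" using fg by (intro I cl) auto
    ultimately show "a * b \<in> ?Q" by (simp only:)
    have "- a = poly (0 - f) x / poly g x" by (simp add: eq)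
    moreover have "poly (0 - f) x / poly g x \<in> ?Q" using fg by (intro I cl) auto
    ultimately show "- a \<in> ?Q" by (simp only:)
  next
    fix a assume "a \<in> ?Q" "a \<noteq> 0"
    then obtain f g where "a = poly f x / poly g x" "poly_over K f" "poly_over K g" "poly g x \<noteq> 0" by blast
    with I[of g f] \<open>a \<noteq> 0\<close> show "inverse a \<in> ?Q" by auto
  qed
  moreover have "x \<in> ?Q"
  proof -
    have "poly_over K [:0, 1:]" by (intro cl subring_set_closed[OF subfield_subring[OF K]])
    from I[OF this cl(2) one] show ?thesis by simp
  qed
  ultimately show ?thesis unfolding field_adjoin_def using KQ by blast
qed

section \<open>A chain of localizations of V[(x - v i) / U i] exhausting V'\<close>

context pseudo_limit_extension
begin

text \<open>The polynomial g is f(v i + (U i) T) / c with c in K of value val (f x). Its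
  coefficients visibly lie in K; that they have nonnegative value is seen from the expansion at x,
  where \<open>value_dichotomy\<close> bounds each Taylor monomial.\<close>

lemma unit_representation:
  assumes f: "poly_over K f" "poly f x \<noteq> 0" "ev_const f"
    and U: "\<And>i. U i \<in> K \<and> U i \<noteq> 0 \<and> val (U i) = val (x - v i)"
  shows "eventually (\<lambda>i. \<exists>c\<in>K. \<exists>g. c \<noteq> 0 \<and> poly_over V g \<and> poly f x = c * poly g ((x - v i) / U i)
    \<and> val (poly g ((x - v i) / U i)) = Some 0) at_top"
  using value_dichotomy(2)[OF poly_over_K_K'[OF f(1)] f(3)]
proof eventually_elim
  case (elim i)
  let ?p = "f \<circ>\<^sub>p [:x, 1:]" and ?d = "v i - x" and ?X = "(x - v i) / U i"
  have fx: "poly f x \<in> K'" by (intro F_poly poly_over_K_K' f x_in)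
  obtain c where c: "c \<in> K" "c \<noteq> 0" "val c = val (poly f x)" using exists_same_value[OF fx f(2)] by blast
  have cK: "c \<in> K'" using c K_in by blast
  have d: "?d \<in> K'" "?d \<noteq> 0" "val ?d = val (U i)"
    using x_v_neq[of i] U[of i] by (auto simp: val_diff_commute v_in' x_in F_closed)
  have UK: "U i \<in> K'" "U i \<noteq> 0" "val (U i) = val (x - v i)" using U[of i] K_in by auto
  define Q where "Q = f \<circ>\<^sub>p [:v i, U i:]"
  \<comment> \<open>This is f(x + (v i - x) T) / c, with coefficients in V' but in general not in K,
    because it is centred at x.\<close>
  define P where "P = smult (1 / c) (?p \<circ>\<^sub>p [:0, ?d:])"
  have "coeff P k \<in> V'" for k
  proof -
    have "coeff P k = (coeff ?p k * ?d ^ k) / c" by (simp add: P_def coeff_pcompose_linear mult.commute)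
    moreover have "coeff ?p k * ?d ^ k \<in> K'"
      using poly_over_K_K'[OF f(1)] d
      by (intro F_closed(4) F_closed(7) poly_over_coeff F_poly_closed x_in F_closed(1,2))
    ultimately show ?thesis using elim c cK
      by (simp add: V'_def F_closed val_divide_nonneg_iff)
  qed
  then have "poly_over V' P" by (simp add: poly_over_def)
  moreover have "U i / ?d \<in> V'"
    using d UK by (simp add: V'_def F_closed val_divide_nonneg_iff)
  ultimately have "poly_over V' (P \<circ>\<^sub>p [:1, U i / ?d:])"
    by (intro poly_over_closed[OF subring_V'] V'_closed)
  \<comment> \<open>An integral affine substitution moves the centre from x to v i, after which the
    coefficients lie in both V' and K, that is, in V.\<close>
  moreover have "P \<circ>\<^sub>p [:1, U i / ?d:] = smult (1 / c) Q"
  proof -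
    have "[:x, 1:] \<circ>\<^sub>p [:0, ?d:] \<circ>\<^sub>p [:1, U i / ?d:] = [:v i, U i:]"
      using d(2) by (simp add: pcompose_pCons)
    then show ?thesis unfolding P_def Q_def pcompose_smult
      by (simp add: pcompose_assoc flip: pcompose_assoc)
  qed
  moreover have "poly_over K (smult (1 / c) Q)"
    unfolding Q_def using f(1) c U by (intro K_poly_closed K_closed v_in) auto
  ultimately have g: "poly_over V (smult (1 / c) Q)" by (simp add: poly_over_def V_def V'_def)
  have "v i + U i * ?X = x" using UK by simp
  then have eq: "poly (smult (1 / c) Q) ?X = poly f x / c" by (simp add: Q_def poly_pcompose)
  moreover have "val (poly f x / c) = Some 0" using c cK fx by (simp add: val_divide_zero_iff)
  ultimately show ?case using g c
    by (intro bexI[of _ c] exI[of _ "smult (1 / c) Q"]) auto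
qed

text \<open>\<open>R i\<close> inverts all elements of V[\<open>Y i\<close>] of value 0, the most
  that V' permits. To reach z = f(x) / g(x), one index i has to serve numerator and denominator at
  once, which holds for all large i.\<close>

lemma filtered_union_if_ev_const:
  assumes gen: "K' = field_adjoin K x" and ev: "\<And>f. poly_over K f \<Longrightarrow> ev_const f"
  shows "filtered_union_loc_poly V V'"
proof -
  have "\<exists>b\<in>K. b \<noteq> 0 \<and> val b = val (x - v i)" for i
    by (rule exists_same_value[OF F_closed(6)[OF x_in v_in'] x_v_neq])
  then obtain U where U: "\<And>i. U i \<in> K \<and> U i \<noteq> 0 \<and> val (U i) = val (x - v i)" by metis
  have UK: "U i \<in> K" "U i \<in> K'" "U i \<noteq> 0" "val (U i) = val (x - v i)" for i using U[of i] K_in by auto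
  define Y where "Y = (\<lambda>i. (x - v i) / U i)"
  define S where "S = (\<lambda>i. {s \<in> poly_subalg V (Y i). val s = Some 0})"
  define R where "R = (\<lambda>i. {a / s | a s. a \<in> poly_subalg V (Y i) \<and> s \<in> S i})"
  have Y': "Y i \<in> V'" for i
  proof -
    have "x - v i \<in> K'" by (intro F_closed x_in v_in')
    then have "vle (Some 0) (val (Y i))" "Y i \<in> K'"
      unfolding Y_def using UK[of i] val_divide_nonneg_iff[of "x - v i" "U i"] F_closed(9) by auto
    then show ?thesis by (simp add: V'_def)
  qed
  have subalg_V': "a \<in> V'" if "a \<in> poly_subalg V (Y i)" for a i
    using that unfolding poly_subalg_def by (auto intro: poly_over_poly[OF subring_V'] poly_over_V_V' Y')
  have R_V': "R i \<subseteq> V'" for i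
  proof
    fix b assume "b \<in> R i"
    then obtain a s where as: "b = a / s" "a \<in> V'" "s \<in> V'" "val s = Some 0"
      using subalg_V' by (auto simp: R_def S_def)
    moreover have "s \<noteq> 0" using as(4) by auto
    ultimately show "b \<in> V'" by (simp add: V'_def F_closed val_divide_nonneg_iff)
  qed
  have loc: "is_loc_poly_subalg V (R i)" for i
    unfolding is_loc_poly_subalg_def
  proof (intro exI conjI ballI)
    show "transcendental_over V (Y i)"
      unfolding transcendental_over_def
    proof safe
      fix p assume p: "poly_over V p" "poly p (Y i) = 0" and "p \<noteq> 0"
      let ?q = "p \<circ>\<^sub>p [:- v i / U i, 1 / U i:]"
      have "poly_over K ?q" by (intro K_poly_closed poly_over_V_K p K_closed v_in UK)
      moreover have "?q \<noteq> 0" using \<open>p \<noteq> 0\<close> UK(3)[of i] by (subst pcompose_eq_0_iff) auto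
      moreover have "poly ?q x = 0" using p(2) by (simp add: poly_pcompose Y_def diff_divide_distrib)
      ultimately show False using trans by (auto simp: transcendental_over_def)
    qed
    show "S i \<subseteq> poly_subalg V (Y i)" by (auto simp: S_def)
    have "poly 1 (Y i) \<in> poly_subalg V (Y i)" by (intro poly_subalgI V_poly_closed)
    then show "1 \<in> S i" by (simp add: S_def)
    show "0 \<notin> S i" by (simp add: S_def)
    show "R i = {a / s | a s. a \<in> poly_subalg V (Y i) \<and> s \<in> S i}" by (simp add: R_def)
    fix s t assume "s \<in> S i" "t \<in> S i"
    then have st: "s \<in> poly_subalg V (Y i)" "t \<in> poly_subalg V (Y i)" "val s = Some 0" "val t = Some 0"
      by (auto simp: S_def)
    then obtain p q where pq: "s = poly p (Y i)" "t = poly q (Y i)" "poly_over V p" "poly_over V q"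
      by (auto simp: poly_subalg_def)
    have "s \<in> K'" "t \<in> K'" using st subalg_V' V'_in by blast+
    with st have "val (s * t) = Some 0" by (simp add: val_mult)
    moreover have "s * t = poly (p * q) (Y i)" "poly_over V (p * q)" using pq by (auto intro: V_poly_closed)
    ultimately show "s * t \<in> S i" unfolding S_def poly_subalg_def by blast
  qed
  have mono: "R i \<subseteq> R j" if "i < j" for i j
  proof -
    \<comment> \<open>For i < j, \<open>Y i\<close> is an affine function of \<open>Y j\<close>;
      both coefficients are integral since val (v j - v i) = val (x - v i) and val (U j) > val (U
      i).\<close>
    let ?q = "[:(v j - v i) / U i, U j / U i:]"
    have "val (v j - v i) = val (x - v i)"
      using lim that by (simp add: pseudo_limit_def val_diff_commute v_in')
    then have "(v j - v i) / U i \<in> V"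
      using UK[of i] by (simp add: V_def K_closed v_in val_divide_nonneg_iff F_closed v_in')
    moreover have "U j / U i \<in> V"
      using x_v_less[OF that] UK[of i] UK[of j] by (simp add: V_def K_closed val_divide_nonneg_iff vord.less_imp_le)
    ultimately have q: "poly_over V ?q" by (intro V_poly_closed)
    have "poly ?q (Y j) = Y i" using UK[of i] UK[of j] by (simp add: Y_def field_simps)
    then have "poly p (Y i) = poly (p \<circ>\<^sub>p ?q) (Y j)" for p by (simp only: poly_pcompose)
    then have "poly_subalg V (Y i) \<subseteq> poly_subalg V (Y j)"
      using V_poly_closed(7)[OF _ q] unfolding poly_subalg_def by blast
    then show ?thesis unfolding R_def S_def by blast
  qed
  have union: "V' \<subseteq> (\<Union>i. R i)"
  proof
    fix z assume z: "z \<in> V'"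
    then have zK: "z \<in> K'" "vle (Some 0) (val z)" by (auto simp: V'_def)
    obtain f g where fg: "z = poly f x / poly g x" "poly_over K f" "poly_over K g" "poly g x \<noteq> 0"
      using field_adjoin_subset_fractions[OF subK, of x] zK(1) unfolding gen[symmetric] by blast
    show "z \<in> (\<Union>i. R i)"
    proof (cases "poly f x = 0")
      case True
      obtain i :: 'i where True by simp
      have "poly 1 (Y i) \<in> poly_subalg V (Y i)" "poly 0 (Y i) \<in> poly_subalg V (Y i)"
        by (intro poly_subalgI V_poly_closed)+
      then have "0 / 1 \<in> R i" unfolding R_def S_def by fastforce
      with True fg show ?thesis by auto
    next
      case False
      have "eventually (\<lambda>i. z \<in> R i) at_top"
        using unit_representation[OF fg(2) False ev[OF fg(2)] U] unit_representation[OF fg(3,4) ev[OF fg(3)] U]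
      proof eventually_elim
        case (elim i)
        then obtain c p d q where c: "c \<in> K" "c \<noteq> 0" "poly_over V p" "poly f x = c * poly p (Y i)" "val (poly p (Y i)) = Some 0"
          and d: "d \<in> K" "d \<noteq> 0" "poly_over V q" "poly g x = d * poly q (Y i)" "val (poly q (Y i)) = Some 0"
          unfolding Y_def by blast
        have pK: "poly p (Y i) \<in> K'" "poly q (Y i) \<in> K'"
          using c(3) d(3) by (auto intro: V'_in subalg_V' poly_subalgI)
        have q0: "poly q (Y i) \<noteq> 0" using d(5) by auto
        have zeq: "z = (c / d) * poly p (Y i) / poly q (Y i)" by (simp add: fg(1) c(4) d(4))
        have "c / d * poly p (Y i) = z * poly q (Y i)" using q0 by (simp add: zeq)
        then have "vplus (val (c / d)) (val (poly p (Y i))) = vplus (val z) (val (poly q (Y i)))"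
          using c(1) d(1) pK zK K_in by (metis F_closed(9) val_mult)
        \<comment> \<open>Both polynomial values are units, so c / d inherits the nonnegative value
          of z and can be absorbed into the numerator as an element of V.\<close>
        then have "val (c / d) = val z" using c(5) d(5) by (cases "val (c / d)"; cases "val z") auto
        then have "c / d \<in> V" using zK c d by (simp add: V_def K_closed)
        then have "poly (smult (c / d) p) (Y i) \<in> poly_subalg V (Y i)" "poly q (Y i) \<in> S i"
          unfolding S_def using c(3) d(3,5) by (auto intro!: poly_subalgI V_poly_closed simp del: poly_smult)
        then show "z \<in> R i" unfolding R_def zeq by fastforce
      qed
      then show ?thesis unfolding eventually_at_top_linorder by blast
    qed
  qed
  show ?thesis
    unfolding filtered_union_loc_poly_def
  proof (intro exI[of _ "range R"] conjI ballI)
    show "range R \<noteq> {}" by simp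
    show "\<Union> (range R) = V'" using union R_V' by blast
    show "is_loc_poly_subalg V Q" "Q \<subseteq> V'" if "Q \<in> range R" for Q using that loc R_V' by auto
    fix Q1 Q2 assume "Q1 \<in> range R" "Q2 \<in> range R"
    then obtain i j where ij: "Q1 = R i" "Q2 = R j" by blast
    then have "Q1 \<union> Q2 \<subseteq> R (max i j)"
      using mono[of i j] mono[of j i] by (cases i j rule: linorder_cases) (auto simp: max_def)
    then show "\<exists>Q3\<in>range R. Q1 \<union> Q2 \<subseteq> Q3" by blast
  qed
qed

section \<open>Specialization of the localization variable\<close>

lemma poly_congruent:
  assumes p: "poly_over V p" and z: "z \<in> V'" "\<zeta> \<in> V" "vless (Some 0) (val (z - \<zeta>))"
  shows "vless (Some 0) (val (poly p z - poly p \<zeta>))"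
  using p
proof (induction p)
  case 0
  then show ?case by (simp add: vless_None_iff)
next
  case (pCons a p)
  have p: "poly_over V p" using pCons.prems unfolding poly_over_def by (metis coeff_pCons_Suc)
  have zV: "z \<in> V'" "\<zeta> \<in> V'" using z V_in_V' by auto
  then have V: "poly p z \<in> V'" "poly p \<zeta> \<in> V'"
    using p by (auto intro!: poly_over_poly[OF subring_V'] poly_over_V_V')
  have "vle (val (poly p z - poly p \<zeta>)) (val (z * (poly p z - poly p \<zeta>)))"
    using V zV by (intro val_mult_nonneg) (auto simp: V'_def F_closed)
  with pCons.IH[OF p] have 1: "vless (Some 0) (val (z * (poly p z - poly p \<zeta>)))" by (rule vord.less_le_trans)
  have "vle (val (z - \<zeta>)) (val (poly p \<zeta> * (z - \<zeta>)))"
    using V zV by (intro val_mult_nonneg) (auto simp: V'_def F_closed)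
  with z(3) have 2: "vless (Some 0) (val (poly p \<zeta> * (z - \<zeta>)))" by (rule vord.less_le_trans)
  have "poly (pCons a p) z - poly (pCons a p) \<zeta> = z * (poly p z - poly p \<zeta>) + poly p \<zeta> * (z - \<zeta>)"
    by (simp add: algebra_simps)
  then show ?case using val_add_gt[OF _ _ 1 2] V zV V'_closed V'_in by simp
qed

text \<open>The relations expressing x and f(x) / c through z are polynomial identities over V,
  because z is transcendental. They survive replacing z by \<zeta> in V from the same residue class,
  and so do the unit values of the denominators and of the numerator of f(x) / c.\<close>

lemma value_attained_if_filtered_union:
  assumes res: "\<forall>a\<in>V'. \<exists>b\<in>V. vless (Some 0) (val (a - b))"
    and filt: "filtered_union_loc_poly V V'" and f: "poly_over V f" "poly f x \<noteq> 0"
  shows "\<exists>y\<in>V. val (poly f y) = val (poly f x)"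
proof -
  have xV: "x \<in> V'" by (simp add: V'_def x_in x_nonneg)
  have fx: "poly f x \<in> V'" by (intro poly_over_poly[OF subring_V'] poly_over_V_V' f xV)
  then obtain c where c: "c \<in> K" "c \<noteq> 0" "val c = val (poly f x)" using exists_same_value f(2) V'_in by blast
  have cV: "c \<in> V" "c \<in> K'" using c fx by (auto simp: V_def V'_def K_in)
  \<comment> \<open>A unit of V'. Having it in the same localization as x, by directedness, is what
    carries the value of f(x) over to f(y); x alone would only produce a point y.\<close>
  define w where "w = poly f x / c"
  have w0: "val w = Some 0"
    unfolding w_def using c cV V'_in[OF fx] by (subst val_divide_zero_iff) auto
  have wV: "w \<in> V'" using w0 cV V'_in[OF fx] by (auto simp: V'_def w_def F_closed)
  obtain Fam where Fam: "\<forall>R\<in>Fam. is_loc_poly_subalg V R \<and> R \<subseteq> V'"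
    "\<forall>R1\<in>Fam. \<forall>R2\<in>Fam. \<exists>R3\<in>Fam. R1 \<union> R2 \<subseteq> R3" "\<Union>Fam = V'"
    using filt unfolding filtered_union_loc_poly_def by (elim exE conjE) (rule that)
  obtain R where R: "R \<in> Fam" "x \<in> R" "w \<in> R" 
  proof -
    obtain R1 R2 where "R1 \<in> Fam" "x \<in> R1" "R2 \<in> Fam" "w \<in> R2" using xV wV Fam(3) by blast
    moreover from this obtain R3 where "R3 \<in> Fam" "R1 \<union> R2 \<subseteq> R3" using Fam(2) by blast
    ultimately show ?thesis using that by blast
  qed
  then have RV: "R \<subseteq> V'" using Fam(1) by blast
  obtain z S where zS: "transcendental_over V z" "S \<subseteq> poly_subalg V z" "1 \<in> S" "0 \<notin> S"
    and R_eq: "R = {a / s | a s. a \<in> poly_subalg V z \<and> s \<in> S}"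
    using bspec[OF Fam(1) R(1)] unfolding is_loc_poly_subalg_def by (elim exE conjE) (rule that)
  have sub_R: "a \<in> V'" if "a \<in> poly_subalg V z" for a
    using that zS(3) RV unfolding R_eq by force
  have "poly [:0, 1:] z \<in> poly_subalg V z" by (intro poly_subalgI V_poly_closed V_closed)
  then have zV: "z \<in> V'" using sub_R by fastforce
  \<comment> \<open>Both s and 1 / s lie in V', the latter because 1 / s belongs to R.\<close>
  have S_unit: "val s = Some 0" if "s \<in> S" for s
  proof -
    have "s \<in> V'" using that zS(2) sub_R by blast
    moreover have "poly 1 z \<in> poly_subalg V z" by (intro poly_subalgI V_poly_closed)
    then have "1 / s \<in> V'" using that RV unfolding R_eq by fastforce
    moreover have "s \<noteq> 0" using that zS(4) by blast
    ultimately show ?thesis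
      using val_divide_nonneg_iff[of 1 s] F_closed(2) by (auto simp: V'_def)
  qed
  obtain pa ps where x_eq: "x = poly pa z / poly ps z" "poly_over V pa" "poly_over V ps" "poly ps z \<in> S"
    using R(2) zS(2) unfolding R_eq poly_subalg_def by blast
  obtain pb pt where w_eq: "w = poly pb z / poly pt z" "poly_over V pb" "poly_over V pt" "poly pt z \<in> S"
    using R(3) zS(2) unfolding R_eq poly_subalg_def by blast
  obtain \<zeta> where \<zeta>: "\<zeta> \<in> V" "vless (Some 0) (val (z - \<zeta>))" using res zV by blast
  have V'p: "poly p z \<in> K'" "poly p \<zeta> \<in> K'" if "poly_over V p" for p
    by (intro F_poly poly_over_K_K' poly_over_V_K that V'_in[OF zV] K_in V_in[OF \<zeta>(1)])+
  have unit_\<zeta>: "val (poly p \<zeta>) = Some 0" if p: "poly_over V p" "val (poly p z) = Some 0" for p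
  proof -
    have "vless (val (poly p z)) (val (- (poly p z - poly p \<zeta>)))"
      using poly_congruent[OF p(1) zV \<zeta>] V'p[OF p(1)] p(2) by (simp only: val_uminus F_closed)
    then have "val (poly p z + - (poly p z - poly p \<zeta>)) = val (poly p z)"
      by (intro val_add_eq F_closed V'p p(1))
    then show ?thesis using p(2) by simp
  qed
  have s1: "val (poly ps z) = Some 0" "val (poly ps \<zeta>) = Some 0"
    using S_unit x_eq unit_\<zeta> by auto
  have t1: "val (poly pt z) = Some 0" "val (poly pt \<zeta>) = Some 0"
    using S_unit w_eq unit_\<zeta> by auto
  have nz: "poly ps z \<noteq> 0" "poly ps \<zeta> \<noteq> 0" "poly pt z \<noteq> 0" "poly pt \<zeta> \<noteq> 0" using s1 t1 by auto
  have "val (poly pb z) = Some 0"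
    using w0 t1(1) nz V'p w_eq by (simp add: val_divide_zero_iff)
  then have b1: "val (poly pb \<zeta>) = Some 0" using unit_\<zeta> w_eq by blast
  define y where "y = poly pa \<zeta> / poly ps \<zeta>"
  have yV: "y \<in> V"
  proof -
    have "poly pa \<zeta> \<in> V" "poly ps \<zeta> \<in> V"
      using x_eq \<zeta> by (auto intro: poly_over_poly[OF subring_V])
    then show ?thesis
      unfolding y_def using s1 nz by (simp add: V_def K_closed K_in val_divide_nonneg_iff)
  qed
  define n where "n = degree f"
  \<comment> \<open>The homogenization ps^n f(pa / ps), free of denominators.\<close>
  define H where "H = (\<Sum>i\<le>n. smult (coeff f i) (pa ^ i * ps ^ (n - i)))"
  have polyH: "poly H \<tau> = poly ps \<tau> ^ n * poly f (poly pa \<tau> / poly ps \<tau>)" if "poly ps \<tau> \<noteq> 0" for \<tau>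
    unfolding H_def poly_sum poly_altdef[of f] n_def[symmetric] sum_distrib_left
  proof (rule sum.cong)
    fix i assume "i \<in> {..n}"
    then have "poly ps \<tau> ^ n = poly ps \<tau> ^ (n - i) * poly ps \<tau> ^ i" by (simp flip: power_add)
    then show "poly (smult (coeff f i) (pa ^ i * ps ^ (n - i))) \<tau>
        = poly ps \<tau> ^ n * (coeff f i * (poly pa \<tau> / poly ps \<tau>) ^ i)"
      using that by (simp add: power_divide)
  qed simp
  have HV: "poly_over V H"
    unfolding H_def using x_eq f(1)
    by (intro poly_over_sum[OF subring_V] V_poly_closed poly_over_power[OF subring_V] poly_over_coeff)
  \<comment> \<open>This is f(x) = c w with denominators cleared. It holds at the transcendental z,
    hence identically, and can then be evaluated at \<zeta>.\<close>
  have "H * pt = smult c (pb * ps ^ n)"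
  proof (rule ccontr)
    assume "H * pt \<noteq> smult c (pb * ps ^ n)"
    then have "H * pt - smult c (pb * ps ^ n) \<noteq> 0" by simp
    moreover have "poly_over V (H * pt - smult c (pb * ps ^ n))"
      by (intro V_poly_closed poly_over_power[OF subring_V] HV x_eq w_eq cV)
    moreover have "poly (H * pt) z = poly (smult c (pb * ps ^ n)) z"
    proof -
      have "c * poly pb z = poly f x * poly pt z" using w_eq(1) c(2) nz by (simp add: w_def field_simps)
      then show ?thesis using polyH[OF nz(1)] by (simp add: x_eq(1)[symmetric])
    qed
    ultimately show False using zS(1) by (auto simp: transcendental_over_def)
  qed
  then have "poly H \<zeta> * poly pt \<zeta> = c * (poly pb \<zeta> * poly ps \<zeta> ^ n)"
    by (metis poly_mult poly_smult poly_power)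
  then have eq: "poly f y * poly pt \<zeta> = c * poly pb \<zeta>"
    using polyH[OF nz(2)] nz(2) by (simp add: y_def)
  have fyK: "poly f y \<in> K'" by (intro F_poly poly_over_K_K' poly_over_V_K f K_in V_in yV)
  have "vplus (val (poly f y)) (Some 0) = vplus (val c) (Some 0)"
    using arg_cong[OF eq, of val] t1(2) b1 fyK cV V'p w_eq by (simp add: val_mult)
  then have "val (poly f y) = val c" by (cases "val (poly f y)"; cases "val c") auto
  with c yV show ?thesis by auto
qed

end

theorem theorem3p2:
  fixes K K' V V' :: "'a::field set"
    and val :: "'a \<Rightarrow> 'g::linordered_ab_group_add option"
    and v :: "'i::wellorder \<Rightarrow> 'a"
    and x :: 'a
  assumes fields: "subfield K" "subfield K'" "K \<subseteq> K'"
    and val: "valuation_on K' val"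
    and V': "V' = {a \<in> K'. vle (Some 0) (val a)}"
    and V: "V = V' \<inter> K"
    and imm_group: "val ` (K' - {0}) = val ` (K - {0})"
    and imm_res: "\<forall>a\<in>V'. \<exists>b\<in>V. vless (Some 0) (val (a - b))"
    and v_in: "range v \<subseteq> V"
    and pc: "pseudo_convergent val v"
    and not_fund: "\<not> fundamental (the ` val ` (K - {0})) val v"
    and x_in: "x \<in> V'"
    and lim: "pseudo_limit val v x"
    and no_lim: "\<not> (\<exists>y\<in>K. pseudo_limit val v y)"
    and gen: "K' = field_adjoin K x"
    and trans: "transcendental_over K x"
    and dim_or_hens: "krull_dim_one V \<or> henselian V {a \<in> V. vless (Some 0) (val a)}"
  shows "((\<forall>f. poly_over V f \<and> poly f x \<noteq> 0 \<longrightarrow> (\<exists>y\<in>V. val (poly f y) = val (poly f x)))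
           \<longleftrightarrow> (\<forall>f. poly_over V f \<and> poly f x \<noteq> 0 \<longrightarrow> (\<exists>y\<in>V. vle (val (poly f x)) (val (poly f y)))))
       \<and> ((\<forall>f. poly_over V f \<and> poly f x \<noteq> 0 \<longrightarrow> (\<exists>y\<in>V. vle (val (poly f x)) (val (poly f y))))
           \<longleftrightarrow> transcendental_seq V val v)
       \<and> (transcendental_seq V val v \<longleftrightarrow> filtered_union_loc_poly V V')"
proof -
  have K_eq: "{a \<in> K. vle (Some 0) (val a)} = V" using fields(3) by (auto simp: V V')
  interpret E: pseudo_limit_extension K' val K v x
  proof
    show "v i \<in> K" "vle (Some 0) (val (v i))" for i using v_in by (auto simp: V V')
    show "x \<in> K'" "vle (Some 0) (val x)" using x_in by (auto simp: V')
  qed (fact fields(1) fields(2) fields(3) val imm_group pc lim no_lim trans)+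
  have EV: "E.V = V" "E.V' = V'" by (simp_all add: E.V_def E.V'_def K_eq V')
  have mm: "E.mm = {a \<in> V. vless (Some 0) (val a)}" by (simp add: E.mm_def EV)
  let ?one = "\<forall>f. poly_over V f \<and> poly f x \<noteq> 0 \<longrightarrow> (\<exists>y\<in>V. val (poly f y) = val (poly f x))"
  let ?two = "\<forall>f. poly_over V f \<and> poly f x \<noteq> 0 \<longrightarrow> (\<exists>y\<in>V. vle (val (poly f x)) (val (poly f y)))"
  \<comment> \<open>The equivalences follow from the cycle (1), (2), (3), (4), (1).\<close>
  have "?one \<Longrightarrow> ?two" by (metis vord.order_refl)
  moreover have "?two \<Longrightarrow> transcendental_seq V val v"
    using E.ev_const_if_values_attained dim_or_hens unfolding E.transcendental_seq_iff[unfolded EV] mm EV by blast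
  moreover have "transcendental_seq V val v \<Longrightarrow> filtered_union_loc_poly V V'"
    using E.filtered_union_if_ev_const[OF gen] unfolding E.transcendental_seq_iff[unfolded EV] EV by blast
  moreover have "filtered_union_loc_poly V V' \<Longrightarrow> ?one"
    using E.value_attained_if_filtered_union imm_res unfolding EV by blast
  ultimately show ?thesis by blast
qed

end
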